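(* Let $k$ be a field having a primitive cube root of unity. If $(a,b,c)$ and $(a',b',c')$ belong to $\mathfrak{D}$, then the degenerate Sklyanin algebras $S_{a,b,c}$ and $S_{a',b',c'}$ are Zhang twists of one another, and their categories of graded right modules are equivalent: $$\mathsf{Gr}\,S_{a,b,c}\equiv \mathsf{Gr}\,S_{a',b',c'}.$$
   Context: $k$ is a field having a primitive cube root of unity. $\mathfrak{D}\subset\mathbb{P}^2_k$ is the set of 12 points $$\mathfrak{D}=\{(1,0,0),(0,1,0),(0,0,1)\}\sqcup\{(a,b,c)\mid a^3=b^3=c^3\}.$$ For $(a,b,c)\in\mathfrak{D}$, the degenerate 3-dimensional Sklyanin algebra is $S_{a,b,c}=k\langle x,y,z\rangle/(f_1,f_2,f_3)$, where $$f_1=ayz+bzy+cx^2,\qquad f_2=azx+bxz+cy^2,\qquad f_3=axy+byx+cz^2,$$ graded with $\deg x=\deg y=\deg z=1$. Given a graded $k$-algebra $B=\bigoplus_{n\ge 0}B_n$ and a graded $k$-algebra automorphism $\tau$ of $B$, the Zhang twist of $B$ by $\tau$ is the graded vector space $B$ with the new multiplication $b*b'=b\,\tau^{m}(b')$ for $b\in B_m$, $b'\in B$. A graded algebra is called a Zhang twist of $B$ if it is isomorphic as a graded algebra to such a twist. $\mathsf{Gr}\,B$ denotes the category of $\mathbb{Z}$-graded right $B$-modules with degree-preserving homomorphisms; $\equiv$ denotes equivalence of categories. *)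

theory Defs
  imports "HOL-Algebra.Module" "HOL-Algebra.QuotRing" "HOL-Algebra.Multiplicative_Group"
begin

section \<open>Graded algebras\<close>

text \<open>
  \<open>M = \<Oplus>\<^sub>i H i\<close> as an internal direct sum of additive subgroups. The index set is a type, so
  the same notion serves gradings by \<open>nat\<close> and by \<open>int\<close>.
\<close>

definition decomposition ::
    "('a, 'r) ring_scheme \<Rightarrow> ('i \<Rightarrow> 'a set) \<Rightarrow> 'a \<Rightarrow> ('i \<Rightarrow> 'a) \<Rightarrow> bool" where
  "decomposition M H x c \<longleftrightarrow>
     (\<forall>i. c i \<in> H i) \<and> finite {i. c i \<noteq> \<zero>\<^bsub>M\<^esub>} \<and> x = finsum M c {i. c i \<noteq> \<zero>\<^bsub>M\<^esub>}"

definition internal_direct_sum :: "('a, 'r) ring_scheme \<Rightarrow> ('i \<Rightarrow> 'a set) \<Rightarrow> bool" where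
  "internal_direct_sum M H \<longleftrightarrow>
     (\<forall>i. additive_subgroup (H i) M) \<and> (\<forall>x \<in> carrier M. \<exists>!c. decomposition M H x c)"

definition component ::
    "('a, 'r) ring_scheme \<Rightarrow> ('i \<Rightarrow> 'a set) \<Rightarrow> 'a \<Rightarrow> 'i \<Rightarrow> 'a" where
  "component M H x = (THE c. decomposition M H x c)"

record ('k, 'b) graded_alg = "('k, 'b) module" +
  homog :: "nat \<Rightarrow> 'b set"

text \<open>
  The library locale \<open>algebra\<close> requires commutativity, so the axioms are stated here. The locale
  \<open>module\<close> only uses the additive structure of its second argument.
\<close>

locale graded_algebra = K: field K + module K B + B: ring B
  for K :: "('k, 'r) ring_scheme" and B :: "('k, 'b, 's) graded_alg_scheme" +
  assumes smult_mult_left: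
      "\<lbrakk>a \<in> carrier K; x \<in> carrier B; y \<in> carrier B\<rbrakk>
        \<Longrightarrow> (a \<odot>\<^bsub>B\<^esub> x) \<otimes>\<^bsub>B\<^esub> y = a \<odot>\<^bsub>B\<^esub> (x \<otimes>\<^bsub>B\<^esub> y)"
    and smult_mult_right:
      "\<lbrakk>a \<in> carrier K; x \<in> carrier B; y \<in> carrier B\<rbrakk>
        \<Longrightarrow> x \<otimes>\<^bsub>B\<^esub> (a \<odot>\<^bsub>B\<^esub> y) = a \<odot>\<^bsub>B\<^esub> (x \<otimes>\<^bsub>B\<^esub> y)"
    and homog_direct_sum: "internal_direct_sum B (homog B)"
    and homog_smult: "\<lbrakk>a \<in> carrier K; x \<in> homog B n\<rbrakk> \<Longrightarrow> a \<odot>\<^bsub>B\<^esub> x \<in> homog B n"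
    and homog_one: "\<one>\<^bsub>B\<^esub> \<in> homog B 0"
    and homog_mult: "\<lbrakk>x \<in> homog B m; y \<in> homog B n\<rbrakk> \<Longrightarrow> x \<otimes>\<^bsub>B\<^esub> y \<in> homog B (m + n)"

definition graded_alg_iso ::
    "('k, 'r) ring_scheme \<Rightarrow> ('k, 'b, 's) graded_alg_scheme \<Rightarrow> ('k, 'c, 't) graded_alg_scheme
      \<Rightarrow> ('b \<Rightarrow> 'c) set" where
  "graded_alg_iso K B C = {\<phi> \<in> ring_iso B C.
     (\<forall>a \<in> carrier K. \<forall>x \<in> carrier B. \<phi> (a \<odot>\<^bsub>B\<^esub> x) = a \<odot>\<^bsub>C\<^esub> \<phi> x) \<and>
     (\<forall>n. \<phi> ` homog B n = homog C n)}"


section \<open>Zhang twists\<close>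

text \<open>
  The rule \<open>x * y = x \<tau>\<^sup>m(y)\<close> for \<open>x\<close> homogeneous of degree \<open>m\<close>, extended additively in \<open>x\<close>.
\<close>

definition zhang_twist ::
    "('k, 'b, 's) graded_alg_scheme \<Rightarrow> ('b \<Rightarrow> 'b) \<Rightarrow> ('k, 'b, 's) graded_alg_scheme" where
  "zhang_twist B \<tau> = B\<lparr>mult := \<lambda>x y.
     let c = component B (homog B) x
     in finsum B (\<lambda>m. c m \<otimes>\<^bsub>B\<^esub> (\<tau> ^^ m) y) {m. c m \<noteq> \<zero>\<^bsub>B\<^esub>}\<rparr>"

definition is_zhang_twist_of ::
    "('k, 'r) ring_scheme \<Rightarrow> ('k, 'c, 't) graded_alg_scheme \<Rightarrow> ('k, 'b, 's) graded_alg_scheme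
      \<Rightarrow> bool" where
  "is_zhang_twist_of K C B \<longleftrightarrow>
     graded_algebra K B \<and>
     (\<exists>\<tau> \<in> graded_alg_iso K B B. graded_alg_iso K C (zhang_twist B \<tau>) \<noteq> {})"


section \<open>Free algebras and quotients\<close>

text \<open>
  \<open>K\<langle>'v\<rangle>\<close>: an element is its coefficient function on words, finitely supported; the product
  convolves over all factorisations of a word into a prefix and a suffix.
\<close>

definition free_alg :: "('k, 'r) ring_scheme \<Rightarrow> ('k, 'v list \<Rightarrow> 'k) graded_alg" where
  "free_alg K =
     \<lparr>carrier = {p. (\<forall>w. p w \<in> carrier K) \<and> finite {w. p w \<noteq> \<zero>\<^bsub>K\<^esub>}},
      mult = (\<lambda>p q w. finsum K (\<lambda>i. p (take i w) \<otimes>\<^bsub>K\<^esub> q (drop i w)) {..length w}),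
      one = (\<lambda>w. if w = [] then \<one>\<^bsub>K\<^esub> else \<zero>\<^bsub>K\<^esub>),
      zero = (\<lambda>w. \<zero>\<^bsub>K\<^esub>),
      add = (\<lambda>p q w. p w \<oplus>\<^bsub>K\<^esub> q w),
      smult = (\<lambda>a p w. a \<otimes>\<^bsub>K\<^esub> p w),
      homog = (\<lambda>n. {p. (\<forall>w. p w \<in> carrier K) \<and> finite {w. p w \<noteq> \<zero>\<^bsub>K\<^esub>} \<and>
                       (\<forall>w. p w \<noteq> \<zero>\<^bsub>K\<^esub> \<longrightarrow> length w = n)})\<rparr>"

definition free_gen :: "('k, 'r) ring_scheme \<Rightarrow> 'v \<Rightarrow> 'v list \<Rightarrow> 'k" where
  "free_gen K v = (\<lambda>w. if w = [v] then \<one>\<^bsub>K\<^esub> else \<zero>\<^bsub>K\<^esub>)"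

text \<open>
  \<open>Quot\<close> extended by the induced scalar multiplication (on cosets, in the style of
  \<open>rcoset_mult\<close>) and the induced grading.
\<close>

definition quot_alg ::
    "('k, 'b, 's) graded_alg_scheme \<Rightarrow> 'b set \<Rightarrow> ('k, 'b set) graded_alg" where
  "quot_alg B I =
     \<lparr>carrier = carrier (B Quot I),
      mult = mult (B Quot I),
      one = one (B Quot I),
      zero = zero (B Quot I),
      add = add (B Quot I),
      smult = (\<lambda>a X. \<Union>x\<in>X. I +>\<^bsub>B\<^esub> (a \<odot>\<^bsub>B\<^esub> x)),
      homog = (\<lambda>n. (\<lambda>x. I +>\<^bsub>B\<^esub> x) ` homog B n)\<rparr>"


section \<open>Degenerate Sklyanin algebras\<close>

datatype gen3 = Gx | Gy | Gz

definition sklyanin_relations ::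
    "('k, 'r) ring_scheme \<Rightarrow> 'k \<times> 'k \<times> 'k \<Rightarrow> (gen3 list \<Rightarrow> 'k) set" where
  "sklyanin_relations K = (\<lambda>(a, b, c).
     let F = free_alg K; x = free_gen K Gx; y = free_gen K Gy; z = free_gen K Gz
     in {a \<odot>\<^bsub>F\<^esub> (y \<otimes>\<^bsub>F\<^esub> z) \<oplus>\<^bsub>F\<^esub> b \<odot>\<^bsub>F\<^esub> (z \<otimes>\<^bsub>F\<^esub> y) \<oplus>\<^bsub>F\<^esub> c \<odot>\<^bsub>F\<^esub> (x \<otimes>\<^bsub>F\<^esub> x),
         a \<odot>\<^bsub>F\<^esub> (z \<otimes>\<^bsub>F\<^esub> x) \<oplus>\<^bsub>F\<^esub> b \<odot>\<^bsub>F\<^esub> (x \<otimes>\<^bsub>F\<^esub> z) \<oplus>\<^bsub>F\<^esub> c \<odot>\<^bsub>F\<^esub> (y \<otimes>\<^bsub>F\<^esub> y),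
         a \<odot>\<^bsub>F\<^esub> (x \<otimes>\<^bsub>F\<^esub> y) \<oplus>\<^bsub>F\<^esub> b \<odot>\<^bsub>F\<^esub> (y \<otimes>\<^bsub>F\<^esub> x) \<oplus>\<^bsub>F\<^esub> c \<odot>\<^bsub>F\<^esub> (z \<otimes>\<^bsub>F\<^esub> z)})"

definition sklyanin ::
    "('k, 'r) ring_scheme \<Rightarrow> 'k \<times> 'k \<times> 'k \<Rightarrow> ('k, (gen3 list \<Rightarrow> 'k) set) graded_alg" where
  "sklyanin K t = quot_alg (free_alg K) (Idl\<^bsub>free_alg K\<^esub> (sklyanin_relations K t))"

text \<open>
  The projective plane, as the set of classes of nonzero triples up to nonzero scalars. If \<open>t\<close> is
  not such a triple, then \<open>proj_point K t\<close> is empty and hence not a point of the plane.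
\<close>

definition homog_coords :: "('k, 'r) ring_scheme \<Rightarrow> ('k \<times> 'k \<times> 'k) set" where
  "homog_coords K = carrier K \<times> carrier K \<times> carrier K - {(\<zero>\<^bsub>K\<^esub>, \<zero>\<^bsub>K\<^esub>, \<zero>\<^bsub>K\<^esub>)}"

definition proj_rel :: "('k, 'r) ring_scheme \<Rightarrow> (('k \<times> 'k \<times> 'k) \<times> ('k \<times> 'k \<times> 'k)) set" where
  "proj_rel K = {((a, b, c), (a', b', c')).
     (a, b, c) \<in> homog_coords K \<and>
     (\<exists>s \<in> carrier K - {\<zero>\<^bsub>K\<^esub>}. a' = s \<otimes>\<^bsub>K\<^esub> a \<and> b' = s \<otimes>\<^bsub>K\<^esub> b \<and> c' = s \<otimes>\<^bsub>K\<^esub> c)}"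

definition proj_point :: "('k, 'r) ring_scheme \<Rightarrow> 'k \<times> 'k \<times> 'k \<Rightarrow> ('k \<times> 'k \<times> 'k) set" where
  "proj_point K t = proj_rel K `` {t}"

definition degenerate_points :: "('k, 'r) ring_scheme \<Rightarrow> ('k \<times> 'k \<times> 'k) set set" where
  "degenerate_points K =
     {proj_point K (\<one>\<^bsub>K\<^esub>, \<zero>\<^bsub>K\<^esub>, \<zero>\<^bsub>K\<^esub>), proj_point K (\<zero>\<^bsub>K\<^esub>, \<one>\<^bsub>K\<^esub>, \<zero>\<^bsub>K\<^esub>),
      proj_point K (\<zero>\<^bsub>K\<^esub>, \<zero>\<^bsub>K\<^esub>, \<one>\<^bsub>K\<^esub>)} \<union>
     {proj_point K (a, b, c) | a b c. (a, b, c) \<in> homog_coords K \<and>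
        a [^]\<^bsub>K\<^esub> (3::nat) = b [^]\<^bsub>K\<^esub> (3::nat) \<and> b [^]\<^bsub>K\<^esub> (3::nat) = c [^]\<^bsub>K\<^esub> (3::nat)}"


section \<open>Categories and equivalences\<close>

text \<open>
  Arrows need not determine their source and target, so identities and composition are indexed by
  objects: \<open>Cmp C x y z g f\<close> is the composite of \<open>f : x \<rightarrow> y\<close> and \<open>g : y \<rightarrow> z\<close>.
\<close>

record ('o, 'h) cat =
  Ob :: "'o set"
  Hom :: "'o \<Rightarrow> 'o \<Rightarrow> 'h set"
  Idt :: "'o \<Rightarrow> 'h"
  Cmp :: "'o \<Rightarrow> 'o \<Rightarrow> 'o \<Rightarrow> 'h \<Rightarrow> 'h \<Rightarrow> 'h"

locale category =
  fixes C :: "('o, 'h) cat"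
  assumes Idt_closed: "x \<in> Ob C \<Longrightarrow> Idt C x \<in> Hom C x x"
    and Cmp_closed:
      "\<lbrakk>x \<in> Ob C; y \<in> Ob C; z \<in> Ob C; f \<in> Hom C x y; g \<in> Hom C y z\<rbrakk>
        \<Longrightarrow> Cmp C x y z g f \<in> Hom C x z"
    and Idt_left: "\<lbrakk>x \<in> Ob C; y \<in> Ob C; f \<in> Hom C x y\<rbrakk> \<Longrightarrow> Cmp C x y y (Idt C y) f = f"
    and Idt_right: "\<lbrakk>x \<in> Ob C; y \<in> Ob C; f \<in> Hom C x y\<rbrakk> \<Longrightarrow> Cmp C x x y f (Idt C x) = f"
    and Cmp_assoc:
      "\<lbrakk>w \<in> Ob C; x \<in> Ob C; y \<in> Ob C; z \<in> Ob C;
        f \<in> Hom C w x; g \<in> Hom C x y; h \<in> Hom C y z\<rbrakk>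
        \<Longrightarrow> Cmp C w y z h (Cmp C w x y g f) = Cmp C w x z (Cmp C x y z h g) f"

locale cat_functor = source: category C + target: category D
  for C :: "('o, 'h) cat" and D :: "('p, 'i) cat" +
  fixes Fo :: "'o \<Rightarrow> 'p" and Fa :: "'o \<Rightarrow> 'o \<Rightarrow> 'h \<Rightarrow> 'i"
  assumes Fo_closed: "x \<in> Ob C \<Longrightarrow> Fo x \<in> Ob D"
    and Fa_closed:
      "\<lbrakk>x \<in> Ob C; y \<in> Ob C; f \<in> Hom C x y\<rbrakk> \<Longrightarrow> Fa x y f \<in> Hom D (Fo x) (Fo y)"
    and Fa_Idt: "x \<in> Ob C \<Longrightarrow> Fa x x (Idt C x) = Idt D (Fo x)"
    and Fa_Cmp:
      "\<lbrakk>x \<in> Ob C; y \<in> Ob C; z \<in> Ob C; f \<in> Hom C x y; g \<in> Hom C y z\<rbrakk>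
        \<Longrightarrow> Fa x z (Cmp C x y z g f) = Cmp D (Fo x) (Fo y) (Fo z) (Fa y z g) (Fa x y f)"

definition cat_isos :: "('o, 'h) cat \<Rightarrow> 'o \<Rightarrow> 'o \<Rightarrow> 'h set" where
  "cat_isos C x y = {f \<in> Hom C x y. \<exists>g \<in> Hom C y x.
     Cmp C x y x g f = Idt C x \<and> Cmp C y x y f g = Idt C y}"

definition naturally_isomorphic ::
    "('o, 'h) cat \<Rightarrow> ('p, 'i) cat \<Rightarrow> ('o \<Rightarrow> 'p) \<Rightarrow> ('o \<Rightarrow> 'o \<Rightarrow> 'h \<Rightarrow> 'i)
      \<Rightarrow> ('o \<Rightarrow> 'p) \<Rightarrow> ('o \<Rightarrow> 'o \<Rightarrow> 'h \<Rightarrow> 'i) \<Rightarrow> bool" where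
  "naturally_isomorphic C D Fo Fa Go Ga \<longleftrightarrow>
     (\<exists>\<eta>. (\<forall>x \<in> Ob C. \<eta> x \<in> cat_isos D (Fo x) (Go x)) \<and>
          (\<forall>x \<in> Ob C. \<forall>y \<in> Ob C. \<forall>f \<in> Hom C x y.
             Cmp D (Fo x) (Fo y) (Go y) (\<eta> y) (Fa x y f) =
             Cmp D (Fo x) (Go x) (Go y) (Ga x y f) (\<eta> x)))"

definition equivalent_categories :: "('o, 'h) cat \<Rightarrow> ('p, 'i) cat \<Rightarrow> bool" where
  "equivalent_categories C D \<longleftrightarrow>
     (\<exists>Fo Fa Go Ga. cat_functor C D Fo Fa \<and> cat_functor D C Go Ga \<and>
        naturally_isomorphic C C (\<lambda>x. Go (Fo x)) (\<lambda>x y f. Ga (Fo x) (Fo y) (Fa x y f))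
          (\<lambda>x. x) (\<lambda>x y f. f) \<and>
        naturally_isomorphic D D (\<lambda>x. Fo (Go x)) (\<lambda>x y f. Fa (Go x) (Go y) (Ga x y f))
          (\<lambda>x. x) (\<lambda>x y f. f))"


section \<open>Graded right modules\<close>

text \<open>
  As for the library's \<open>module\<close>, only the additive part of the \<open>ring\<close> record is used. The
  \<open>K\<close>-vector space structure is the action of the scalars in \<open>B\<close>.
\<close>

record ('b, 'm) graded_mod = "'m ring" +
  ract :: "'m \<Rightarrow> 'b \<Rightarrow> 'm"
  mhomog :: "int \<Rightarrow> 'm set"

locale graded_right_module = abelian_group M
  for B :: "('k, 'b, 's) graded_alg_scheme" and M :: "('b, 'm) graded_mod" +
  assumes ract_closed: "\<lbrakk>x \<in> carrier M; b \<in> carrier B\<rbrakk> \<Longrightarrow> ract M x b \<in> carrier M"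
    and ract_add_left:
      "\<lbrakk>x \<in> carrier M; y \<in> carrier M; b \<in> carrier B\<rbrakk>
        \<Longrightarrow> ract M (x \<oplus>\<^bsub>M\<^esub> y) b = ract M x b \<oplus>\<^bsub>M\<^esub> ract M y b"
    and ract_add_right:
      "\<lbrakk>x \<in> carrier M; b \<in> carrier B; c \<in> carrier B\<rbrakk>
        \<Longrightarrow> ract M x (b \<oplus>\<^bsub>B\<^esub> c) = ract M x b \<oplus>\<^bsub>M\<^esub> ract M x c"
    and ract_mult:
      "\<lbrakk>x \<in> carrier M; b \<in> carrier B; c \<in> carrier B\<rbrakk>
        \<Longrightarrow> ract M x (b \<otimes>\<^bsub>B\<^esub> c) = ract M (ract M x b) c"
    and ract_one: "x \<in> carrier M \<Longrightarrow> ract M x \<one>\<^bsub>B\<^esub> = x"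
    and mhomog_direct_sum: "internal_direct_sum M (mhomog M)"
    and mhomog_ract: "\<lbrakk>x \<in> mhomog M i; b \<in> homog B n\<rbrakk> \<Longrightarrow> ract M x b \<in> mhomog M (i + int n)"

text \<open>Homomorphisms are extensional, so that equal arrows are equal functions.\<close>

definition graded_mod_hom ::
    "('k, 'b, 's) graded_alg_scheme \<Rightarrow> ('b, 'm) graded_mod \<Rightarrow> ('b, 'm) graded_mod
      \<Rightarrow> ('m \<Rightarrow> 'm) set" where
  "graded_mod_hom B M N = {f \<in> carrier M \<rightarrow>\<^sub>E carrier N.
     (\<forall>x \<in> carrier M. \<forall>y \<in> carrier M. f (x \<oplus>\<^bsub>M\<^esub> y) = f x \<oplus>\<^bsub>N\<^esub> f y) \<and>
     (\<forall>x \<in> carrier M. \<forall>b \<in> carrier B. f (ract M x b) = ract N (f x) b) \<and>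
     (\<forall>i. f ` mhomog M i \<subseteq> mhomog N i)}"

text \<open>
  \<open>Gr B\<close>, relative to a type \<open>'m\<close> that plays the role of the universe in which the underlying
  sets of the modules live.
\<close>

definition Gr ::
    "('k, 'b, 's) graded_alg_scheme \<Rightarrow> (('b, 'm) graded_mod, 'm \<Rightarrow> 'm) cat" where
  "Gr B = \<lparr>Ob = {M. graded_right_module B M},
           Hom = graded_mod_hom B,
           Idt = (\<lambda>M. \<lambda>x \<in> carrier M. x),
           Cmp = (\<lambda>L M N g f. compose (carrier L) g f)\<rparr>"

end

theory Submission
  imports Defs
begin

text \<open>
  Index the generators by \<open>\<int>/3\<close>, with \<open>x, y, z\<close> at \<open>0, 1, 2\<close>, and read \<open>\<kappa> = (c, a, b)\<close> as a function on
  \<open>\<int>/3\<close>. The three relations become \<open>f\<^sub>j = \<Sum>\<^sub>d \<kappa>(d) x\<^sub>j\<^sub>+\<^sub>d x\<^sub>j\<^sub>+\<^sub>2\<^sub>d\<close>. Write \<open>W(n)\<close> for the \<open>n\<close>-th power of \<open>\<omega>\<close>.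
  Up to a scalar, the twelve degenerate parameters \<open>\<kappa>\<close> are the three delta functions \<open>\<delta>\<^sub>e\<close> and the nine
  functions \<open>d \<mapsto> W(2ed + 2gd\<^sup>2)\<close>, since every function from \<open>\<int>/3\<close> to the cube roots of unity is a
  constant times the exponential of a quadratic polynomial.

  Two kinds of substitution relate these parameters. The Fourier substitution
  \<open>x\<^sub>u \<mapsto> \<Sum>\<^sub>i W(ui + gi\<^sup>2) x\<^sub>i\<close> carries the span of the monomial relations of \<open>\<delta>\<^sub>e\<close> onto the span of the
  relations for \<open>d \<mapsto> W(2ed + 2gd\<^sup>2)\<close>; it is invertible because \<open>3 \<noteq> 0\<close> in a field with a primitive cube
  root of unity. So each of the algebras is isomorphic to one of three monomial algebras
  (\<open>isomorphic_monomial_algebra\<close>). Rotating the letter at position \<open>n\<close> of a word by \<open>mn\<close> turns the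
  relations of \<open>\<delta>\<^sub>e\<close> into those of \<open>\<delta>\<^sub>e\<^sub>+\<^sub>m\<close>, because it changes the difference of two adjacent indices
  by \<open>m\<close> (\<open>twisting_system_rotation\<close>); this is a Zhang twist by the rotation automorphism.

  Isomorphisms and twists are treated together as twisting systems: families of graded linear
  bijections \<open>\<phi>\<^sub>i\<close> with \<open>\<phi>\<^sub>i(xy) = \<phi>\<^sub>i(x) \<phi>\<^sub>i\<^sub>+\<^sub>m(y)\<close> for \<open>x\<close> of degree \<open>m\<close>. These can be inverted and composed,
  descend to quotients, and always induce an equivalence of graded module categories
  (\<open>equivalent_module_categories\<close>). A system with \<open>\<phi>\<^sub>i\<^sub>+\<^sub>1 = \<tau> \<circ> \<phi>\<^sub>i\<close> for a single map \<open>\<tau>\<close> exhibits its source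
  as the Zhang twist of its target by \<open>\<tau>\<close> (\<open>is_zhang_twist\<close>). A composite of two twists need not have
  this form, but the composite of one twist with isomorphisms on both sides does
  (\<open>twist_through_isomorphisms\<close>), and any two of the twelve algebras are connected in this way.
\<close>

section \<open>Graded abelian groups\<close>

locale graded_group = abelian_group M for M (structure) +
  fixes H :: "'i \<Rightarrow> 'a set"
  assumes direct_sum: "internal_direct_sum M H"
begin

abbreviation part :: "'a \<Rightarrow> 'i \<Rightarrow> 'a" where
  "part \<equiv> component M H"

lemma homog_subgroup: "additive_subgroup (H i) M"
  using direct_sum by (simp add: internal_direct_sum_def)

lemma homog_closed: "x \<in> H i \<Longrightarrow> x \<in> carrier M"
  using additive_subgroup.a_Hcarr[OF homog_subgroup] by blast

lemma homog_zero: "\<zero> \<in> H i"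
  using additive_subgroup.zero_closed[OF homog_subgroup] .

lemma homog_add: "x \<in> H i \<Longrightarrow> y \<in> H i \<Longrightarrow> x \<oplus> y \<in> H i"
  using additive_subgroup.a_closed[OF homog_subgroup] .

lemma decomposition_part:
  assumes "x \<in> carrier M" shows "decomposition M H x (part x)"
  using assms direct_sum theI'[of "decomposition M H x"]
  unfolding internal_direct_sum_def component_def by blast

lemma part_unique:
  assumes "x \<in> carrier M" "decomposition M H x c" shows "part x = c"
  using assms decomposition_part[OF assms(1)] direct_sum
  unfolding internal_direct_sum_def by blast

lemma part_homog: "x \<in> carrier M \<Longrightarrow> part x i \<in> H i"
  using decomposition_part by (simp add: decomposition_def)

lemma part_closed: "x \<in> carrier M \<Longrightarrow> part x i \<in> carrier M"
  using part_homog homog_closed by blast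

lemma finite_parts: "x \<in> carrier M \<Longrightarrow> finite {i. part x i \<noteq> \<zero>}"
  using decomposition_part by (simp add: decomposition_def)

lemma sum_parts: "x \<in> carrier M \<Longrightarrow> finsum M (part x) {i. part x i \<noteq> \<zero>} = x"
  using decomposition_part by (simp add: decomposition_def)

lemma part_of_homog:
  assumes "x \<in> H j" shows "part x i = (if i = j then x else \<zero>)"
proof -
  have x: "x \<in> carrier M" using assms homog_closed by blast
  have "decomposition M H x (\<lambda>i. if i = j then x else \<zero>)"
  proof (cases "x = \<zero>")
    case True
    then show ?thesis by (auto simp: decomposition_def homog_zero)
  next
    case False
    then have "{i. (if i = j then x else \<zero>) \<noteq> \<zero>} = {j}" by auto
    then show ?thesis using assms x by (auto simp: decomposition_def homog_zero)
  qed
  then show ?thesis using part_unique[OF x] by simp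
qed

lemma homog_induct [consumes 1, case_names homog add]:
  assumes "x \<in> carrier M"
    and homog: "\<And>i y. y \<in> H i \<Longrightarrow> P y"
    and add: "\<And>y z. \<lbrakk>y \<in> carrier M; z \<in> carrier M; P y; P z\<rbrakk> \<Longrightarrow> P (y \<oplus> z)"
  shows "P x"
proof -
  have "P (finsum M (part x) A)" if "finite A" for A
    using that
  proof (induction A)
    case empty
    show ?case using homog[OF homog_zero] by simp
  next
    case (insert i A)
    have "finsum M (part x) (insert i A) = part x i \<oplus> finsum M (part x) A"
      using insert.hyps part_closed[OF assms(1)] by (intro finsum_insert) auto
    then show ?case
      using add[OF part_closed[OF assms(1)] _ homog[OF part_homog[OF assms(1)]] insert.IH]
        part_closed[OF assms(1)] by (simp add: Pi_def)
  qed
  then show ?thesis using finite_parts[OF assms(1)] sum_parts[OF assms(1)] by metis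
qed

lemma part_add:
  assumes x: "x \<in> carrier M" and y: "y \<in> carrier M"
  shows "part (x \<oplus> y) i = part x i \<oplus> part y i"
proof -
  let ?c = "\<lambda>i. part x i \<oplus> part y i"
  let ?A = "{i. part x i \<noteq> \<zero>} \<union> {i. part y i \<noteq> \<zero>}"
  have fin: "finite ?A" using x y finite_parts by simp
  have sub: "{i. ?c i \<noteq> \<zero>} \<subseteq> ?A" by auto
  have px: "part x \<in> B \<rightarrow> carrier M" and py: "part y \<in> B \<rightarrow> carrier M" for B
    using x y part_closed by auto
  have "finsum M ?c {i. ?c i \<noteq> \<zero>} = finsum M ?c ?A"
    using fin sub part_closed[OF x] part_closed[OF y]
    by (intro add.finprod_mono_neutral_cong_left) auto
  also have "\<dots> = finsum M (part x) ?A \<oplus> finsum M (part y) ?A"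
    using px py by (rule finsum_addf)
  also have "finsum M (part x) ?A = finsum M (part x) {i. part x i \<noteq> \<zero>}"
    using fin px by (intro add.finprod_mono_neutral_cong_right) auto
  also have "finsum M (part y) ?A = finsum M (part y) {i. part y i \<noteq> \<zero>}"
    using fin py by (intro add.finprod_mono_neutral_cong_right) auto
  finally have "finsum M ?c {i. ?c i \<noteq> \<zero>} = x \<oplus> y"
    using sum_parts x y by simp
  moreover have "finite {i. ?c i \<noteq> \<zero>}" using fin sub finite_subset by blast
  ultimately have "decomposition M H (x \<oplus> y) ?c"
    using x y part_homog homog_add by (simp add: decomposition_def)
  then show ?thesis using part_unique[of "x \<oplus> y"] x y by simp
qed

lemma part_minus:
  assumes x: "x \<in> carrier M" and y: "y \<in> carrier M"
  shows "part (x \<ominus> y) i = part x i \<ominus> part y i"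
proof -
  let ?d = "part (x \<ominus> y) i" and ?p = "part y i"
  have cl: "?d \<in> carrier M" "?p \<in> carrier M" using x y part_closed by simp_all
  have "x = (x \<ominus> y) \<oplus> y" using x y by (simp add: minus_eq a_assoc l_neg)
  then have "part x i = ?d \<oplus> ?p" using part_add[of "x \<ominus> y" y i] x y by simp
  also have "\<dots> \<ominus> ?p = ?d" using cl by (simp only: minus_eq a_assoc r_neg r_zero a_inv_closed)
  finally show ?thesis by simp
qed

end

text \<open>
  An additive family of projections that is the identity on its own summand and zero on the others
  forces every decomposition to be the given one: apply the projections to the sum.
\<close>

lemma (in abelian_group) internal_direct_sumI:
  assumes sub: "\<And>i. additive_subgroup (H i) G"
    and mem: "\<And>x i. x \<in> carrier G \<Longrightarrow> p x i \<in> H i"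
    and fin: "\<And>x. x \<in> carrier G \<Longrightarrow> finite {i. p x i \<noteq> \<zero>}"
    and sum: "\<And>x. x \<in> carrier G \<Longrightarrow> x = finsum G (p x) {i. p x i \<noteq> \<zero>}"
    and add: "\<And>x y i. \<lbrakk>x \<in> carrier G; y \<in> carrier G\<rbrakk> \<Longrightarrow> p (x \<oplus> y) i = p x i \<oplus> p y i"
    and hom: "\<And>x i j. x \<in> H j \<Longrightarrow> p x i = (if i = j then x else \<zero>)"
  shows "internal_direct_sum G H" and "x \<in> carrier G \<Longrightarrow> component G H x = p x"
proof -
  have dec: "decomposition G H x (p x)" if "x \<in> carrier G" for x
    unfolding decomposition_def using that mem fin sum by blast
  have uniq: "c = p x" if x: "x \<in> carrier G" and c: "decomposition G H x c" for x c
  proof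
    fix i
    have cH: "c j \<in> H j" for j using c by (simp add: decomposition_def)
    have cc: "c j \<in> carrier G" for j using cH additive_subgroup.a_Hcarr[OF sub] by blast
    have z: "p \<zero> i = \<zero>"
      using hom[OF additive_subgroup.zero_closed[OF sub, of i], of i] by simp
    have "p (finsum G c A) i = (if i \<in> A then c i else \<zero>)" if "finite A" for A
      using that
    proof (induction A)
      case empty then show ?case using z by simp
    next
      case (insert j A)
      have "finsum G c (insert j A) = c j \<oplus> finsum G c A"
        using insert.hyps cc by (intro finsum_insert) auto
      moreover have "p (c j \<oplus> finsum G c A) i = p (c j) i \<oplus> p (finsum G c A) i"
        using cc by (intro add) auto
      ultimately show ?case using insert hom[OF cH, of j i] cc by auto
    qed
    from this[of "{j. c j \<noteq> \<zero>}"] show "c i = p x i"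
      using c by (auto simp: decomposition_def)
  qed
  show "internal_direct_sum G H"
    unfolding internal_direct_sum_def using sub dec uniq by blast
  show "component G H x = p x" if "x \<in> carrier G"
    unfolding component_def using dec[OF that] uniq[OF that] by blast
qed

text \<open>
  The additive map that is given by \<open>f i\<close> on the summand \<open>H i\<close>. Both the product of a Zhang twist and
  the action on a twisted module have this form.
\<close>

definition graded_extension ::
    "('a, 'r) ring_scheme \<Rightarrow> ('i \<Rightarrow> 'a set) \<Rightarrow> ('c, 's) ring_scheme \<Rightarrow> ('i \<Rightarrow> 'a \<Rightarrow> 'c) \<Rightarrow> 'a \<Rightarrow> 'c"
  where "graded_extension M H N f x =
    finsum N (\<lambda>i. f i (component M H x i)) {i. component M H x i \<noteq> \<zero>\<^bsub>M\<^esub>}"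

locale graded_group_maps = graded_group M H + N: abelian_group N
  for M (structure) and H :: "'i \<Rightarrow> 'a set" and N (structure) +
  fixes f :: "'i \<Rightarrow> 'a \<Rightarrow> 'c"
  assumes f_closed: "x \<in> H i \<Longrightarrow> f i x \<in> carrier N"
    and f_add: "\<lbrakk>x \<in> H i; y \<in> H i\<rbrakk> \<Longrightarrow> f i (x \<oplus>\<^bsub>M\<^esub> y) = f i x \<oplus>\<^bsub>N\<^esub> f i y"
begin

lemma f_zero: "f i \<zero>\<^bsub>M\<^esub> = \<zero>\<^bsub>N\<^esub>"
  using f_add[OF homog_zero homog_zero, of i] f_closed[OF homog_zero, of i]
  by (simp add: N.add.l_cancel_one')

lemma extension_eq:
  assumes "x \<in> carrier M" "finite A" "{i. part x i \<noteq> \<zero>\<^bsub>M\<^esub>} \<subseteq> A"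
  shows "graded_extension M H N f x = finsum N (\<lambda>i. f i (part x i)) A"
  unfolding graded_extension_def using assms f_closed[OF part_homog[OF assms(1)]] f_zero
  by (intro N.add.finprod_mono_neutral_cong_left) auto

lemma extension_closed:
  "x \<in> carrier M \<Longrightarrow> graded_extension M H N f x \<in> carrier N"
  unfolding graded_extension_def using f_closed part_homog by (intro N.finsum_closed) auto

lemma extension_add:
  assumes x: "x \<in> carrier M" and y: "y \<in> carrier M"
  shows "graded_extension M H N f (x \<oplus>\<^bsub>M\<^esub> y)
    = graded_extension M H N f x \<oplus>\<^bsub>N\<^esub> graded_extension M H N f y"
proof -
  let ?A = "{i. part x i \<noteq> \<zero>\<^bsub>M\<^esub>} \<union> {i. part y i \<noteq> \<zero>\<^bsub>M\<^esub>}"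
  have fin: "finite ?A" using x y finite_parts by simp
  have cl: "(\<lambda>i. f i (part z i)) \<in> ?A \<rightarrow> carrier N" if "z \<in> carrier M" for z
    using f_closed[OF part_homog[OF that]] by auto
  have "graded_extension M H N f (x \<oplus>\<^bsub>M\<^esub> y) = finsum N (\<lambda>i. f i (part (x \<oplus>\<^bsub>M\<^esub> y) i)) ?A"
    using x y fin by (intro extension_eq) (auto simp: part_add)
  also have "\<dots> = finsum N (\<lambda>i. f i (part x i) \<oplus>\<^bsub>N\<^esub> f i (part y i)) ?A"
    using x y part_homog by (simp add: part_add f_add)
  also have "\<dots> = finsum N (\<lambda>i. f i (part x i)) ?A \<oplus>\<^bsub>N\<^esub> finsum N (\<lambda>i. f i (part y i)) ?A"
    using cl x y by (intro N.finsum_addf) auto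
  also have "finsum N (\<lambda>i. f i (part x i)) ?A = graded_extension M H N f x"
    using x fin by (intro extension_eq[symmetric]) auto
  also have "finsum N (\<lambda>i. f i (part y i)) ?A = graded_extension M H N f y"
    using y fin by (intro extension_eq[symmetric]) auto
  finally show ?thesis .
qed

lemma extension_homog:
  assumes "x \<in> H j" shows "graded_extension M H N f x = f j x"
proof -
  have x: "x \<in> carrier M" using assms homog_closed by blast
  have "graded_extension M H N f x = finsum N (\<lambda>i. f i (part x i)) {j}"
    using x assms by (intro extension_eq) (auto simp: part_of_homog split: if_splits)
  then show ?thesis using assms f_closed by (simp add: part_of_homog)
qed

end

section \<open>Graded algebras and their quotients\<close>

context graded_algebra
begin

sublocale graded_group B "homog B"
  by (intro graded_group.intro graded_group_axioms.intro homog_direct_sum) (rule M.abelian_group_axioms)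

text \<open>
  Multiplication by a homogeneous element shifts the degrees, and so can be computed part by part.
\<close>

lemma part_mult_left:
  assumes r: "r \<in> homog B m" and x: "x \<in> carrier B"
  shows "part (r \<otimes>\<^bsub>B\<^esub> x) n = (if m \<le> n then r \<otimes>\<^bsub>B\<^esub> part x (n - m) else \<zero>\<^bsub>B\<^esub>)"
  using x
proof (induction x rule: homog_induct)
  case (homog i y)
  then show ?case
    using r homog_mult[OF r homog] homog_closed[OF r] by (auto simp: part_of_homog)
next
  case (add y z)
  then show ?case
    using homog_closed[OF r] part_closed by (simp add: B.r_distr part_add)
qed

lemma part_mult_right:
  assumes r: "r \<in> homog B m" and x: "x \<in> carrier B"
  shows "part (x \<otimes>\<^bsub>B\<^esub> r) n = (if m \<le> n then part x (n - m) \<otimes>\<^bsub>B\<^esub> r else \<zero>\<^bsub>B\<^esub>)"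
  using x
proof (induction x rule: homog_induct)
  case (homog i y)
  then show ?case
    using r homog_mult[OF homog r] homog_closed[OF r] by (auto simp: part_of_homog)
next
  case (add y z)
  then show ?case
    using homog_closed[OF r] part_closed by (simp add: B.l_distr part_add)
qed

text \<open>Scalars act through the unit element, hence preserve every two-sided ideal.\<close>

lemma smult_as_mult:
  assumes "a \<in> carrier K" "x \<in> carrier B"
  shows "a \<odot>\<^bsub>B\<^esub> x = (a \<odot>\<^bsub>B\<^esub> \<one>\<^bsub>B\<^esub>) \<otimes>\<^bsub>B\<^esub> x"
  using assms by (simp add: smult_mult_left)

lemma ideal_smult:
  assumes "ideal I B" "a \<in> carrier K" "x \<in> I"
  shows "a \<odot>\<^bsub>B\<^esub> x \<in> I"
  using assms ideal.Icarr[OF assms(1,3)] smult_as_mult[of a x] ideal.I_l_closed[OF assms(1,3)]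
  by simp

end

locale graded_ideal = graded_algebra K B + I: ideal I B
  for K :: "('k, 'r) ring_scheme" and B :: "('k, 'b, 's) graded_alg_scheme" and I +
  assumes part_in_ideal: "x \<in> I \<Longrightarrow> part x n \<in> I"

text \<open>
  The elements all of whose parts lie in the ideal generated by \<open>S\<close> form an ideal again, and it
  contains \<open>S\<close> if \<open>S\<close> consists of homogeneous elements.
\<close>

lemma (in graded_algebra) graded_ideal_genideal:
  assumes S: "\<And>s. s \<in> S \<Longrightarrow> \<exists>n. s \<in> homog B n"
  shows "graded_ideal K B (Idl\<^bsub>B\<^esub> S)"
proof -
  have SB: "S \<subseteq> carrier B" using S homog_closed by blast
  let ?I = "Idl\<^bsub>B\<^esub> S"
  interpret I: ideal ?I B using B.genideal_ideal[OF SB] .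
  let ?J = "{x \<in> carrier B. \<forall>n. part x n \<in> ?I}"
  have mult: "r \<otimes>\<^bsub>B\<^esub> x \<in> ?J \<and> x \<otimes>\<^bsub>B\<^esub> r \<in> ?J" if x: "x \<in> ?J" and r: "r \<in> carrier B" for x r
    using r
  proof (induction r rule: homog_induct)
    case (homog i y)
    then have y: "y \<in> carrier B" using homog_closed by blast
    show ?case
      using x y I.I_l_closed I.I_r_closed I.zero_closed
      by (auto simp: part_mult_left[OF homog] part_mult_right[OF homog])
  next
    case (add y z)
    then show ?case
      using x I.a_closed by (auto simp: B.l_distr B.r_distr part_add)
  qed
  have "ideal ?J B"
  proof (rule idealI[OF B.ring_axioms])
    have neg: "\<ominus>\<^bsub>B\<^esub> x \<in> ?J" if x: "x \<in> ?J" for x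
    proof -
      have "\<ominus>\<^bsub>B\<^esub> x = (\<ominus>\<^bsub>B\<^esub> \<one>\<^bsub>B\<^esub>) \<otimes>\<^bsub>B\<^esub> x" using x by (simp add: B.l_minus)
      then show ?thesis using mult[OF x, of "\<ominus>\<^bsub>B\<^esub> \<one>\<^bsub>B\<^esub>"] by simp
    qed
    show "subgroup ?J (add_monoid B)"
    proof (rule M.add.subgroupI)
      show "?J \<noteq> {}"
      proof -
        have "\<zero>\<^bsub>B\<^esub> \<in> ?J" using part_of_homog[OF homog_zero[of 0]] I.zero_closed by simp
        then show ?thesis by blast
      qed
      show "\<ominus>\<^bsub>B\<^esub> x \<in> ?J" if "x \<in> ?J" for x using neg[OF that] .
      show "x \<oplus>\<^bsub>B\<^esub> y \<in> ?J" if "x \<in> ?J" "y \<in> ?J" for x y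
        using that I.a_closed by (auto simp: part_add)
    qed auto
  qed (use mult in auto)
  moreover have "S \<subseteq> ?J"
  proof
    fix s assume s: "s \<in> S"
    then obtain n where n: "s \<in> homog B n" using S by blast
    have "s \<in> ?I" using B.genideal_self[OF SB] s by blast
    then show "s \<in> ?J" using part_of_homog[OF n] I.zero_closed homog_closed[OF n] by auto
  qed
  ultimately have "?I \<subseteq> ?J" by (rule B.genideal_minimal)
  then show ?thesis
    by (intro graded_ideal.intro graded_algebra_axioms graded_ideal_axioms.intro) (auto intro: I.ideal_axioms)
qed

context graded_ideal
begin

abbreviation "Q \<equiv> quot_alg B I"
abbreviation proj where "proj x \<equiv> I +>\<^bsub>B\<^esub> x"

lemma quot_carrier: "carrier Q = proj ` carrier B"
  by (auto simp: quot_alg_def FactRing_simps)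

lemma quot_mult: "\<lbrakk>x \<in> carrier B; y \<in> carrier B\<rbrakk> \<Longrightarrow> proj x \<otimes>\<^bsub>Q\<^esub> proj y = proj (x \<otimes>\<^bsub>B\<^esub> y)"
  by (simp add: quot_alg_def FactRing_def I.rcoset_mult_add)

lemma quot_add: "\<lbrakk>x \<in> carrier B; y \<in> carrier B\<rbrakk> \<Longrightarrow> proj x \<oplus>\<^bsub>Q\<^esub> proj y = proj (x \<oplus>\<^bsub>B\<^esub> y)"
  by (simp add: quot_alg_def FactRing_def I.a_rcos_sum)

lemma quot_one: "\<one>\<^bsub>Q\<^esub> = proj \<one>\<^bsub>B\<^esub>"
  by (simp add: quot_alg_def FactRing_def)

lemma quot_zero: "\<zero>\<^bsub>Q\<^esub> = proj \<zero>\<^bsub>B\<^esub>"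
  using M.a_coset_add_zero[OF I.a_subset] by (simp add: quot_alg_def FactRing_def)

lemma quot_homog: "homog Q n = proj ` homog B n"
  by (simp add: quot_alg_def)

lemma proj_eq_iff:
  assumes "x \<in> carrier B" "y \<in> carrier B"
  shows "proj x = proj y \<longleftrightarrow> x \<ominus>\<^bsub>B\<^esub> y \<in> I"
  using B.quotient_eq_iff_same_a_r_cos[OF I.ideal_axioms assms] by simp

lemma quot_smult:
  assumes a: "a \<in> carrier K" and x: "x \<in> carrier B"
  shows "a \<odot>\<^bsub>Q\<^esub> proj x = proj (a \<odot>\<^bsub>B\<^esub> x)"
proof -
  have "proj (a \<odot>\<^bsub>B\<^esub> y) = proj (a \<odot>\<^bsub>B\<^esub> x)" if y: "y \<in> proj x" for y
  proof -
    obtain h where h: "h \<in> I" "y = h \<oplus>\<^bsub>B\<^esub> x"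
      using y by (auto simp: a_r_coset_def')
    have hB: "h \<in> carrier B" using h I.Icarr by blast
    have "a \<odot>\<^bsub>B\<^esub> y \<ominus>\<^bsub>B\<^esub> a \<odot>\<^bsub>B\<^esub> x = a \<odot>\<^bsub>B\<^esub> h"
      using a x hB by (simp add: h(2) smult_r_distr a_minus_def M.a_assoc M.r_neg)
    then show ?thesis
      using a x hB h ideal_smult[OF I.ideal_axioms a h(1)] by (subst proj_eq_iff) auto
  qed
  moreover have "x \<in> proj x"
    using I.a_rcos_self[OF x] .
  moreover have "a \<odot>\<^bsub>Q\<^esub> proj x = (\<Union>y\<in>proj x. proj (a \<odot>\<^bsub>B\<^esub> y))"
    by (simp add: quot_alg_def)
  ultimately show ?thesis by blast
qed

lemma quot_ring: "ring Q"
proof -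
  have "abelian_group Q"
  proof (rule abelian_groupI)
    fix X assume "X \<in> carrier Q"
    then obtain x where "x \<in> carrier B" "X = proj x" by (auto simp: quot_carrier)
    then show "\<exists>Y\<in>carrier Q. Y \<oplus>\<^bsub>Q\<^esub> X = \<zero>\<^bsub>Q\<^esub>"
      by (intro bexI[of _ "proj (\<ominus>\<^bsub>B\<^esub> x)"]) (auto simp: quot_carrier quot_add quot_zero M.l_neg)
  qed (auto simp: quot_carrier quot_add quot_zero M.a_ac)
  moreover have "monoid Q"
    by (rule monoidI) (auto simp: quot_carrier quot_mult quot_one B.m_assoc)
  ultimately show ?thesis
    by (rule ringI) (auto simp: quot_carrier quot_add quot_mult B.l_distr B.r_distr)
qed

lemma proj_finsum:
  assumes "finite A" "f \<in> A \<rightarrow> carrier B"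
  shows "finsum Q (\<lambda>i. proj (f i)) A = proj (finsum B f A)"
proof -
  interpret Q: ring Q by (rule quot_ring)
  show ?thesis
    using assms
  proof (induction A)
    case empty
    then show ?case by (simp add: quot_zero)
  next
    case (insert i A)
    then have "finsum Q (\<lambda>i. proj (f i)) (insert i A) = proj (f i) \<oplus>\<^bsub>Q\<^esub> finsum Q (\<lambda>i. proj (f i)) A"
      by (intro Q.finsum_insert) (auto simp: quot_carrier)
    with insert show ?case by (simp add: quot_add Pi_def)
  qed
qed

lemma quot_module: "module K Q"
proof -
  interpret Q: ring Q by (rule quot_ring)
  show ?thesis
  proof (rule moduleI[OF K.is_cring Q.is_abelian_group])
  qed (auto simp: quot_carrier quot_smult quot_add smult_l_distr smult_r_distr smult_assoc1)
qed

text \<open>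
  Any representative may be chosen, because the ideal contains the parts of its elements.
\<close>

definition quot_part :: "'b set \<Rightarrow> nat \<Rightarrow> 'b set" where
  "quot_part X n = proj (part (SOME x. x \<in> carrier B \<and> X = proj x) n)"

lemma quot_part_proj:
  assumes x: "x \<in> carrier B" shows "quot_part (proj x) n = proj (part x n)"
proof -
  define y where "y = (SOME y. y \<in> carrier B \<and> proj x = proj y)"
  have y: "y \<in> carrier B \<and> proj x = proj y"
    unfolding y_def by (rule someI[of _ x]) (use x in simp)
  then have "part (y \<ominus>\<^bsub>B\<^esub> x) n \<in> I"
    using x part_in_ideal proj_eq_iff by metis
  then have "proj (part y n) = proj (part x n)"
    using x y part_closed by (simp add: proj_eq_iff part_minus)
  then show ?thesis by (simp add: quot_part_def y_def)
qed

lemma quot_direct_sum: "internal_direct_sum Q (homog Q)"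
proof -
  interpret Q: ring Q by (rule quot_ring)
  show ?thesis
  proof (rule Q.internal_direct_sumI(1)[where p = quot_part])
    fix n
    show "additive_subgroup (homog Q n) Q"
    proof (rule additive_subgroupI, rule Q.add.subgroupI)
      show "homog Q n \<subseteq> carrier Q" using homog_closed by (auto simp: quot_homog quot_carrier)
      show "homog Q n \<noteq> {}" using homog_zero by (auto simp: quot_homog)
      fix X assume "X \<in> homog Q n"
      then obtain x where x: "x \<in> homog B n" "X = proj x" by (auto simp: quot_homog)
      have xB: "x \<in> carrier B" using x homog_closed by blast
      have "proj x \<oplus>\<^bsub>Q\<^esub> proj (\<ominus>\<^bsub>B\<^esub> x) = \<zero>\<^bsub>Q\<^esub>"
        using xB by (simp add: quot_add quot_zero M.r_neg)
      then have "\<ominus>\<^bsub>Q\<^esub> X = proj (\<ominus>\<^bsub>B\<^esub> x)"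
        using xB x by (intro Q.minus_equality) (auto simp: quot_carrier quot_add quot_zero M.l_neg)
      then show "\<ominus>\<^bsub>Q\<^esub> X \<in> homog Q n"
        using x additive_subgroup.a_inv_closed[OF homog_subgroup]
        by (auto simp: quot_homog)
      fix Y assume "Y \<in> homog Q n"
      then obtain y where y: "y \<in> homog B n" "Y = proj y" by (auto simp: quot_homog)
      show "X \<oplus>\<^bsub>Q\<^esub> Y \<in> homog Q n"
        using x y homog_closed homog_add by (auto simp: quot_homog quot_add)
    qed
  next
    fix X assume "X \<in> carrier Q"
    then obtain x where x: "x \<in> carrier B" "X = proj x" by (auto simp: quot_carrier)
    show "quot_part X n \<in> homog Q n" for n
      using x part_homog by (auto simp: quot_part_proj quot_homog)
    have sub: "{n. quot_part X n \<noteq> \<zero>\<^bsub>Q\<^esub>} \<subseteq> {n. part x n \<noteq> \<zero>\<^bsub>B\<^esub>}"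
      using x by (auto simp: quot_part_proj quot_zero)
    show "finite {n. quot_part X n \<noteq> \<zero>\<^bsub>Q\<^esub>}"
      using sub finite_parts[OF x(1)] finite_subset by blast
    have "finsum Q (quot_part X) {n. quot_part X n \<noteq> \<zero>\<^bsub>Q\<^esub>}
        = finsum Q (\<lambda>n. proj (part x n)) {n. part x n \<noteq> \<zero>\<^bsub>B\<^esub>}"
      using sub finite_parts[OF x(1)] part_closed[OF x(1)] x
      by (intro Q.add.finprod_mono_neutral_cong_left) (auto simp: quot_part_proj quot_carrier)
    also have "\<dots> = proj x"
      using sum_parts[OF x(1)] finite_parts[OF x(1)] part_closed[OF x(1)]
      by (subst proj_finsum) auto
    finally show "X = finsum Q (quot_part X) {n. quot_part X n \<noteq> \<zero>\<^bsub>Q\<^esub>}" using x by simp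
    fix Y n assume "Y \<in> carrier Q"
    then obtain y where y: "y \<in> carrier B" "Y = proj y" by (auto simp: quot_carrier)
    show "quot_part (X \<oplus>\<^bsub>Q\<^esub> Y) n = quot_part X n \<oplus>\<^bsub>Q\<^esub> quot_part Y n"
      using x y part_closed by (simp add: quot_add quot_part_proj part_add)
  next
    fix X i j assume "X \<in> homog Q j"
    then obtain x where "x \<in> homog B j" "X = proj x" by (auto simp: quot_homog)
    then show "quot_part X i = (if i = j then X else \<zero>\<^bsub>Q\<^esub>)"
      using homog_closed by (auto simp: quot_part_proj part_of_homog quot_zero)
  qed
qed

lemma quot_graded_algebra: "graded_algebra K Q"
proof -
  interpret Q: ring Q by (rule quot_ring)
  show ?thesis
  proof (intro graded_algebra.intro graded_algebra_axioms.intro quot_direct_sum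
      K.field_axioms quot_ring quot_module)
    show "\<one>\<^bsub>Q\<^esub> \<in> homog Q 0" using homog_one by (auto simp: quot_homog quot_one)
    fix X Y m n assume "X \<in> homog Q m" "Y \<in> homog Q n"
    then obtain x y where "x \<in> homog B m" "X = proj x" "y \<in> homog B n" "Y = proj y"
      by (auto simp: quot_homog)
    then show "X \<otimes>\<^bsub>Q\<^esub> Y \<in> homog Q (m + n)"
      using homog_mult[of x m y n] homog_closed[of x m] homog_closed[of y n]
      by (simp add: quot_homog quot_mult)
  next
    fix a X n assume "a \<in> carrier K" "X \<in> homog Q n"
    then obtain x where "a \<in> carrier K" "x \<in> homog B n" "X = proj x"
      by (auto simp: quot_homog)
    then show "a \<odot>\<^bsub>Q\<^esub> X \<in> homog Q n"
      using homog_smult[of a x n] homog_closed[of x n] by (simp add: quot_homog quot_smult)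
  next
    fix a X Y assume "a \<in> carrier K" "X \<in> carrier Q" "Y \<in> carrier Q"
    then obtain x y where "a \<in> carrier K" "x \<in> carrier B" "X = proj x" "y \<in> carrier B" "Y = proj y"
      by (auto simp: quot_carrier)
    then show "(a \<odot>\<^bsub>Q\<^esub> X) \<otimes>\<^bsub>Q\<^esub> Y = a \<odot>\<^bsub>Q\<^esub> (X \<otimes>\<^bsub>Q\<^esub> Y)"
      and "X \<otimes>\<^bsub>Q\<^esub> (a \<odot>\<^bsub>Q\<^esub> Y) = a \<odot>\<^bsub>Q\<^esub> (X \<otimes>\<^bsub>Q\<^esub> Y)"
      by (simp_all add: quot_smult quot_mult smult_mult_left smult_mult_right)
  qed
qed

end

section \<open>Twisting systems\<close>

text \<open>
  A constant family is an isomorphism of graded algebras. The index ranges over \<open>\<int>\<close> because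
  \<open>\<phi> i\<close> is used to act on the elements of degree \<open>i\<close> of a graded module.
\<close>

locale twisting_system = C: graded_algebra K C + B: graded_algebra K B
  for K :: "('k, 'r) ring_scheme" and C :: "('k, 'c, 's) graded_alg_scheme"
    and B :: "('k, 'b, 't) graded_alg_scheme" +
  fixes \<phi> :: "int \<Rightarrow> 'c \<Rightarrow> 'b"
  assumes bij: "bij_betw (\<phi> i) (carrier C) (carrier B)"
    and map_add: "\<lbrakk>x \<in> carrier C; y \<in> carrier C\<rbrakk> \<Longrightarrow> \<phi> i (x \<oplus>\<^bsub>C\<^esub> y) = \<phi> i x \<oplus>\<^bsub>B\<^esub> \<phi> i y"
    and map_smult: "\<lbrakk>a \<in> carrier K; x \<in> carrier C\<rbrakk> \<Longrightarrow> \<phi> i (a \<odot>\<^bsub>C\<^esub> x) = a \<odot>\<^bsub>B\<^esub> \<phi> i x"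
    and map_homog: "\<phi> i ` homog C n = homog B n"
    and map_mult: "\<lbrakk>x \<in> homog C m; y \<in> carrier C\<rbrakk>
      \<Longrightarrow> \<phi> i (x \<otimes>\<^bsub>C\<^esub> y) = \<phi> i x \<otimes>\<^bsub>B\<^esub> \<phi> (i + int m) y"
begin

lemma map_closed: "x \<in> carrier C \<Longrightarrow> \<phi> i x \<in> carrier B"
  using bij bij_betwE by blast

lemma map_inj: "\<lbrakk>\<phi> i x = \<phi> i y; x \<in> carrier C; y \<in> carrier C\<rbrakk> \<Longrightarrow> x = y"
  using bij by (metis bij_betw_def inj_onD)

lemma map_surj: "y \<in> carrier B \<Longrightarrow> \<exists>x \<in> carrier C. y = \<phi> i x"
  using bij by (metis bij_betw_def imageE)

lemma map_surj_homog: "y \<in> homog B n \<Longrightarrow> \<exists>x \<in> homog C n. y = \<phi> i x"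
  using map_homog by blast

lemma map_homog_closed: "x \<in> homog C n \<Longrightarrow> \<phi> i x \<in> homog B n"
  using map_homog by blast

lemma map_zero: "\<phi> i \<zero>\<^bsub>C\<^esub> = \<zero>\<^bsub>B\<^esub>"
  using map_add[of "\<zero>\<^bsub>C\<^esub>" "\<zero>\<^bsub>C\<^esub>" i] map_closed[of "\<zero>\<^bsub>C\<^esub>" i]
  by (simp add: B.M.add.l_cancel_one')

lemma map_minus:
  assumes x: "x \<in> carrier C" and y: "y \<in> carrier C"
  shows "\<phi> i (x \<ominus>\<^bsub>C\<^esub> y) = \<phi> i x \<ominus>\<^bsub>B\<^esub> \<phi> i y"
proof -
  let ?d = "\<phi> i (x \<ominus>\<^bsub>C\<^esub> y)"
  have cl: "?d \<in> carrier B" "\<phi> i y \<in> carrier B" using x y map_closed by simp_all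
  have "x = (x \<ominus>\<^bsub>C\<^esub> y) \<oplus>\<^bsub>C\<^esub> y" using x y by (simp add: C.M.minus_eq C.M.a_assoc C.M.l_neg)
  then have "\<phi> i x = ?d \<oplus>\<^bsub>B\<^esub> \<phi> i y" using map_add[of "x \<ominus>\<^bsub>C\<^esub> y" y i] x y by simp
  also have "\<dots> \<ominus>\<^bsub>B\<^esub> \<phi> i y = ?d"
    using cl by (simp only: B.M.minus_eq B.M.a_assoc B.M.r_neg B.M.r_zero B.M.a_inv_closed)
  finally show ?thesis by simp
qed

text \<open>The image of the unit is a left unit for all elements in the image of \<open>\<phi> i\<close>, including the unit.\<close>

lemma map_one: "\<phi> i \<one>\<^bsub>C\<^esub> = \<one>\<^bsub>B\<^esub>"
proof -
  obtain u where u: "u \<in> carrier C" "\<one>\<^bsub>B\<^esub> = \<phi> i u" using map_surj[OF B.B.one_closed] by blast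
  have "\<phi> i \<one>\<^bsub>C\<^esub> = \<phi> i \<one>\<^bsub>C\<^esub> \<otimes>\<^bsub>B\<^esub> \<one>\<^bsub>B\<^esub>" using map_closed by simp
  also have "\<dots> = \<one>\<^bsub>B\<^esub>"
    using u map_mult[OF C.homog_one u(1), of i] by simp
  finally show ?thesis .
qed

abbreviation inverse :: "int \<Rightarrow> 'b \<Rightarrow> 'c" where
  "inverse i \<equiv> inv_into (carrier C) (\<phi> i)"

lemma inverse_map: "x \<in> carrier C \<Longrightarrow> inverse i (\<phi> i x) = x"
  using bij_betw_inv_into_left[OF bij] .

lemma map_inverse: "y \<in> carrier B \<Longrightarrow> \<phi> i (inverse i y) = y"
  using bij_betw_inv_into_right[OF bij] .

lemma inverse_closed: "y \<in> carrier B \<Longrightarrow> inverse i y \<in> carrier C"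
  using bij map_surj inverse_map by metis

lemma inverse_eqI: "\<lbrakk>x \<in> carrier C; \<phi> i x = y\<rbrakk> \<Longrightarrow> inverse i y = x"
  using inverse_map by blast

lemma twisting_system_inverse: "twisting_system K B C inverse"
proof (intro twisting_system.intro twisting_system_axioms.intro
    C.graded_algebra_axioms B.graded_algebra_axioms)
  fix i
  show "bij_betw (inverse i) (carrier B) (carrier C)" by (rule bij_betw_inv_into[OF bij])
  show "inverse i (x \<oplus>\<^bsub>B\<^esub> y) = inverse i x \<oplus>\<^bsub>C\<^esub> inverse i y"
    if "x \<in> carrier B" "y \<in> carrier B" for x y
    using that by (intro inverse_eqI) (simp_all add: inverse_closed map_add map_inverse)
  show "inverse i (a \<odot>\<^bsub>B\<^esub> x) = a \<odot>\<^bsub>C\<^esub> inverse i x"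
    if "a \<in> carrier K" "x \<in> carrier B" for a x
    using that by (intro inverse_eqI) (simp_all add: inverse_closed map_smult map_inverse)
  show im: "inverse i ` homog B n = homog C n" for n
  proof -
    have "inverse i ` \<phi> i ` homog C n = homog C n"
      using inverse_map C.homog_closed by (force simp: image_image)
    then show ?thesis by (simp only: map_homog)
  qed
  fix x y m assume x: "x \<in> homog B m" and y: "y \<in> carrier B"
  have "inverse i x \<in> homog C m" using x im by blast
  then show "inverse i (x \<otimes>\<^bsub>B\<^esub> y) = inverse i x \<otimes>\<^bsub>C\<^esub> inverse (i + int m) y"
    using y B.homog_closed[OF x] C.homog_closed
    by (intro inverse_eqI) (simp_all add: inverse_closed map_mult map_inverse)
qed

lemma twisting_system_compose:
  assumes "twisting_system K B A \<psi>"
  shows "twisting_system K C A (\<lambda>i. \<psi> i \<circ> \<phi> i)"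
proof -
  interpret BA: twisting_system K B A \<psi> by fact
  show ?thesis
  proof (intro twisting_system.intro twisting_system_axioms.intro
      C.graded_algebra_axioms BA.B.graded_algebra_axioms)
    fix i
    show "bij_betw (\<psi> i \<circ> \<phi> i) (carrier C) (carrier A)" by (rule bij_betw_trans[OF bij BA.bij])
    show "(\<psi> i \<circ> \<phi> i) ` homog C n = homog A n" for n
      by (simp only: image_comp[symmetric] map_homog BA.map_homog)
    show "(\<psi> i \<circ> \<phi> i) (x \<otimes>\<^bsub>C\<^esub> y) = (\<psi> i \<circ> \<phi> i) x \<otimes>\<^bsub>A\<^esub> (\<psi> (i + int m) \<circ> \<phi> (i + int m)) y"
      if "x \<in> homog C m" "y \<in> carrier C" for x y m
      using that by (simp add: map_mult BA.map_mult[OF map_homog_closed] map_closed)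
  qed (simp_all add: map_add map_smult map_closed BA.map_add BA.map_smult)
qed

lemma map_funpow:
  assumes step: "\<And>i x. x \<in> carrier C \<Longrightarrow> \<phi> (i + 1) x = \<tau> (\<phi> i x)" and x: "x \<in> carrier C"
  shows "\<phi> (int m) x = (\<tau> ^^ m) (\<phi> 0 x)"
proof (induction m)
  case (Suc m)
  then show ?case using step[OF x, of "int m"] by (simp add: add.commute)
qed simp

text \<open>
  The hypothesis forces \<open>\<tau>\<close> to be an automorphism of \<open>B\<close>. Write homogeneous \<open>x = \<phi>\<^sub>0(c)\<close> of degree \<open>m\<close>
  and \<open>y = \<phi>\<^sub>m(d)\<close>; then \<open>xy = \<phi>\<^sub>0(cd)\<close>, and \<open>\<tau>(xy) = \<phi>\<^sub>1(cd) = \<phi>\<^sub>1(c) \<phi>\<^sub>m\<^sub>+\<^sub>1(d) = \<tau>(x) \<tau>(y)\<close>. The isomorphism onto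
  the twist is \<open>\<phi>\<^sub>0\<close>, as \<open>\<phi>\<^sub>m = \<tau>\<^sup>m \<circ> \<phi>\<^sub>0\<close>.
\<close>

lemma is_zhang_twist:
  assumes step: "\<And>i x. x \<in> carrier C \<Longrightarrow> \<phi> (i + 1) x = \<tau> (\<phi> i x)"
  shows "is_zhang_twist_of K C B"
proof -
  have step0: "\<tau> (\<phi> i x) = \<phi> (i + 1) x" if "x \<in> carrier C" for i x
    using step[OF that] by simp
  have tau: "\<tau> \<in> graded_alg_iso K B B"
  proof -
    have closed: "\<tau> x \<in> carrier B" if "x \<in> carrier B" for x
      using map_surj[OF that, of 0] step0 map_closed by auto
    have tau_add: "\<tau> (x \<oplus>\<^bsub>B\<^esub> y) = \<tau> x \<oplus>\<^bsub>B\<^esub> \<tau> y" if x: "x \<in> carrier B" and y: "y \<in> carrier B" for x y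
    proof -
      obtain c d where "c \<in> carrier C" "x = \<phi> 0 c" "d \<in> carrier C" "y = \<phi> 0 d"
        using map_surj[OF x] map_surj[OF y] by metis
      then show ?thesis by (simp add: map_add[symmetric] step0)
    qed
    have mult: "\<tau> (x \<otimes>\<^bsub>B\<^esub> y) = \<tau> x \<otimes>\<^bsub>B\<^esub> \<tau> y" if x: "x \<in> carrier B" and y: "y \<in> carrier B" for x y
      using x
    proof (induction x rule: B.homog_induct)
      case (homog m x)
      then obtain c where c: "c \<in> homog C m" "x = \<phi> 0 c" using map_surj_homog by metis
      obtain d where d: "d \<in> carrier C" "y = \<phi> (0 + int m) d" using map_surj[OF y] by metis
      have "x \<otimes>\<^bsub>B\<^esub> y = \<phi> 0 (c \<otimes>\<^bsub>C\<^esub> d)" using c d by (simp add: map_mult)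
      then have "\<tau> (x \<otimes>\<^bsub>B\<^esub> y) = \<phi> 1 (c \<otimes>\<^bsub>C\<^esub> d)" using c d C.homog_closed by (simp add: step0)
      also have "\<dots> = \<phi> 1 c \<otimes>\<^bsub>B\<^esub> \<phi> (int m + 1) d" using map_mult[OF c(1) d(1), of 1]
        by (simp add: add.commute)
      also have "\<dots> = \<tau> x \<otimes>\<^bsub>B\<^esub> \<tau> y" using c d C.homog_closed by (simp add: step0)
      finally show ?case .
    next
      case (add u v)
      then show ?case using y closed by (simp add: tau_add B.B.l_distr)
    qed
    have one: "\<tau> \<one>\<^bsub>B\<^esub> = \<one>\<^bsub>B\<^esub>"
      using step0[OF C.B.one_closed, of 0] by (simp add: map_one)
    have "bij_betw \<tau> (\<phi> 0 ` carrier C) (carrier B)"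
    proof (rule bij_betw_comp_iff[THEN iffD2, rotated])
      show "bij_betw (\<phi> 0) (carrier C) (\<phi> 0 ` carrier C)" using bij by (simp add: bij_betw_def)
      show "bij_betw (\<tau> \<circ> \<phi> 0) (carrier C) (carrier B)"
        using bij[of 1] by (rule bij_betw_cong[THEN iffD1, rotated]) (simp add: step0)
    qed
    then have bij_tau: "bij_betw \<tau> (carrier B) (carrier B)"
      using bij[of 0] by (simp add: bij_betw_def)
    have smult: "\<tau> (a \<odot>\<^bsub>B\<^esub> x) = a \<odot>\<^bsub>B\<^esub> \<tau> x" if a: "a \<in> carrier K" and x: "x \<in> carrier B" for a x
    proof -
      obtain c where "c \<in> carrier C" "x = \<phi> 0 c" using map_surj[OF x] by metis
      then show ?thesis using a by (simp add: map_smult[symmetric] step0)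
    qed
    have "\<tau> ` homog B n = homog B n" for n
    proof -
      have "\<tau> ` \<phi> 0 ` homog C n = \<phi> 1 ` homog C n"
        using C.homog_closed by (force simp: image_image step0)
      then show ?thesis by (simp only: map_homog)
    qed
    then show ?thesis
      unfolding graded_alg_iso_def
      using closed tau_add mult one bij_tau smult by (auto intro!: ring_iso_memI simp: ring_iso_def ring_hom_memI)
  qed
  let ?Z = "zhang_twist B \<tau>"
  have Z: "carrier ?Z = carrier B" "add ?Z = add B" "one ?Z = one B" "homog ?Z = homog B"
    "smult ?Z = smult B"
    by (simp_all add: zhang_twist_def)
  have Zmult: "x \<otimes>\<^bsub>?Z\<^esub> y = graded_extension B (homog B) B (\<lambda>m u. u \<otimes>\<^bsub>B\<^esub> (\<tau> ^^ m) y) x" for x y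
    by (simp add: zhang_twist_def graded_extension_def Let_def)
  have mult: "\<phi> 0 (x \<otimes>\<^bsub>C\<^esub> y) = \<phi> 0 x \<otimes>\<^bsub>?Z\<^esub> \<phi> 0 y" if x: "x \<in> carrier C" and y: "y \<in> carrier C" for x y
  proof -
    have ty: "(\<tau> ^^ m) (\<phi> 0 y) = \<phi> (int m) y" for m
      using map_funpow[OF step y] by simp
    interpret E: graded_group_maps B "homog B" B "\<lambda>m u. u \<otimes>\<^bsub>B\<^esub> (\<tau> ^^ m) (\<phi> 0 y)"
      using B.homog_closed map_closed[OF y]
      by unfold_locales (simp_all add: ty B.B.l_distr)
    show ?thesis
      using x unfolding Zmult
    proof (induction x rule: C.homog_induct)
      case (homog m x)
      show ?case
        using E.extension_homog[OF map_homog_closed[OF homog, of 0]] map_mult[OF homog y, of 0]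
        by (simp add: ty)
    next
      case (add u v)
      then show ?case
        using E.extension_add[of "\<phi> 0 u" "\<phi> 0 v"] map_closed y
        by (simp add: C.B.l_distr map_add)
    qed
  qed
  have "\<phi> 0 \<in> ring_iso C ?Z"
    using mult bij[of 0] map_closed by (intro ring_iso_memI) (simp_all add: Z map_add map_one)
  then have "\<phi> 0 \<in> graded_alg_iso K C ?Z"
    by (simp add: graded_alg_iso_def Z map_smult map_homog)
  with tau B.graded_algebra_axioms show ?thesis
    unfolding is_zhang_twist_of_def by blast
qed

text \<open>
  The elements that all \<open>\<phi> i\<close> send into \<open>J\<close> form a two-sided ideal. For closure under multiplication
  on the right, an element has to be split into its parts before the product rule applies; the
  parts are sent into \<open>J\<close> too, because \<open>J\<close> is graded.
\<close>

lemma map_genideal_subset: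
  assumes J: "graded_ideal K B J" and S: "\<And>s. s \<in> S \<Longrightarrow> \<exists>n. s \<in> homog C n"
    and map_S: "\<And>i s. s \<in> S \<Longrightarrow> \<phi> i s \<in> J"
  shows "\<phi> i ` (Idl\<^bsub>C\<^esub> S) \<subseteq> J"
proof -
  interpret J: graded_ideal K B J by fact
  have part_map: "B.part (\<phi> i x) n = \<phi> i (C.part x n)" if "x \<in> carrier C" for i x n
    using that
  proof (induction x rule: C.homog_induct)
    case (homog m x)
    then show ?case
      by (simp add: C.part_of_homog B.part_of_homog[OF map_homog_closed] map_zero)
  next
    case (add x y)
    then show ?case by (simp add: map_add map_closed B.part_add C.part_add C.part_closed)
  qed
  let ?I = "{x \<in> carrier C. \<forall>i. \<phi> i x \<in> J}"
  have left: "r \<otimes>\<^bsub>C\<^esub> x \<in> ?I" if x: "x \<in> ?I" and r: "r \<in> carrier C" for x r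
    using r
  proof (induction r rule: C.homog_induct)
    case (homog m r)
    then show ?case
      using x C.homog_closed[OF homog] J.I.I_l_closed map_closed by (simp add: map_mult)
  next
    case (add r s)
    then show ?case using x J.I.a_closed by (simp add: C.B.l_distr map_add)
  qed
  have right: "x \<otimes>\<^bsub>C\<^esub> r \<in> ?I" if x: "x \<in> ?I" and r: "r \<in> carrier C" for x r
  proof -
    have part_J: "\<phi> i (C.part x n) \<in> J" for n i
      using x J.part_in_ideal by (simp add: part_map[symmetric])
    have cl: "C.part x n \<in> carrier C" for n using x C.part_closed by simp
    have "\<phi> i (finsum C (C.part x) A \<otimes>\<^bsub>C\<^esub> r) \<in> J" if "finite A" for A i
      using that
    proof (induction A)
      case empty
      then show ?case using r J.I.zero_closed by (simp add: map_zero)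
    next
      case (insert n A)
      have fcl: "finsum C (C.part x) A \<in> carrier C" using cl by (intro C.M.finsum_closed) auto
      have "finsum C (C.part x) (insert n A) = C.part x n \<oplus>\<^bsub>C\<^esub> finsum C (C.part x) A"
        using insert.hyps cl by (intro C.M.finsum_insert) auto
      then have "\<phi> i (finsum C (C.part x) (insert n A) \<otimes>\<^bsub>C\<^esub> r)
          = \<phi> i (C.part x n) \<otimes>\<^bsub>B\<^esub> \<phi> (i + int n) r \<oplus>\<^bsub>B\<^esub> \<phi> i (finsum C (C.part x) A \<otimes>\<^bsub>C\<^esub> r)"
        using x r cl fcl C.part_homog[of x n] by (simp add: C.B.l_distr map_add map_mult)
      then show ?case
        using insert.IH J.I.a_closed J.I.I_r_closed[OF part_J map_closed[OF r]] by simp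
    qed
    from this[OF C.finite_parts[of x]] have "\<phi> i (x \<otimes>\<^bsub>C\<^esub> r) \<in> J" for i
      using x C.sum_parts[of x] by simp
    then show ?thesis using x r by simp
  qed
  have "ideal ?I C"
  proof (rule idealI[OF C.B.ring_axioms])
    show "subgroup ?I (add_monoid C)"
    proof (rule C.M.add.subgroupI)
      have "\<zero>\<^bsub>C\<^esub> \<in> ?I" using J.I.zero_closed by (simp add: map_zero)
      then show "?I \<noteq> {}" by blast
      show "\<ominus>\<^bsub>C\<^esub> x \<in> ?I" if "x \<in> ?I" for x
        using left[OF that, of "\<ominus>\<^bsub>C\<^esub> \<one>\<^bsub>C\<^esub>"] that by (simp add: C.B.l_minus)
      show "x \<oplus>\<^bsub>C\<^esub> y \<in> ?I" if "x \<in> ?I" "y \<in> ?I" for x y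
        using that J.I.a_closed by (simp add: map_add)
    qed auto
  qed (use left right in auto)
  moreover have "S \<subseteq> ?I" using S map_S C.homog_closed by blast
  ultimately have "Idl\<^bsub>C\<^esub> S \<subseteq> ?I" by (rule C.B.genideal_minimal)
  then show ?thesis by blast
qed

lemma map_genideal:
  assumes S: "\<And>s. s \<in> S \<Longrightarrow> \<exists>n. s \<in> homog C n" and T: "\<And>t. t \<in> T \<Longrightarrow> \<exists>n. t \<in> homog B n"
    and map_S: "\<And>i s. s \<in> S \<Longrightarrow> \<phi> i s \<in> Idl\<^bsub>B\<^esub> T"
    and inverse_T: "\<And>i t. t \<in> T \<Longrightarrow> inverse i t \<in> Idl\<^bsub>C\<^esub> S"
  shows "\<phi> i ` (Idl\<^bsub>C\<^esub> S) = Idl\<^bsub>B\<^esub> T"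
proof
  interpret inv: twisting_system K B C inverse by (rule twisting_system_inverse)
  show "\<phi> i ` (Idl\<^bsub>C\<^esub> S) \<subseteq> Idl\<^bsub>B\<^esub> T"
    by (rule map_genideal_subset[OF B.graded_ideal_genideal[OF T] S map_S])
  have "inverse i ` (Idl\<^bsub>B\<^esub> T) \<subseteq> Idl\<^bsub>C\<^esub> S"
    by (rule inv.map_genideal_subset[OF C.graded_ideal_genideal[OF S] T inverse_T])
  moreover have "Idl\<^bsub>B\<^esub> T \<subseteq> carrier B"
    using ideal.Icarr[OF graded_ideal.axioms(2)[OF B.graded_ideal_genideal[OF T]]] by blast
  ultimately show "Idl\<^bsub>B\<^esub> T \<subseteq> \<phi> i ` (Idl\<^bsub>C\<^esub> S)"
  proof (intro subsetI)
    fix y assume y: "y \<in> Idl\<^bsub>B\<^esub> T"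
    have "\<phi> i (inverse i y) = y" using y \<open>Idl\<^bsub>B\<^esub> T \<subseteq> carrier B\<close> by (intro map_inverse) blast
    moreover have "inverse i y \<in> Idl\<^bsub>C\<^esub> S" using y \<open>inverse i ` (Idl\<^bsub>B\<^esub> T) \<subseteq> Idl\<^bsub>C\<^esub> S\<close> by blast
    ultimately show "y \<in> \<phi> i ` (Idl\<^bsub>C\<^esub> S)" by (metis imageI)
  qed
qed

lemma twisting_system_quotient:
  assumes I: "graded_ideal K C I" and J: "graded_ideal K B J" and map_I: "\<And>i. \<phi> i ` I = J"
  shows "twisting_system K (quot_alg C I) (quot_alg B J) (\<lambda>i X. \<phi> i ` X)"
proof -
  interpret I: graded_ideal K C I by fact
  interpret J: graded_ideal K B J by fact
  have coset: "\<phi> i ` I.proj x = J.proj (\<phi> i x)" if x: "x \<in> carrier C" for i x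
  proof -
    have "I.proj x = (\<lambda>h. h \<oplus>\<^bsub>C\<^esub> x) ` I" by (auto simp: a_r_coset_def')
    then have "\<phi> i ` I.proj x = (\<lambda>h. \<phi> i h \<oplus>\<^bsub>B\<^esub> \<phi> i x) ` I"
      using x I.I.Icarr by (simp add: image_image map_add)
    also have "\<dots> = (\<lambda>h. h \<oplus>\<^bsub>B\<^esub> \<phi> i x) ` \<phi> i ` I" by (simp add: image_image)
    finally show ?thesis by (auto simp: map_I a_r_coset_def')
  qed
  show ?thesis
  proof (intro twisting_system.intro twisting_system_axioms.intro
      I.quot_graded_algebra J.quot_graded_algebra)
    fix i
    show "bij_betw ((`) (\<phi> i)) (carrier I.Q) (carrier J.Q)"
    proof (rule bij_betw_imageI)
      show "inj_on ((`) (\<phi> i)) (carrier I.Q)"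
      proof (rule inj_onI)
        fix X Y assume "X \<in> carrier I.Q" "Y \<in> carrier I.Q" and eq: "\<phi> i ` X = \<phi> i ` Y"
        then obtain x y where x: "x \<in> carrier C" "X = I.proj x" and y: "y \<in> carrier C" "Y = I.proj y"
          by (auto simp: I.quot_carrier)
        have "\<phi> i (x \<ominus>\<^bsub>C\<^esub> y) \<in> J"
          using eq x y map_closed by (simp add: coset J.proj_eq_iff map_minus)
        then obtain h where h: "h \<in> I" "\<phi> i (x \<ominus>\<^bsub>C\<^esub> y) = \<phi> i h" using map_I by blast
        have "x \<ominus>\<^bsub>C\<^esub> y \<in> I" using h map_inj[OF h(2)] x y I.I.Icarr[OF h(1)] by simp
        then show "X = Y" using x y by (simp add: I.proj_eq_iff)
      qed
      show "(`) (\<phi> i) ` carrier I.Q = carrier J.Q"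
      proof -
        have "(`) (\<phi> i) ` carrier I.Q = J.proj ` \<phi> i ` carrier C"
          by (simp add: I.quot_carrier image_image coset)
        then show ?thesis using bij by (simp add: J.quot_carrier bij_betw_def)
      qed
    qed
    show "(`) (\<phi> i) ` homog I.Q n = homog J.Q n" for n
    proof -
      have "(`) (\<phi> i) ` homog I.Q n = J.proj ` \<phi> i ` homog C n"
        using C.homog_closed by (simp add: I.quot_homog image_image coset)
      then show ?thesis by (simp add: J.quot_homog map_homog)
    qed
    fix X Y assume "X \<in> carrier I.Q" and Y: "Y \<in> carrier I.Q"
    then obtain x y where "x \<in> carrier C" "X = I.proj x" "y \<in> carrier C" "Y = I.proj y"
      by (auto simp: I.quot_carrier)
    then show "\<phi> i ` (X \<oplus>\<^bsub>I.Q\<^esub> Y) = \<phi> i ` X \<oplus>\<^bsub>J.Q\<^esub> \<phi> i ` Y"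
      by (simp add: I.quot_add J.quot_add coset map_add map_closed)
  next
    fix i a X assume "a \<in> carrier K" "X \<in> carrier I.Q"
    then obtain x where "a \<in> carrier K" "x \<in> carrier C" "X = I.proj x"
      by (auto simp: I.quot_carrier)
    then show "\<phi> i ` (a \<odot>\<^bsub>I.Q\<^esub> X) = a \<odot>\<^bsub>J.Q\<^esub> \<phi> i ` X"
      by (simp add: I.quot_smult J.quot_smult coset map_smult map_closed)
  next
    fix i X Y m assume "X \<in> homog I.Q m" "Y \<in> carrier I.Q"
    then obtain x y where x: "x \<in> homog C m" "X = I.proj x" and y: "y \<in> carrier C" "Y = I.proj y"
      by (auto simp: I.quot_carrier I.quot_homog)
    then show "\<phi> i ` (X \<otimes>\<^bsub>I.Q\<^esub> Y) = \<phi> i ` X \<otimes>\<^bsub>J.Q\<^esub> \<phi> (i + int m) ` Y"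
      using C.homog_closed[OF x(1)] by (simp add: I.quot_mult J.quot_mult coset map_mult map_closed)
  qed
qed

end

section \<open>Categories of graded modules\<close>

context graded_right_module
begin

sublocale graded_group M "mhomog M"
  by (intro graded_group.intro graded_group_axioms.intro mhomog_direct_sum abelian_group_axioms)

end

lemma Gr_simps [simp]:
  "Ob (Gr B) = {M. graded_right_module B M}" "Hom (Gr B) = graded_mod_hom B"
  "Idt (Gr B) = (\<lambda>M. \<lambda>x \<in> carrier M. x)"
  "Cmp (Gr B) = (\<lambda>L M N g f. compose (carrier L) g f)"
  by (simp_all add: Gr_def)

lemma graded_mod_homD:
  assumes "f \<in> graded_mod_hom B M N"
  shows "f \<in> extensional (carrier M)"
    and "x \<in> carrier M \<Longrightarrow> f x \<in> carrier N"
    and "\<lbrakk>x \<in> carrier M; y \<in> carrier M\<rbrakk> \<Longrightarrow> f (x \<oplus>\<^bsub>M\<^esub> y) = f x \<oplus>\<^bsub>N\<^esub> f y"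
    and "\<lbrakk>x \<in> carrier M; b \<in> carrier B\<rbrakk> \<Longrightarrow> f (ract M x b) = ract N (f x) b"
    and "x \<in> mhomog M i \<Longrightarrow> f x \<in> mhomog N i"
  using assms by (auto simp: graded_mod_hom_def PiE_def image_subset_iff)

lemma graded_mod_homI:
  assumes "f \<in> extensional (carrier M)"
    and "\<And>x. x \<in> carrier M \<Longrightarrow> f x \<in> carrier N"
    and "\<And>x y. \<lbrakk>x \<in> carrier M; y \<in> carrier M\<rbrakk> \<Longrightarrow> f (x \<oplus>\<^bsub>M\<^esub> y) = f x \<oplus>\<^bsub>N\<^esub> f y"
    and "\<And>x b. \<lbrakk>x \<in> carrier M; b \<in> carrier B\<rbrakk> \<Longrightarrow> f (ract M x b) = ract N (f x) b"
    and "\<And>x i. x \<in> mhomog M i \<Longrightarrow> f x \<in> mhomog N i"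
  shows "f \<in> graded_mod_hom B M N"
  using assms by (auto simp: graded_mod_hom_def PiE_def image_subset_iff)

lemma identity_graded_mod_hom:
  assumes M: "graded_right_module B M"
    and "carrier N = carrier M" "add N = add M" "mhomog N = mhomog M"
    and "\<And>x b. \<lbrakk>x \<in> carrier M; b \<in> carrier B\<rbrakk> \<Longrightarrow> ract N x b = ract M x b"
  shows "(\<lambda>x \<in> carrier M. x) \<in> graded_mod_hom B M N"
proof -
  interpret graded_right_module B M by fact
  show ?thesis
    by (rule graded_mod_homI) (auto simp: assms(2-) ract_closed homog_closed)
qed

lemma category_Gr: "category (Gr B)"
proof
  fix L assume "L \<in> Ob (Gr B)"
  then show "Idt (Gr B) L \<in> Hom (Gr B) L L"
    using identity_graded_mod_hom[of B L L] by simp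
next
  fix L M f assume "L \<in> Ob (Gr B)" "M \<in> Ob (Gr B)" "f \<in> Hom (Gr B) L M"
  then have f: "f \<in> extensional (carrier L)" "f \<in> carrier L \<rightarrow> carrier M"
    using graded_mod_homD(1,2)[of f B L M] by auto
  show "Cmp (Gr B) L M M (Idt (Gr B) M) f = f" "Cmp (Gr B) L L M f (Idt (Gr B) L) = f"
    using f by (auto simp: compose_def fun_eq_iff extensional_def Pi_def)
next
  fix L M N f g
  assume L: "L \<in> Ob (Gr B)" and M: "M \<in> Ob (Gr B)" and f: "f \<in> Hom (Gr B) L M" and g: "g \<in> Hom (Gr B) M N"
  interpret L: graded_right_module B L using L by simp
  note f' = graded_mod_homD[of f B L M, OF f[simplified]]
  note g' = graded_mod_homD[of g B M N, OF g[simplified]]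
  have "compose (carrier L) g f \<in> graded_mod_hom B L N"
    by (rule graded_mod_homI)
      (auto simp: compose_def f' g' L.ract_closed L.homog_closed)
  then show "Cmp (Gr B) L M N g f \<in> Hom (Gr B) L N" by simp
next
  fix J L M N f g h
  assume "f \<in> Hom (Gr B) J L"
  then show "Cmp (Gr B) J M N h (Cmp (Gr B) J L M g f) = Cmp (Gr B) J L N (Cmp (Gr B) L M N h g) f"
    using graded_mod_homD(2)[of f B J L] by (auto simp: compose_def fun_eq_iff)
qed

definition twisted_module ::
    "(int \<Rightarrow> 'c \<Rightarrow> 'b) \<Rightarrow> ('b, 'm) graded_mod \<Rightarrow> ('c, 'm) graded_mod" where
  "twisted_module \<phi> M =
     \<lparr>carrier = carrier M, mult = mult M, one = one M, zero = zero M, add = add M,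
      ract = (\<lambda>x c. graded_extension M (mhomog M) M (\<lambda>i u. ract M u (\<phi> i c)) x),
      mhomog = mhomog M\<rparr>"

lemma twisted_module_simps [simp]:
  "carrier (twisted_module \<phi> M) = carrier M" "zero (twisted_module \<phi> M) = zero M"
  "add (twisted_module \<phi> M) = add M" "mhomog (twisted_module \<phi> M) = mhomog M"
  by (simp_all add: twisted_module_def)

text \<open>
  The two records have different types, so their sums agree only after unfolding to the additive
  structure.
\<close>

lemma internal_direct_sum_twisted_module:
  "internal_direct_sum (twisted_module \<phi> M) H \<longleftrightarrow> internal_direct_sum M H"
  by (simp add: internal_direct_sum_def decomposition_def finsum_def finprod_def
      additive_subgroup_def subgroup_def m_inv_def twisted_module_def)

context twisting_system
begin

context
  fixes M :: "('b, 'm) graded_mod"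
  assumes M: "graded_right_module B M"
begin

interpretation M: graded_right_module B M by (rule M)

lemma action_maps:
  assumes c: "c \<in> carrier C"
  shows "graded_group_maps M (mhomog M) M (\<lambda>i u. ract M u (\<phi> i c))"
  by unfold_locales (simp_all add: M.ract_closed M.ract_add_left M.homog_closed map_closed[OF c])

lemma twisted_ract_closed:
  "\<lbrakk>x \<in> carrier M; c \<in> carrier C\<rbrakk> \<Longrightarrow> ract (twisted_module \<phi> M) x c \<in> carrier M"
  using graded_group_maps.extension_closed[OF action_maps] by (simp add: twisted_module_def)

lemma twisted_ract_add_left:
  "\<lbrakk>x \<in> carrier M; y \<in> carrier M; c \<in> carrier C\<rbrakk> \<Longrightarrow>
    ract (twisted_module \<phi> M) (x \<oplus>\<^bsub>M\<^esub> y) c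
      = ract (twisted_module \<phi> M) x c \<oplus>\<^bsub>M\<^esub> ract (twisted_module \<phi> M) y c"
  using graded_group_maps.extension_add[OF action_maps] by (simp add: twisted_module_def)

lemma twisted_ract_homog:
  "\<lbrakk>x \<in> mhomog M i; c \<in> carrier C\<rbrakk> \<Longrightarrow> ract (twisted_module \<phi> M) x c = ract M x (\<phi> i c)"
  using graded_group_maps.extension_homog[OF action_maps] by (simp add: twisted_module_def)

lemma graded_right_module_twisted: "graded_right_module C (twisted_module \<phi> M)"
proof -
  let ?N = "twisted_module \<phi> M"
  have add_right: "ract ?N x (c \<oplus>\<^bsub>C\<^esub> d) = ract ?N x c \<oplus>\<^bsub>M\<^esub> ract ?N x d"
    if x: "x \<in> carrier M" and cd: "c \<in> carrier C" "d \<in> carrier C" for x c d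
    using x
  proof (induction x rule: M.homog_induct)
    case (homog i x)
    then show ?case
      using cd M.homog_closed[OF homog]
      by (simp add: twisted_ract_homog map_add M.ract_add_right map_closed)
  next
    case (add x y)
    then show ?case
      using cd by (simp add: twisted_ract_add_left twisted_ract_closed M.a_ac)
  qed
  have mult: "ract ?N x (c \<otimes>\<^bsub>C\<^esub> d) = ract ?N (ract ?N x c) d"
    if x: "x \<in> carrier M" and c: "c \<in> carrier C" and d: "d \<in> carrier C" for x c d
    using x
  proof (induction x rule: M.homog_induct)
    case (homog i x)
    have xM: "x \<in> carrier M" using M.homog_closed[OF homog] .
    show ?case
      using c
    proof (induction c rule: C.homog_induct)
      case (homog n c)
      have cC: "c \<in> carrier C" using C.homog_closed[OF homog] .
      have "ract M x (\<phi> i c) \<in> mhomog M (i + int n)"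
        using M.mhomog_ract[OF \<open>x \<in> mhomog M i\<close> map_homog_closed[OF homog]] .
      then show ?case
        using \<open>x \<in> mhomog M i\<close> homog cC d xM
        by (simp add: twisted_ract_homog map_mult M.ract_mult map_closed)
    next
      case (add c c')
      then show ?case
        using d xM by (simp add: C.B.l_distr add_right twisted_ract_closed twisted_ract_add_left)
    qed
  next
    case (add x y)
    then show ?case
      using c d by (simp add: twisted_ract_add_left twisted_ract_closed)
  qed
  have one: "ract ?N x \<one>\<^bsub>C\<^esub> = x" if "x \<in> carrier M" for x
    using that
  proof (induction x rule: M.homog_induct)
    case (homog i x)
    then show ?case
      using M.homog_closed[OF homog] by (simp add: twisted_ract_homog map_one M.ract_one)
  next
    case (add x y)
    then show ?case by (simp add: twisted_ract_add_left)
  qed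
  have group: "abelian_group ?N"
  proof (rule abelian_groupI)
    show "\<exists>y\<in>carrier ?N. y \<oplus>\<^bsub>?N\<^esub> x = \<zero>\<^bsub>?N\<^esub>" if "x \<in> carrier ?N" for x
      using that M.l_neg[of x] M.a_inv_closed[of x] by auto
  qed (simp_all add: M.a_ac)
  show ?thesis
  proof (intro graded_right_module.intro graded_right_module_axioms.intro group)
    show "internal_direct_sum ?N (mhomog ?N)"
      using M.mhomog_direct_sum by (simp add: internal_direct_sum_twisted_module)
    show "ract ?N x c \<in> mhomog ?N (i + int n)" if "x \<in> mhomog ?N i" "c \<in> homog C n" for x c i n
      using that C.homog_closed[OF that(2)] M.mhomog_ract[of x i "\<phi> i c" n] map_homog_closed[OF that(2)]
      by (simp add: twisted_ract_homog)
  qed (simp_all add: twisted_ract_closed twisted_ract_add_left add_right mult one)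
qed

end

lemma twisted_module_hom:
  assumes M: "graded_right_module B M" and N: "graded_right_module B N"
    and f: "f \<in> graded_mod_hom B M N"
  shows "f \<in> graded_mod_hom C (twisted_module \<phi> M) (twisted_module \<phi> N)"
proof -
  interpret M: graded_right_module B M by (rule M)
  note f' = graded_mod_homD[OF f]
  have "f (ract (twisted_module \<phi> M) x c) = ract (twisted_module \<phi> N) (f x) c"
    if x: "x \<in> carrier M" and c: "c \<in> carrier C" for x c
    using x
  proof (induction x rule: M.homog_induct)
    case (homog i x)
    then show ?case
      using c M.homog_closed[OF homog]
      by (simp add: twisted_ract_homog[OF M] twisted_ract_homog[OF N f'(5)[OF homog]] f' map_closed)
  next
    case (add x y)
    then show ?case
      using c by (simp add: f' twisted_ract_add_left[OF M] twisted_ract_add_left[OF N]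
        twisted_ract_closed[OF M])
  qed
  then show ?thesis
    by (intro graded_mod_homI) (simp_all add: f')
qed

lemma functor_twisted_module:
  "cat_functor (Gr B) (Gr C) (twisted_module \<phi>) (\<lambda>M N f. f)"
  by (intro cat_functor.intro cat_functor_axioms.intro category_Gr)
    (simp_all add: graded_right_module_twisted twisted_module_hom)

text \<open>
  Twisting forth and back restores the action on the carrier but not the values of \<open>ract\<close> off the
  carrier, so the round trip is only naturally isomorphic to the identity, by the identity maps.
\<close>

lemma twisted_module_round_trip:
  assumes \<psi>: "twisting_system K B C \<psi>" and inv: "\<And>i b. b \<in> carrier B \<Longrightarrow> \<phi> i (\<psi> i b) = b"
  shows "naturally_isomorphic (Gr B) (Gr B)
    (\<lambda>M. twisted_module \<psi> (twisted_module \<phi> M)) (\<lambda>M N f. f) (\<lambda>M. M) (\<lambda>M N f. f)"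
proof -
  interpret psi: twisting_system K B C \<psi> by fact
  let ?T = "\<lambda>M. twisted_module \<psi> (twisted_module \<phi> M)"
  have ract: "ract (?T M) x b = ract M x b"
    if M: "graded_right_module B M" and x: "x \<in> carrier M" and b: "b \<in> carrier B" for M :: "('b, 'm) graded_mod" and x b
  proof -
    interpret M: graded_right_module B M by fact
    have N: "graded_right_module C (twisted_module \<phi> M)" by (rule graded_right_module_twisted[OF M])
    show ?thesis
      using x
    proof (induction x rule: M.homog_induct)
      case (homog i x)
      then show ?case
        using b by (simp add: psi.twisted_ract_homog[OF N] twisted_ract_homog[OF M] psi.map_closed inv)
    next
      case (add x y)
      then show ?case
        using b psi.twisted_ract_add_left[OF N, of x y b] by (simp add: M.ract_add_left)
    qed
  qed
  have "(\<lambda>x \<in> carrier M. x) \<in> cat_isos (Gr B) (?T M) M" if M: "graded_right_module B M" for M :: "('b, 'm) graded_mod"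
  proof -
    have T: "graded_right_module B (?T M)"
      by (rule psi.graded_right_module_twisted[OF graded_right_module_twisted[OF M]])
    have "(\<lambda>x \<in> carrier M. x) \<in> graded_mod_hom B (?T M) M"
      using identity_graded_mod_hom[OF T, of M] ract[OF M] by simp
    moreover have "(\<lambda>x \<in> carrier M. x) \<in> graded_mod_hom B M (?T M)"
      using identity_graded_mod_hom[OF M, of "?T M"] ract[OF M] by simp
    ultimately show ?thesis
      by (auto simp: cat_isos_def compose_def fun_eq_iff restrict_def intro!: bexI[of _ "\<lambda>x \<in> carrier M. x"])
  qed
  moreover have "compose (carrier M) (\<lambda>x \<in> carrier N. x) f = compose (carrier M) f (\<lambda>x \<in> carrier M. x)"
    if "f \<in> graded_mod_hom B M N" for M N :: "('b, 'm) graded_mod" and f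
    using graded_mod_homD(2)[OF that] by (auto simp: compose_def fun_eq_iff)
  ultimately show ?thesis
    unfolding naturally_isomorphic_def
    by (intro exI[of _ "\<lambda>M. \<lambda>x \<in> carrier M. x"]) (simp, blast)
qed

theorem equivalent_module_categories:
  "equivalent_categories (Gr C :: (('c, 'm) graded_mod, 'm \<Rightarrow> 'm) cat)
    (Gr B :: (('b, 'm) graded_mod, 'm \<Rightarrow> 'm) cat)"
proof -
  interpret inv: twisting_system K B C inverse by (rule twisting_system_inverse)
  show ?thesis
    unfolding equivalent_categories_def
    using inv.functor_twisted_module functor_twisted_module
      inv.twisted_module_round_trip[OF twisting_system_axioms inverse_map]
      twisted_module_round_trip[OF inv.twisting_system_axioms map_inverse]
    by blast
qed

end

section \<open>The free algebra\<close>

lemma (in abelian_monoid) finsum_swap: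
  assumes "finite A" "finite B" "\<And>x y. \<lbrakk>x \<in> A; y \<in> B\<rbrakk> \<Longrightarrow> f x y \<in> carrier G"
  shows "(\<Oplus>x\<in>A. \<Oplus>y\<in>B. f x y) = (\<Oplus>y\<in>B. \<Oplus>x\<in>A. f x y)"
  using assms
proof (induction A)
  case empty
  then show ?case by simp
next
  case (insert a A)
  have "(\<Oplus>y\<in>B. \<Oplus>x\<in>insert a A. f x y) = (\<Oplus>y\<in>B. f a y \<oplus> (\<Oplus>x\<in>A. f x y))"
    using insert by (intro finsum_cong') auto
  also have "\<dots> = (\<Oplus>y\<in>B. f a y) \<oplus> (\<Oplus>y\<in>B. \<Oplus>x\<in>A. f x y)"
    using insert by (intro finsum_addf) auto
  also have "\<dots> = (\<Oplus>x\<in>insert a A. \<Oplus>y\<in>B. f x y)"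
    using insert by (subst finsum_insert) auto
  finally show ?case by simp
qed

definition convolution ::
    "('k, 'r) ring_scheme \<Rightarrow> ('v list \<Rightarrow> 'k) \<Rightarrow> ('v list \<Rightarrow> 'k) \<Rightarrow> 'v list \<Rightarrow> 'k"
    (infixl "\<star>\<index>" 70) where
  "convolution K p q w = finsum K (\<lambda>i. p (take i w) \<otimes>\<^bsub>K\<^esub> q (drop i w)) {..length w}"

context field
begin

abbreviation coeffs :: "('v list \<Rightarrow> 'a) \<Rightarrow> bool" where
  "coeffs p \<equiv> \<forall>w. p w \<in> carrier R"

abbreviation free :: "('a, 'v list \<Rightarrow> 'a) graded_alg" where
  "free \<equiv> free_alg R"

lemma conv_closed: "\<lbrakk>coeffs p; coeffs q\<rbrakk> \<Longrightarrow> (p \<star> q) w \<in> carrier R"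
  by (simp add: convolution_def)

lemma conv_Nil: "\<lbrakk>coeffs p; coeffs q\<rbrakk> \<Longrightarrow> (p \<star> q) [] = p [] \<otimes> q []"
  by (simp add: convolution_def)

text \<open>
  Splitting off the first letter of the word. With this recursion the laws of the convolution
  product follow by induction on the word, without any exchange of sums.
\<close>

lemma conv_Cons:
  "\<lbrakk>coeffs p; coeffs q\<rbrakk> \<Longrightarrow> (p \<star> q) (x # w) = p [] \<otimes> q (x # w) \<oplus> ((\<lambda>u. p (x # u)) \<star> q) w"
  unfolding convolution_def by (simp add: finsum_Suc2 a_comm del: finsum_Suc add.finprod_Suc)

lemma conv_zero_left: "coeffs q \<Longrightarrow> ((\<lambda>u. \<zero>) \<star> q) w = \<zero>"
  by (simp add: convolution_def)

lemma conv_add_left: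
  "\<lbrakk>coeffs p; coeffs p'; coeffs q\<rbrakk> \<Longrightarrow> ((\<lambda>u. p u \<oplus> p' u) \<star> q) w = (p \<star> q) w \<oplus> (p' \<star> q) w"
  by (simp add: convolution_def l_distr finsum_addf)

lemma conv_add_right:
  "\<lbrakk>coeffs p; coeffs q; coeffs q'\<rbrakk> \<Longrightarrow> (p \<star> (\<lambda>u. q u \<oplus> q' u)) w = (p \<star> q) w \<oplus> (p \<star> q') w"
  by (simp add: convolution_def r_distr finsum_addf)

lemma conv_smult_left:
  "\<lbrakk>a \<in> carrier R; coeffs p; coeffs q\<rbrakk> \<Longrightarrow> ((\<lambda>u. a \<otimes> p u) \<star> q) w = a \<otimes> (p \<star> q) w"
  by (simp add: convolution_def m_assoc finsum_rdistr)

lemma conv_smult_right: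
  "\<lbrakk>a \<in> carrier R; coeffs p; coeffs q\<rbrakk> \<Longrightarrow> (p \<star> (\<lambda>u. a \<otimes> q u)) w = a \<otimes> (p \<star> q) w"
  by (simp add: convolution_def m_lcomm finsum_rdistr)

lemma conv_sum_left:
  assumes "finite A" "\<And>x. x \<in> A \<Longrightarrow> coeffs (f x)" "coeffs q"
  shows "((\<lambda>u. \<Oplus>x\<in>A. f x u) \<star> q) w = (\<Oplus>x\<in>A. (f x \<star> q) w)"
  using assms
proof (induction A)
  case empty
  then show ?case by (simp add: conv_zero_left)
next
  case (insert a A)
  then have "(\<lambda>u. \<Oplus>x\<in>insert a A. f x u) = (\<lambda>u. f a u \<oplus> (\<Oplus>x\<in>A. f x u))"
    by (intro ext finsum_insert) auto
  with insert show ?case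
    by (subst finsum_insert) (auto simp: conv_closed conv_add_left finsum_closed Pi_def)
qed

lemma conv_assoc:
  "\<lbrakk>coeffs p; coeffs q; coeffs r\<rbrakk> \<Longrightarrow> ((p \<star> q) \<star> r) w = (p \<star> (q \<star> r)) w"
proof (induction w arbitrary: p)
  case Nil
  then show ?case by (simp add: conv_Nil conv_closed m_assoc)
next
  case (Cons x w)
  let ?d = "\<lambda>p u. p (x # u)"
  have "((p \<star> q) \<star> r) (x # w) = p [] \<otimes> q [] \<otimes> r (x # w) \<oplus> ((\<lambda>u. p [] \<otimes> ?d q u \<oplus> (?d p \<star> q) u) \<star> r) w"
    using Cons.prems by (simp add: conv_Cons conv_Nil conv_closed)
  also have "((\<lambda>u. p [] \<otimes> ?d q u \<oplus> (?d p \<star> q) u) \<star> r) w = p [] \<otimes> (?d q \<star> r) w \<oplus> (?d p \<star> (q \<star> r)) w"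
    using Cons.prems Cons.IH[of "?d p"] by (simp add: conv_add_left conv_smult_left conv_closed)
  also have "p [] \<otimes> q [] \<otimes> r (x # w) \<oplus> \<dots> = p [] \<otimes> (q \<star> r) (x # w) \<oplus> (?d p \<star> (q \<star> r)) w"
    using Cons.prems by (simp add: conv_Cons conv_closed r_distr m_assoc a_assoc)
  finally show ?case using Cons.prems by (simp add: conv_Cons conv_closed)
qed

lemma conv_one_left: "coeffs p \<Longrightarrow> ((\<lambda>u. if u = [] then \<one> else \<zero>) \<star> p) w = p w"
  by (cases w) (simp_all add: conv_Nil conv_Cons conv_zero_left)

lemma conv_one_right: "coeffs p \<Longrightarrow> (p \<star> (\<lambda>u. if u = [] then \<one> else \<zero>)) w = p w"
  by (induction w arbitrary: p) (simp_all add: conv_Nil conv_Cons)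

lemma conv_support:
  assumes "coeffs p" "coeffs q" "(p \<star> q) w \<noteq> \<zero>"
  shows "\<exists>u v. w = u @ v \<and> p u \<noteq> \<zero> \<and> q v \<noteq> \<zero>"
  using assms
proof (induction w arbitrary: p)
  case Nil
  then show ?case using integral_iff by (auto simp: conv_Nil)
next
  case (Cons x w)
  then consider "p [] \<otimes> q (x # w) \<noteq> \<zero>" | "((\<lambda>u. p (x # u)) \<star> q) w \<noteq> \<zero>"
    by (cases "p [] \<otimes> q (x # w) = \<zero>") (auto simp: conv_Cons conv_closed)
  then show ?case
  proof cases
    case 1
    then show ?thesis using Cons.prems by (intro exI[of _ "[]"] exI[of _ "x # w"]) auto
  next
    case 2
    then obtain u v where "w = u @ v" "p (x # u) \<noteq> \<zero>" "q v \<noteq> \<zero>"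
      using Cons.IH[of "\<lambda>u. p (x # u)"] Cons.prems by auto
    then show ?thesis by (intro exI[of _ "x # u"] exI[of _ v]) auto
  qed
qed

lemma free_simps:
  "carrier free = {p. coeffs p \<and> finite {w. p w \<noteq> \<zero>}}"
  "p \<otimes>\<^bsub>free\<^esub> q = p \<star> q" "\<one>\<^bsub>free\<^esub> = (\<lambda>w. if w = [] then \<one> else \<zero>)"
  "\<zero>\<^bsub>free\<^esub> = (\<lambda>w. \<zero>)" "p \<oplus>\<^bsub>free\<^esub> q = (\<lambda>w. p w \<oplus> q w)" "a \<odot>\<^bsub>free\<^esub> p = (\<lambda>w. a \<otimes> p w)"
  "homog free n = {p \<in> carrier free. \<forall>w. p w \<noteq> \<zero> \<longrightarrow> length w = n}"
  by (auto simp: free_alg_def convolution_def fun_eq_iff)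

lemma free_carrier_add:
  assumes "p \<in> carrier free" "q \<in> carrier free" shows "(\<lambda>w. p w \<oplus> q w) \<in> carrier free"
proof -
  have "{w. p w \<oplus> q w \<noteq> \<zero>} \<subseteq> {w. p w \<noteq> \<zero>} \<union> {w. q w \<noteq> \<zero>}" by auto
  then show ?thesis using assms by (auto simp: free_simps intro: finite_subset)
qed

lemma free_carrier_mono:
  assumes "p \<in> carrier free" "\<And>w. q w \<in> carrier R" "\<And>w. p w = \<zero> \<Longrightarrow> q w = \<zero>"
  shows "q \<in> carrier free"
proof -
  have "{w. q w \<noteq> \<zero>} \<subseteq> {w. p w \<noteq> \<zero>}" using assms(3) by auto
  then show ?thesis using assms(1,2) by (auto simp: free_simps intro: finite_subset)
qed

lemma free_carrier_conv:
  assumes "p \<in> carrier free" "q \<in> carrier free" shows "p \<star> q \<in> carrier free"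
proof -
  have "{w. (p \<star> q) w \<noteq> \<zero>} \<subseteq> (\<lambda>(u, v). u @ v) ` ({w. p w \<noteq> \<zero>} \<times> {w. q w \<noteq> \<zero>})"
    using assms conv_support[of p q] by (auto simp: free_simps image_iff)
  then show ?thesis using assms by (auto simp: free_simps conv_closed intro: finite_subset)
qed

lemma free_abelian_group: "abelian_group (free :: ('a, 'v list \<Rightarrow> 'a) graded_alg)"
proof (rule abelian_groupI)
  fix p :: "'v list \<Rightarrow> 'a" assume p: "p \<in> carrier free"
  then show "\<exists>q \<in> carrier free. q \<oplus>\<^bsub>free\<^esub> p = \<zero>\<^bsub>free\<^esub>"
    using free_carrier_mono[OF p, of "\<lambda>w. \<ominus> p w"]
    by (intro bexI[of _ "\<lambda>w. \<ominus> p w"]) (auto simp: free_simps l_neg)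
qed (auto simp: free_simps(4,5) free_carrier_add, auto simp: free_simps fun_eq_iff a_ac)

lemma free_ring: "ring free"
proof (rule ringI[OF free_abelian_group])
  show "monoid free"
    by (rule monoidI)
      (auto simp: free_simps(2,3) free_carrier_conv,
       auto simp: free_simps fun_eq_iff conv_assoc conv_one_left conv_one_right)
qed (auto simp: free_simps fun_eq_iff conv_add_left conv_add_right)

lemma free_module: "module R free"
proof (rule moduleI[OF is_cring free_abelian_group])
  show "a \<odot>\<^bsub>free\<^esub> p \<in> carrier free" if "a \<in> carrier R" "p \<in> carrier free" for a and p :: "'v list \<Rightarrow> 'a"
    using free_carrier_mono[OF that(2), of "\<lambda>w. a \<otimes> p w"] that by (auto simp: free_simps)
qed (auto simp: free_simps fun_eq_iff l_distr r_distr m_assoc)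

lemma free_finsum:
  assumes "finite A" "\<And>i. i \<in> A \<Longrightarrow> c i \<in> carrier free"
  shows "finsum free c A w = (\<Oplus>i\<in>A. c i w)"
proof -
  interpret F: abelian_group free by (rule free_abelian_group)
  show ?thesis
    using assms
  proof (induction A)
    case empty
    then show ?case by (simp add: free_simps)
  next
    case (insert a A)
    then have "finsum free c (insert a A) = c a \<oplus>\<^bsub>free\<^esub> finsum free c A"
      by (intro F.finsum_insert) auto
    moreover have "(\<Oplus>i\<in>insert a A. c i w) = c a w \<oplus> (\<Oplus>i\<in>A. c i w)"
      using insert by (intro finsum_insert) (auto simp: free_simps)
    ultimately show ?case using insert by (simp add: free_simps)
  qed
qed

lemma free_direct_sum: "internal_direct_sum free (homog (free :: ('a, 'v list \<Rightarrow> 'a) graded_alg))"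
proof -
  interpret F: abelian_group "free :: ('a, 'v list \<Rightarrow> 'a) graded_alg" by (rule free_abelian_group)
  let ?p = "\<lambda>p n w. if length w = n then p w else \<zero>"
  have p_closed: "?p q n \<in> carrier free" if "q \<in> carrier free" for q :: "'v list \<Rightarrow> 'a" and n
    using that by (rule free_carrier_mono) (use that in \<open>auto simp: free_simps\<close>)
  show ?thesis
  proof (rule F.internal_direct_sumI(1)[where p = ?p])
    fix n
    show "additive_subgroup (homog free n) (free :: ('a, 'v list \<Rightarrow> 'a) graded_alg)"
    proof (rule additive_subgroupI, rule F.add.subgroupI)
      show "homog free n \<noteq> ({} :: ('v list \<Rightarrow> 'a) set)"
      proof -
        have "\<zero>\<^bsub>free\<^esub> \<in> homog (free :: ('a, 'v list \<Rightarrow> 'a) graded_alg) n" by (simp add: free_simps)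
        then show ?thesis by blast
      qed
      fix p q :: "'v list \<Rightarrow> 'a" assume p: "p \<in> homog free n" and q: "q \<in> homog free n"
      have "(\<lambda>w. \<ominus> p w) \<in> carrier free"
        using p free_carrier_mono[of p "\<lambda>w. \<ominus> p w"] by (auto simp: free_simps)
      moreover from this have "\<ominus>\<^bsub>free\<^esub> p = (\<lambda>w. \<ominus> p w)"
        using p by (intro F.minus_equality) (auto simp: free_simps l_neg)
      ultimately show "\<ominus>\<^bsub>free\<^esub> p \<in> homog free n" using p by (auto simp: free_simps)
      show "p \<oplus>\<^bsub>free\<^esub> q \<in> homog free n"
        using p q free_carrier_add[of p q] by (auto simp: free_simps) (metis l_zero zero_closed)
    qed (auto simp: free_simps)
  next
    fix p :: "'v list \<Rightarrow> 'a" assume p: "p \<in> carrier free"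
    show "?p p n \<in> homog free n" for n
      using p_closed[OF p] by (simp add: free_simps(7))
    have sub: "{n. ?p p n \<noteq> \<zero>\<^bsub>free\<^esub>} = length ` {w. p w \<noteq> \<zero>}"
      by (force simp: free_simps fun_eq_iff)
    then show fin: "finite {n. ?p p n \<noteq> \<zero>\<^bsub>free\<^esub>}" using p by (simp add: free_simps)
    show "p = finsum free (?p p) {n. ?p p n \<noteq> \<zero>\<^bsub>free\<^esub>}"
    proof
      fix w
      have "finsum free (?p p) {n. ?p p n \<noteq> \<zero>\<^bsub>free\<^esub>} w = (\<Oplus>n\<in>length ` {w. p w \<noteq> \<zero>}. ?p p n w)"
        using free_finsum[OF fin p_closed[OF p]] sub by simp
      also have "\<dots> = p w"
      proof (cases "p w = \<zero>")
        case True
        then show ?thesis by (simp add: if_distrib cong: if_cong)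
      next
        case False
        then show ?thesis
          using p finsum_singleton[of "length w" "length ` {w. p w \<noteq> \<zero>}" "\<lambda>_. p w"]
          by (auto simp: free_simps)
      qed
      finally show "p w = finsum free (?p p) {n. ?p p n \<noteq> \<zero>\<^bsub>free\<^esub>} w" by simp
    qed
  next
    fix p q :: "'v list \<Rightarrow> 'a" and n assume "p \<in> carrier free" "q \<in> carrier free"
    then show "?p (p \<oplus>\<^bsub>free\<^esub> q) n = ?p p n \<oplus>\<^bsub>free\<^esub> ?p q n" by (auto simp: free_simps)
  next
    fix p :: "'v list \<Rightarrow> 'a" and i j assume "p \<in> homog free j"
    then show "?p p i = (if i = j then p else \<zero>\<^bsub>free\<^esub>)"
      by (auto simp: free_simps fun_eq_iff) metis
  qed
qed

lemma free_graded_algebra: "graded_algebra R free"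
proof (intro graded_algebra.intro graded_algebra_axioms.intro field_axioms free_module free_ring
    free_direct_sum)
  fix p q :: "'v list \<Rightarrow> 'a" and m n assume "p \<in> homog free m" "q \<in> homog free n"
  then show "p \<otimes>\<^bsub>free\<^esub> q \<in> homog free (m + n)"
    using free_carrier_conv[of p q] conv_support[of p q] by (auto simp: free_simps) fastforce
next
  interpret module R "free :: ('a, 'v list \<Rightarrow> 'a) graded_alg" by (rule free_module)
  fix p :: "'v list \<Rightarrow> 'a" and a n assume "a \<in> carrier R" "p \<in> homog free n"
  then show "a \<odot>\<^bsub>free\<^esub> p \<in> homog free n"
    using smult_closed[of a p] by (auto simp: free_simps) (metis r_null)
qed (auto simp: free_simps fun_eq_iff conv_smult_left conv_smult_right)

end

section \<open>Linear substitutions depending on the position\<close>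

text \<open>
  The linear map that replaces a letter \<open>x\<close> at position \<open>n\<close> of a word by \<open>\<Sum>\<^sub>y H (i + n) x y \<cdot> y\<close>, expressed on
  coefficient functions: the coefficients after the first letter \<open>x\<close> are those of \<open>\<lambda>u. p (x # u)\<close>.
\<close>

primrec substitute ::
    "('k, 'r) ring_scheme \<Rightarrow> (int \<Rightarrow> 'v \<Rightarrow> 'v \<Rightarrow> 'k) \<Rightarrow> int \<Rightarrow> ('v list \<Rightarrow> 'k) \<Rightarrow> 'v list \<Rightarrow> 'k" where
  "substitute K H i p [] = p []"
| "substitute K H i p (y # w) =
    finsum K (\<lambda>x. H i x y \<otimes>\<^bsub>K\<^esub> substitute K H (i + 1) (\<lambda>u. p (x # u)) w) UNIV"

locale invertible_substitution = field K for K :: "('k, 'r) ring_scheme" (structure) +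
  fixes H G :: "int \<Rightarrow> 'v::finite \<Rightarrow> 'v \<Rightarrow> 'k"
  assumes H_closed: "H i x y \<in> carrier K" and G_closed: "G i x y \<in> carrier K"
    and HG: "(\<Oplus>y\<in>UNIV. H i x y \<otimes> G i y z) = (if x = z then \<one> else \<zero>)"
    and GH: "(\<Oplus>y\<in>UNIV. G i x y \<otimes> H i y z) = (if x = z then \<one> else \<zero>)"
begin

abbreviation "sub \<equiv> substitute K H"

lemma sub_closed: "coeffs p \<Longrightarrow> sub i p w \<in> carrier K"
  by (induction w arbitrary: i p) (auto simp: H_closed intro!: finsum_closed)

lemma sub_zero:
  assumes "\<And>u. length u = length w \<Longrightarrow> p u = \<zero>" shows "sub i p w = \<zero>"
  using assms by (induction w arbitrary: i p) (auto simp: H_closed)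

lemma sub_add:
  assumes "coeffs p" "coeffs q" shows "sub i (\<lambda>u. p u \<oplus> q u) w = sub i p w \<oplus> sub i q w"
  using assms
proof (induction w arbitrary: i p q)
  case (Cons y w)
  then show ?case by (simp add: H_closed sub_closed r_distr finsum_addf)
qed simp

lemma sub_smult:
  assumes "coeffs p" "a \<in> carrier K" shows "sub i (\<lambda>u. a \<otimes> p u) w = a \<otimes> sub i p w"
  using assms
proof (induction w arbitrary: i p)
  case (Cons y w)
  then show ?case by (simp add: H_closed sub_closed m_lcomm finsum_rdistr)
qed simp

lemma sub_sum:
  assumes "finite A" "\<And>x. x \<in> A \<Longrightarrow> coeffs (f x)"
  shows "sub i (\<lambda>u. \<Oplus>x\<in>A. f x u) w = (\<Oplus>x\<in>A. sub i (f x) w)"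
  using assms
proof (induction A)
  case empty
  then show ?case by (simp add: sub_zero)
next
  case (insert a A)
  then have "(\<lambda>u. \<Oplus>x\<in>insert a A. f x u) = (\<lambda>u. f a u \<oplus> (\<Oplus>x\<in>A. f x u))"
    by (intro ext finsum_insert) auto
  with insert show ?case
    by (subst finsum_insert) (auto simp: sub_closed sub_add finsum_closed Pi_def)
qed

text \<open>
  The second factor of a product starts at position \<open>m\<close>, so it is substituted with matrices
  shifted by \<open>m\<close>. This is the product rule of a twisting system.
\<close>

lemma sub_conv:
  assumes "coeffs p" "coeffs q" "\<And>u. p u \<noteq> \<zero> \<Longrightarrow> length u = m"
  shows "sub i (p \<star> q) w = (sub i p \<star> sub (i + int m) q) w"
  using assms
proof (induction w arbitrary: i p m)
  case Nil
  then show ?case by (simp add: conv_Nil sub_closed)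
next
  case (Cons y w)
  let ?d = "\<lambda>p x u. p (x # u)"
  have cl: "coeffs (?d p x)" "coeffs (?d q x)" "coeffs (?d p x \<star> q)" for x
    using Cons.prems by (simp_all add: conv_closed)
  have L: "sub i (p \<star> q) (y # w) = (\<Oplus>x\<in>UNIV. H i x y \<otimes>
      (p [] \<otimes> sub (i + 1) (?d q x) w \<oplus> sub (i + 1) (?d p x \<star> q) w))"
    using Cons.prems cl by (simp add: conv_Cons sub_add sub_smult)
  have R: "(sub i p \<star> sub (i + int m) q) (y # w) = p [] \<otimes> sub (i + int m) q (y # w)
      \<oplus> (\<Oplus>x\<in>UNIV. H i x y \<otimes> (sub (i + 1) (?d p x) \<star> sub (i + int m) q) w)"
    using Cons.prems cl
    by (simp add: conv_Cons sub_closed H_closed conv_sum_left conv_smult_left del: substitute.simps(2))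
      (simp add: conv_sum_left conv_smult_left sub_closed H_closed)
  show ?case
  proof (cases m)
    case 0
    have z: "?d p x = (\<lambda>u. \<zero>)" for x
      using Cons.prems(3) 0 by fastforce
    have z': "sub j (\<lambda>u. \<zero>) = (\<lambda>u. \<zero>)" for j
      by (simp add: fun_eq_iff sub_zero)
    have z'': "(\<lambda>u. \<zero>) \<star> q' = (\<lambda>u. \<zero>)" if "coeffs q'" for q' :: "'v list \<Rightarrow> 'k"
      using that by (simp add: fun_eq_iff conv_zero_left)
    show ?thesis
      unfolding L R using Cons.prems cl 0
      by (simp add: z z' z'' conv_zero_left sub_closed H_closed m_lcomm finsum_rdistr)
  next
    case (Suc n)
    have p0: "p [] = \<zero>" using Cons.prems(3)[of "[]"] Suc by auto
    have IH: "sub (i + 1) (?d p x \<star> q) w = (sub (i + 1) (?d p x) \<star> sub (i + int m) q) w" for x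
      using Cons.IH[of "?d p x" n "i + 1"] Cons.prems cl Suc Cons.prems(3)[of "x # _"]
      by (simp add: algebra_simps)
    show ?thesis
      unfolding L R using Cons.prems cl by (simp add: p0 IH sub_closed H_closed conv_closed)
  qed
qed

lemma sub_support:
  assumes "sub i p w \<noteq> \<zero>" shows "\<exists>u. length u = length w \<and> p u \<noteq> \<zero>"
  using assms sub_zero by blast

lemma sub_carrier:
  assumes "p \<in> carrier free" shows "sub i p \<in> carrier free"
proof -
  have "{w. sub i p w \<noteq> \<zero>} \<subseteq> (\<Union>n \<in> length ` {u. p u \<noteq> \<zero>}. {w. length w = n})"
    using sub_support by fastforce
  moreover have "finite {w :: 'v list. length w = n}" for n
    using finite_lists_length_eq[of "UNIV :: 'v set" n] by simp
  ultimately show ?thesis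
    using assms by (auto simp: free_simps sub_closed intro: finite_subset)
qed

lemma sub_homog: "p \<in> homog free n \<Longrightarrow> sub i p \<in> homog free n"
  using sub_carrier sub_support by (fastforce simp: free_simps(7))

lemma reverse: "invertible_substitution K G H"
  by unfold_locales (simp_all add: G_closed H_closed HG GH)

lemma reverse_sub:
  assumes "coeffs p" shows "substitute K G i (sub i p) w = p w"
  using assms
proof (induction w arbitrary: i p)
  case (Cons z w)
  interpret rev: invertible_substitution K G H by (rule reverse)
  let ?d = "\<lambda>p x u. p (x # u)"
  have cl: "coeffs (sub (i + 1) (?d p x))" "p (x # w) \<in> carrier K" for x
    using Cons.prems by (simp_all add: sub_closed)
  have "substitute K G i (sub i p) (z # w) = (\<Oplus>y\<in>UNIV. G i y z \<otimes> (\<Oplus>x\<in>UNIV. H i x y \<otimes> p (x # w)))"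
    using cl Cons by (simp add: rev.sub_sum rev.sub_smult H_closed)
  also have "\<dots> = (\<Oplus>y\<in>UNIV. \<Oplus>x\<in>UNIV. H i x y \<otimes> G i y z \<otimes> p (x # w))"
    using cl by (simp add: finsum_rdistr H_closed G_closed m_ac)
  also have "\<dots> = (\<Oplus>x\<in>UNIV. \<Oplus>y\<in>UNIV. H i x y \<otimes> G i y z \<otimes> p (x # w))"
    using cl by (intro finsum_swap) (auto simp: H_closed G_closed)
  also have "\<dots> = (\<Oplus>x\<in>UNIV. if z = x then p (x # w) else \<zero>)"
    using cl by (intro finsum_cong') (auto simp: finsum_ldistr[symmetric] H_closed G_closed HG)
  also have "\<dots> = p (z # w)"
    using cl finsum_singleton[of z UNIV "\<lambda>x. p (x # w)"] by simp
  finally show ?case .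
qed simp

lemma twisting_system_free: "twisting_system K free free sub"
proof (intro twisting_system.intro twisting_system_axioms.intro free_graded_algebra)
  interpret rev: invertible_substitution K G H by (rule reverse)
  have inv: "substitute K G i (sub i p) = p" "sub i (substitute K G i p) = p" if "p \<in> carrier free" for p i
    using that reverse_sub rev.reverse_sub by (auto simp: free_simps)
  show "bij_betw (sub i) (carrier free) (carrier free)" for i
    by (rule bij_betw_byWitness[where f' = "substitute K G i"])
      (use inv sub_carrier rev.sub_carrier in auto)
  show "sub i ` homog free n = homog free n" for i n
  proof
    show "homog free n \<subseteq> sub i ` homog free n"
    proof
      fix p :: "'v list \<Rightarrow> 'k" assume "p \<in> homog free n"
      then show "p \<in> sub i ` homog free n"
        using rev.sub_homog[of p n i] inv(2)[of p i]
        by (intro image_eqI[of _ _ "substitute K G i p"]) (auto simp: free_simps(7))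
    qed
  qed (use sub_homog in auto)
  show "sub i (p \<otimes>\<^bsub>free\<^esub> q) = sub i p \<otimes>\<^bsub>free\<^esub> sub (i + int m) q"
    if "p \<in> homog free m" "q \<in> carrier free" for i p q m
    using that sub_conv[of p q m i] by (auto simp: free_simps fun_eq_iff)
qed (auto simp: free_simps fun_eq_iff sub_add sub_smult)

lemma twisting_system_quotient_algebras:
  assumes S: "S \<subseteq> homog free n" and T: "T \<subseteq> homog free n"
    and sub_S: "\<And>i s. s \<in> S \<Longrightarrow> sub i s \<in> Idl\<^bsub>free\<^esub> T"
    and sub_T: "\<And>i t. t \<in> T \<Longrightarrow> substitute K G i t \<in> Idl\<^bsub>free\<^esub> S"
  shows "twisting_system K (quot_alg free (Idl\<^bsub>free\<^esub> S)) (quot_alg free (Idl\<^bsub>free\<^esub> T)) (\<lambda>i X. sub i ` X)"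
proof -
  interpret F: twisting_system K free free sub by (rule twisting_system_free)
  interpret rev: invertible_substitution K G H by (rule reverse)
  have S': "\<exists>n. s \<in> homog free n" if "s \<in> S" for s using S that by blast
  have T': "\<exists>n. t \<in> homog free n" if "t \<in> T" for t using T that by blast
  have "F.inverse i t \<in> Idl\<^bsub>free\<^esub> S" if "t \<in> T" for i t
  proof -
    have t: "t \<in> carrier free" using T that by (auto simp: free_simps(7))
    then have "sub i (substitute K G i t) = t"
      using rev.reverse_sub by (auto simp: free_simps)
    then have "F.inverse i t = substitute K G i t"
      using rev.sub_carrier[OF t] by (intro F.inverse_eqI)
    then show ?thesis using sub_T[OF that] by simp
  qed
  then show ?thesis
    using F.C.graded_ideal_genideal[OF S'] F.C.graded_ideal_genideal[OF T']
      F.map_genideal[OF S' T' sub_S] by (intro F.twisting_system_quotient) auto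
qed

end

section \<open>Sklyanin relations\<close>

fun num :: "gen3 \<Rightarrow> int" where
  "num Gx = 0" | "num Gy = 1" | "num Gz = 2"

definition gen :: "int \<Rightarrow> gen3" where
  "gen n = (if n mod 3 = 0 then Gx else if n mod 3 = 1 then Gy else Gz)"

lemma UNIV_gen3: "(UNIV :: gen3 set) = {Gx, Gy, Gz}"
  using gen3.exhaust by auto

instance gen3 :: finite
  by standard (simp add: UNIV_gen3)

lemma num_mod [simp]: "num x mod 3 = num x"
  by (cases x) simp_all

lemma num_gen [simp]: "num (gen n) = n mod 3"
proof -
  have "n mod 3 = 0 \<or> n mod 3 = 1 \<or> n mod 3 = 2" by presburger
  then show ?thesis by (auto simp: gen_def)
qed

lemma num_inject: "num x = num y \<longleftrightarrow> x = y"
  by (cases x; cases y) simp_all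

lemma gen_eq_iff: "gen n = x \<longleftrightarrow> (num x - n) mod 3 = 0"
proof -
  have "gen n = x \<longleftrightarrow> num (gen n) = num x" by (simp only: num_inject)
  also have "\<dots> \<longleftrightarrow> num x mod 3 = n mod 3" by (simp only: num_gen num_mod) (rule eq_commute)
  also have "\<dots> \<longleftrightarrow> (num x - n) mod 3 = 0" by (simp only: mod_eq_dvd_iff dvd_eq_mod_eq_0)
  finally show ?thesis .
qed

text \<open>
  The coefficient of \<open>x\<^sub>u x\<^sub>u\<^sub>+\<^sub>d\<close> in the relations.
\<close>

definition coeff :: "'k \<times> 'k \<times> 'k \<Rightarrow> int \<Rightarrow> 'k" where
  "coeff = (\<lambda>(a, b, c) d. if d mod 3 = 0 then c else if d mod 3 = 1 then a else b)"

text \<open>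
  The coefficients of \<open>f\<^sub>j = \<Sum>\<^sub>d \<kappa>(d) x\<^sub>j\<^sub>+\<^sub>d x\<^sub>j\<^sub>+\<^sub>2\<^sub>d\<close>: modulo 3, the indices of the word \<open>x\<^sub>j\<^sub>+\<^sub>d x\<^sub>j\<^sub>+\<^sub>2\<^sub>d\<close> differ by
  \<open>d\<close> and add up to \<open>2j = -j\<close>.
\<close>

definition relation :: "('k, 'r) ring_scheme \<Rightarrow> (int \<Rightarrow> 'k) \<Rightarrow> gen3 \<Rightarrow> gen3 list \<Rightarrow> 'k" where
  "relation K \<kappa> j w = (if length w = 2 \<and> (num (w ! 0) + num (w ! 1) + num j) mod 3 = 0
     then \<kappa> (num (w ! 1) - num (w ! 0)) else \<zero>\<^bsub>K\<^esub>)"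

definition relation_ideal :: "('k, 'r) ring_scheme \<Rightarrow> (int \<Rightarrow> 'k) \<Rightarrow> (gen3 list \<Rightarrow> 'k) set" where
  "relation_ideal K \<kappa> = Idl\<^bsub>free_alg K\<^esub> (range (relation K \<kappa>))"

definition periodic :: "(int \<Rightarrow> 'k) \<Rightarrow> bool" where
  "periodic \<kappa> \<longleftrightarrow> (\<forall>m n. m mod 3 = n mod 3 \<longrightarrow> \<kappa> m = \<kappa> n)"

lemma periodicD: "periodic \<kappa> \<Longrightarrow> m mod 3 = n mod 3 \<Longrightarrow> \<kappa> m = \<kappa> n"
  unfolding periodic_def by blast

lemma length_2_cases:
  assumes "length w = 2" obtains x y where "w = [x, y]"
  using assms by (auto simp: numeral_2_eq_2 length_Suc_conv)

context field
begin

lemma sum_gen3: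
  assumes "\<And>x. f x \<in> carrier R"
  shows "(\<Oplus>x\<in>UNIV. f (x :: gen3)) = f Gx \<oplus> (f Gy \<oplus> f Gz)"
  using assms by (simp add: UNIV_gen3)

lemma sum_single:
  assumes "\<And>x. f x \<in> carrier R" "\<And>x. x \<noteq> z \<Longrightarrow> f x = \<zero>"
  shows "(\<Oplus>x\<in>UNIV. f (x :: gen3)) = f z"
  using assms(1) by (cases z) (simp_all add: sum_gen3 assms(2))

lemma free_gen_conv:
  "(free_gen R x \<star> free_gen R y) w = (if w = [x, y] then \<one> else \<zero>)"
proof (cases w)
  case Nil
  then show ?thesis by (simp add: conv_Nil free_gen_def)
next
  case (Cons z u)
  have "(\<lambda>u. free_gen R x (z # u)) = (if z = x then (\<lambda>u. if u = [] then \<one> else \<zero>) else (\<lambda>u. \<zero>))"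
    by (auto simp: free_gen_def)
  then show ?thesis
    using Cons by (auto simp: conv_Cons free_gen_def conv_one_left conv_zero_left)
qed

lemma sklyanin_relations_eq:
  assumes "a \<in> carrier R" "b \<in> carrier R" "c \<in> carrier R"
  shows "sklyanin_relations R (a, b, c) = range (relation R (coeff (a, b, c)))"
proof -
  have rel: "a' \<odot>\<^bsub>free\<^esub> (free_gen R x \<otimes>\<^bsub>free\<^esub> free_gen R y) \<oplus>\<^bsub>free\<^esub> b' \<odot>\<^bsub>free\<^esub> (free_gen R y \<otimes>\<^bsub>free\<^esub> free_gen R x)
      \<oplus>\<^bsub>free\<^esub> c' \<odot>\<^bsub>free\<^esub> (free_gen R z \<otimes>\<^bsub>free\<^esub> free_gen R z)
    = (\<lambda>w. a' \<otimes> (if w = [x, y] then \<one> else \<zero>) \<oplus> b' \<otimes> (if w = [y, x] then \<one> else \<zero>)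
        \<oplus> c' \<otimes> (if w = [z, z] then \<one> else \<zero>))" for a' b' c' and x y z :: gen3
    by (simp add: free_simps free_gen_conv fun_eq_iff)
  have "(\<lambda>w. a \<otimes> (if w = [gen (num j + 1), gen (num j + 2)] then \<one> else \<zero>)
       \<oplus> b \<otimes> (if w = [gen (num j + 2), gen (num j + 1)] then \<one> else \<zero>)
       \<oplus> c \<otimes> (if w = [j, j] then \<one> else \<zero>)) = relation R (coeff (a, b, c)) j" for j
  proof
    fix w
    show "a \<otimes> (if w = [gen (num j + 1), gen (num j + 2)] then \<one> else \<zero>)
       \<oplus> b \<otimes> (if w = [gen (num j + 2), gen (num j + 1)] then \<one> else \<zero>)
       \<oplus> c \<otimes> (if w = [j, j] then \<one> else \<zero>) = relation R (coeff (a, b, c)) j w"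
    proof (cases "length w = 2")
      case True
      then obtain x y where "w = [x, y]" by (rule length_2_cases)
      then show ?thesis
        using assms by (cases j; cases x; cases y) (simp_all add: relation_def coeff_def gen_def)
    next
      case False
      then have "w \<noteq> [x, y]" for x y by auto
      then show ?thesis using assms False by (simp add: relation_def)
    qed
  qed
  note this[of Gx] this[of Gy] this[of Gz]
  then show ?thesis
    by (simp add: sklyanin_relations_def Let_def rel UNIV_gen3 gen_def)
qed

lemma sklyanin_eq:
  assumes "a \<in> carrier R" "b \<in> carrier R" "c \<in> carrier R"
  shows "sklyanin R (a, b, c) = quot_alg free (relation_ideal R (coeff (a, b, c)))"
  using assms by (simp add: sklyanin_def sklyanin_relations_eq relation_ideal_def)

lemma relation_homog:
  assumes "\<And>d. \<kappa> d \<in> carrier R" shows "relation R \<kappa> j \<in> homog free 2"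
proof -
  have "finite {w :: gen3 list. length w = 2}"
    using finite_lists_length_eq[of "UNIV :: gen3 set" 2] by simp
  then have "finite {w. relation R \<kappa> j w \<noteq> \<zero>}"
    by (rule finite_subset[rotated]) (auto simp: relation_def)
  then show ?thesis using assms by (auto simp: free_simps relation_def)
qed

lemma relation_ideal_memI:
  assumes \<kappa>: "\<And>d. \<kappa> d \<in> carrier R" and c: "\<And>l. c l \<in> carrier R"
  shows "(\<lambda>w. \<Oplus>l\<in>UNIV. c l \<otimes> relation R \<kappa> l w) \<in> relation_ideal R \<kappa>"
proof -
  interpret F: graded_algebra R "free :: ('a, gen3 list \<Rightarrow> 'a) graded_alg" by (rule free_graded_algebra)
  have S: "range (relation R \<kappa>) \<subseteq> carrier free"
    using relation_homog[OF \<kappa>] by (auto simp: free_simps(7))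
  interpret I: ideal "relation_ideal R \<kappa>" free
    unfolding relation_ideal_def by (rule F.B.genideal_ideal[OF S])
  have "relation R \<kappa> l \<in> relation_ideal R \<kappa>" for l
    unfolding relation_ideal_def using F.B.genideal_self[OF S] by blast
  then have mem: "c l \<odot>\<^bsub>free\<^esub> relation R \<kappa> l \<in> relation_ideal R \<kappa>" for l
    using F.ideal_smult[OF I.ideal_axioms c] by blast
  have "(\<lambda>w. \<Oplus>l\<in>UNIV. c l \<otimes> relation R \<kappa> l w) =
      c Gx \<odot>\<^bsub>free\<^esub> relation R \<kappa> Gx \<oplus>\<^bsub>free\<^esub>
      (c Gy \<odot>\<^bsub>free\<^esub> relation R \<kappa> Gy \<oplus>\<^bsub>free\<^esub> c Gz \<odot>\<^bsub>free\<^esub> relation R \<kappa> Gz)"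
    using \<kappa> c by (simp add: free_simps fun_eq_iff sum_gen3 relation_def)
  then show ?thesis using mem I.a_closed by simp
qed

text \<open>
  The word \<open>vw\<close> occurs in exactly one of the relations, the one with index \<open>-v - w\<close>.
\<close>

lemma sum_relation:
  assumes \<kappa>: "\<And>d. \<kappa> d \<in> carrier R" and c: "\<And>l. c l \<in> carrier R"
  shows "(\<Oplus>l\<in>UNIV. c l \<otimes> relation R \<kappa> l [v, w]) = c (gen (- num v - num w)) \<otimes> \<kappa> (num w - num v)"
proof -
  have "relation R \<kappa> l [v, w] = \<zero>" if "l \<noteq> gen (- num v - num w)" for l
  proof -
    have "(num l - (- num v - num w)) mod 3 \<noteq> 0" using that gen_eq_iff by metis
    then show ?thesis by (simp add: relation_def algebra_simps)
  qed
  then have "(\<Oplus>l\<in>UNIV. c l \<otimes> relation R \<kappa> l [v, w])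
      = c (gen (- num v - num w)) \<otimes> relation R \<kappa> (gen (- num v - num w)) [v, w]"
    using \<kappa> c by (intro sum_single) (auto simp: relation_def)
  also have "relation R \<kappa> (gen (- num v - num w)) [v, w] = \<kappa> (num w - num v)"
    by (simp add: relation_def mod_simps)
  finally show ?thesis .
qed

lemma double_sum_relation:
  assumes \<kappa>: "\<And>d. \<kappa> d \<in> carrier R" "periodic \<kappa>" and f: "\<And>x y. f x y \<in> carrier R"
  shows "(\<Oplus>x\<in>UNIV. \<Oplus>y\<in>UNIV. f x y \<otimes> relation R \<kappa> j [x, y])
    = (\<Oplus>d\<in>UNIV. f (gen (num j + num d)) (gen (num j + 2 * num d)) \<otimes> \<kappa> (num d))"
proof -
  have "\<kappa> (- 1) = \<kappa> 2" "\<kappa> (- 2) = \<kappa> 1" by (auto intro!: periodicD[OF \<kappa>(2)])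
  then show ?thesis
    using assms by (cases j) (simp_all add: sum_gen3 relation_def gen_def a_ac)
qed

end

locale gen3_substitution = invertible_substitution K H G
  for K :: "('k, 'r) ring_scheme" (structure) and H G :: "int \<Rightarrow> gen3 \<Rightarrow> gen3 \<Rightarrow> 'k"
begin

lemma sub_relation:
  assumes \<kappa>: "\<And>d. \<kappa> d \<in> carrier K" "periodic \<kappa>"
  shows "sub i (relation K \<kappa> j) [v, w] = (\<Oplus>d\<in>UNIV. H i (gen (num j + num d)) v
    \<otimes> H (i + 1) (gen (num j + 2 * num d)) w \<otimes> \<kappa> (num d))"
proof -
  have "sub i (relation K \<kappa> j) [v, w]
      = (\<Oplus>x\<in>UNIV. \<Oplus>y\<in>UNIV. H i x v \<otimes> H (i + 1) y w \<otimes> relation K \<kappa> j [x, y])"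
    using \<kappa>(1) by (simp add: finsum_rdistr H_closed relation_def m_assoc)
  then show ?thesis using double_sum_relation[OF \<kappa>, of "\<lambda>x y. H i x v \<otimes> H (i + 1) y w" j] H_closed by simp
qed

text \<open>
  The image is the linear combination of the relations of \<open>\<kappa>'\<close> with coefficients \<open>c\<close>. Both are
  homogeneous of degree 2, so it suffices to compare them on the words \<open>vw\<close>, where only one relation
  contributes.
\<close>

lemma sub_relation_mem:
  assumes \<kappa>: "\<And>d. \<kappa> d \<in> carrier K" "periodic \<kappa>" and \<kappa>': "\<And>d. \<kappa>' d \<in> carrier K"
    and c: "\<And>l. c l \<in> carrier K"
    and eq: "\<And>v w. (\<Oplus>d\<in>UNIV. H i (gen (num j + num d)) v
      \<otimes> H (i + 1) (gen (num j + 2 * num d)) w \<otimes> \<kappa> (num d))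
      = c (gen (- num v - num w)) \<otimes> \<kappa>' (num w - num v)"
  shows "sub i (relation K \<kappa> j) \<in> relation_ideal K \<kappa>'"
proof -
  have "sub i (relation K \<kappa> j) u = (\<Oplus>l\<in>UNIV. c l \<otimes> relation K \<kappa>' l u)" for u
  proof (cases "length u = 2")
    case True
    then obtain v w where "u = [v, w]" by (rule length_2_cases)
    then show ?thesis using sub_relation[OF \<kappa>, of i j v w] eq sum_relation[OF \<kappa>' c] by simp
  next
    case False
    then have "sub i (relation K \<kappa> j) u = \<zero>" by (intro sub_zero) (simp add: relation_def)
    moreover have "(\<Oplus>l\<in>UNIV. c l \<otimes> relation K \<kappa>' l u) = \<zero>"
      using False c by (simp add: relation_def)
    ultimately show ?thesis by simp
  qed
  then have "sub i (relation K \<kappa> j) = (\<lambda>u. \<Oplus>l\<in>UNIV. c l \<otimes> relation K \<kappa>' l u)" by blast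
  then show ?thesis using relation_ideal_memI[OF \<kappa>' c] by simp
qed

lemma twisting_system_relation_ideals:
  assumes "\<And>d. \<kappa> d \<in> carrier K" and "\<And>d. \<kappa>' d \<in> carrier K"
    and "\<And>i j. sub i (relation K \<kappa> j) \<in> relation_ideal K \<kappa>'"
    and "\<And>i j. substitute K G i (relation K \<kappa>' j) \<in> relation_ideal K \<kappa>"
  shows "twisting_system K (quot_alg free (relation_ideal K \<kappa>)) (quot_alg free (relation_ideal K \<kappa>'))
    (\<lambda>i X. sub i ` X)"
  unfolding relation_ideal_def
  using assms relation_homog[of \<kappa>] relation_homog[of \<kappa>']
  by (intro twisting_system_quotient_algebras[where n = 2]) (auto simp: relation_ideal_def)

end

section \<open>Rotations of the generators\<close>

text \<open>
  The matrix of \<open>x\<^sub>u \<mapsto> x\<^sub>u\<^sub>+\<^sub>m\<^sub>i\<close>.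
\<close>

definition rotation :: "('k, 'r) ring_scheme \<Rightarrow> int \<Rightarrow> int \<Rightarrow> gen3 \<Rightarrow> gen3 \<Rightarrow> 'k" where
  "rotation K m i x y = (if (num y - num x - m * i) mod 3 = 0 then \<one>\<^bsub>K\<^esub> else \<zero>\<^bsub>K\<^esub>)"

definition delta :: "('k, 'r) ring_scheme \<Rightarrow> int \<Rightarrow> int \<Rightarrow> 'k" where
  "delta K e d = (if (d - e) mod 3 = 0 then \<one>\<^bsub>K\<^esub> else \<zero>\<^bsub>K\<^esub>)"

lemma periodic_delta: "periodic (delta K e)"
  unfolding periodic_def delta_def by (metis mod_diff_left_eq)

context field
begin

lemma sum_rotation:
  assumes "\<And>x. f x \<in> carrier R"
  shows "(\<Oplus>x\<in>UNIV. rotation R m i x y \<otimes> f x) = f (gen (num y - m * i))"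
proof -
  let ?z = "gen (num y - m * i)"
  have z: "(num y - num x - k) mod 3 = 0 \<longleftrightarrow> gen (num y - k) = x" for x k
    unfolding gen_eq_iff by presburger
  have "(\<Oplus>x\<in>UNIV. rotation R m i x y \<otimes> f x) = rotation R m i ?z y \<otimes> f ?z"
    using assms by (intro sum_single) (auto simp: rotation_def z)
  moreover have "rotation R m i ?z y = \<one>" by (simp only: rotation_def z refl if_True)
  ultimately show ?thesis using assms by simp
qed

lemma rotation_sym: "rotation R m i x y = rotation R (- m) i y x"
proof -
  have "(num y - num x - k) mod 3 = 0 \<longleftrightarrow> (num x - num y + k) mod 3 = 0" for k by presburger
  then show ?thesis by (simp add: rotation_def)
qed

lemma rotation_inverse:
  "(\<Oplus>y\<in>UNIV. rotation R m i x y \<otimes> rotation R (- m) i y z) = (if x = z then \<one> else \<zero>)"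
proof -
  have "(num z - (num x + k) mod 3 + k) mod 3 = 0 \<longleftrightarrow> num z mod 3 = num x mod 3" for k
    by presburger
  then have eq: "(num z - (num x + k) mod 3 + k) mod 3 = 0 \<longleftrightarrow> x = z" for k
    using num_inject[of x z] by auto
  have "(\<Oplus>y\<in>UNIV. rotation R m i x y \<otimes> rotation R (- m) i y z)
      = (\<Oplus>y\<in>UNIV. rotation R (- m) i y x \<otimes> rotation R (- m) i y z)"
    by (simp only: rotation_sym[of m i x])
  also have "\<dots> = rotation R (- m) i (gen (num x - - m * i)) z"
    by (intro sum_rotation) (simp add: rotation_def)
  also have "\<dots> = (if x = z then \<one> else \<zero>)"
    by (simp add: rotation_def eq)
  finally show ?thesis .
qed

lemma gen3_substitution_rotation: "gen3_substitution R (rotation R m) (rotation R (- m))"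
proof (intro gen3_substitution.intro invertible_substitution.intro invertible_substitution_axioms.intro
    field_axioms rotation_inverse)
  show "(\<Oplus>y\<in>UNIV. rotation R (- m) i x y \<otimes> rotation R m i y z) = (if x = z then \<one> else \<zero>)" for i x z
    using rotation_inverse[of "- m" i x z] by simp
qed (simp_all add: rotation_def)

text \<open>
  The word \<open>x\<^sub>j\<^sub>+\<^sub>e x\<^sub>j\<^sub>+\<^sub>2\<^sub>e\<close> is sent to \<open>x\<^sub>j\<^sub>+\<^sub>e\<^sub>+\<^sub>m\<^sub>i x\<^sub>j\<^sub>+\<^sub>2\<^sub>e\<^sub>+\<^sub>m\<^sub>i\<^sub>+\<^sub>m\<close>. Its indices differ by \<open>e + m\<close>, and it is the
  relation of \<open>\<delta>\<^sub>e\<^sub>+\<^sub>m\<close> with index \<open>j + mi - m\<close>.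
\<close>

lemma rotate_relation:
  "substitute R (rotation R m) i (relation R (delta R e) j) \<in> relation_ideal R (delta R (e + m))"
proof -
  interpret gen3_substitution R "rotation R m" "rotation R (- m)" by (rule gen3_substitution_rotation)
  show ?thesis
  proof (rule sub_relation_mem[where c = "\<lambda>l. if (num l - num j - m * i + m) mod 3 = 0 then \<one> else \<zero>"])
    fix v w
    define k where "k = m * i"
    let ?x = "\<lambda>d. gen (num j + d)" and ?y = "\<lambda>d. gen (num j + 2 * d)"
    have "(\<Oplus>d\<in>UNIV. rotation R m i (?x (num d)) v \<otimes> rotation R m (i + 1) (?y (num d)) w \<otimes> delta R e (num d))
        = rotation R m i (?x (num (gen e))) v \<otimes> rotation R m (i + 1) (?y (num (gen e))) w \<otimes> delta R e (num (gen e))"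
    proof (rule sum_single)
      fix d assume "d \<noteq> gen e"
      then have "(num d - e) mod 3 \<noteq> 0" using gen_eq_iff[of e d] by metis
      then show "rotation R m i (?x (num d)) v \<otimes> rotation R m (i + 1) (?y (num d)) w \<otimes> delta R e (num d) = \<zero>"
        by (simp add: delta_def rotation_def)
    qed (simp add: delta_def rotation_def)
    also have "\<dots> = (if (num v - (num j + e mod 3) mod 3 - k) mod 3 = 0
        \<and> (num w - (num j + 2 * (e mod 3)) mod 3 - (k + m)) mod 3 = 0 then \<one> else \<zero>)"
      by (simp add: rotation_def delta_def k_def algebra_simps mod_diff_left_eq)
    also have "(num v - (num j + e mod 3) mod 3 - k) mod 3 = 0
        \<and> (num w - (num j + 2 * (e mod 3)) mod 3 - (k + m)) mod 3 = 0 \<longleftrightarrow>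
        ((- num v - num w) mod 3 - num j - k + m) mod 3 = 0 \<and> (num w - num v - (e + m)) mod 3 = 0"
    proof -
      define p q r where "p = num v - num j - e - k" and "q = num w - num j - 2 * e - (k + m)"
        and "r = num j + e + k"
      note pqr = p_def q_def r_def
      have "num v - (num j + e mod 3) mod 3 - k = p + 3 * (e div 3 + (num j + e mod 3) div 3)"
        "num w - (num j + 2 * (e mod 3)) mod 3 - (k + m)
          = q + 3 * (2 * (e div 3) + (num j + 2 * (e mod 3)) div 3)"
        "(- num v - num w) mod 3 - num j - k + m
          = - (p + q) - 3 * r + 3 * (- ((- num v - num w) div 3))"
        by (simp_all add: pqr minus_mult_div_eq_mod[symmetric] algebra_simps del: minus_mult_div_eq_mod)
      moreover have "num w - num v - (e + m) = q - p" by (simp add: pqr)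
      moreover have "3 dvd p \<and> 3 dvd q \<longleftrightarrow> 3 dvd - (p + q) - 3 * r \<and> 3 dvd q - p" by presburger
      ultimately show ?thesis by (simp only: mod_mult_self2 dvd_eq_mod_eq_0)
    qed
    also have "(if \<dots> then \<one> else \<zero>)
        = (if (num (gen (- num v - num w)) - num j - m * i + m) mod 3 = 0 then \<one> else \<zero>)
          \<otimes> delta R (e + m) (num w - num v)"
      by (simp add: delta_def k_def)
    finally show "(\<Oplus>d\<in>UNIV. rotation R m i (?x (num d)) v \<otimes> rotation R m (i + 1) (?y (num d)) w
        \<otimes> delta R e (num d)) = \<dots>" .
  qed (simp_all add: delta_def periodic_delta)
qed

lemma twisting_system_rotation:
  "twisting_system R (quot_alg free (relation_ideal R (delta R e)))
    (quot_alg free (relation_ideal R (delta R (e + m))))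
    (\<lambda>i X. substitute R (rotation R m) i ` X)"
proof -
  interpret gen3_substitution R "rotation R m" "rotation R (- m)" by (rule gen3_substitution_rotation)
  show ?thesis
    using rotate_relation[of m _ e] rotate_relation[of "- m" _ "e + m"]
    by (intro twisting_system_relation_ideals) (simp_all add: delta_def)
qed

text \<open>
  Passing from \<open>i\<close> to \<open>i + 1\<close> applies one further rotation by \<open>m\<close> to all letters alike, which is
  composition with the inverse rotation on coefficient functions. This is the automorphism of the
  Zhang twist.
\<close>

lemma substitute_rotation_Suc:
  assumes "coeffs p"
  shows "substitute R (rotation R m) (i + 1) p w
    = substitute R (rotation R m) i p (map (\<lambda>y. gen (num y - m)) w)"
  using assms
proof (induction w arbitrary: i p)
  case (Cons y w)
  interpret gen3_substitution R "rotation R m" "rotation R (- m)" by (rule gen3_substitution_rotation)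
  have step: "sub i q (y # w) = sub (i + 1) (\<lambda>u. q (gen (num y - m * i) # u)) w"
    if "coeffs q" for i q y w
    using that by (simp add: sum_rotation sub_closed)
  have "gen ((num y - m) mod 3 - m * i) = gen (num y - m * (i + 1))"
    by (simp add: gen_def algebra_simps mod_diff_left_eq)
  moreover have "sub (i + 1 + 1) (\<lambda>u. p (gen (num y - m * (i + 1)) # u)) w
      = sub (i + 1) (\<lambda>u. p (gen (num y - m * (i + 1)) # u)) (map (\<lambda>y. gen (num y - m)) w)"
    using Cons.prems by (intro Cons.IH) simp
  ultimately show ?case
    using step[OF Cons.prems, of "i + 1" y w]
      step[OF Cons.prems, of i "gen (num y - m)" "map (\<lambda>y. gen (num y - m)) w"]
    by (simp only: list.map num_gen)
qed simp

end


section \<open>Fourier substitutions\<close>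

locale cube_root_of_unity = field K for K :: "('k, 'r) ring_scheme" (structure) +
  fixes \<omega> :: 'k
  assumes \<omega>_closed [simp]: "\<omega> \<in> carrier K" and \<omega>_cube: "\<omega> \<otimes> \<omega> \<otimes> \<omega> = \<one>" and \<omega>_neq_one: "\<omega> \<noteq> \<one>"
begin

text \<open>
  \<open>W n\<close> is \<open>\<omega>\<close> to the power \<open>n\<close>, for all integers \<open>n\<close>.
\<close>

definition W :: "int \<Rightarrow> 'k" where
  "W n = (if n mod 3 = 0 then \<one> else if n mod 3 = 1 then \<omega> else \<omega> \<otimes> \<omega>)"

lemma W_closed [simp]: "W n \<in> carrier K"
  by (simp add: W_def)

lemma W_eqI: "3 dvd m - n \<Longrightarrow> W m = W n"
  by (simp add: W_def mod_eq_dvd_iff[symmetric])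

lemma W_zero [simp]: "W 0 = \<one>"
  by (simp add: W_def)

lemma W_mult: "W m \<otimes> W n = W (m + n)"
proof -
  have mn: "(m + n) mod 3 = (m mod 3 + n mod 3) mod 3" by (simp add: mod_add_eq)
  have "m mod 3 = 0 \<or> m mod 3 = 1 \<or> m mod 3 = 2" "n mod 3 = 0 \<or> n mod 3 = 1 \<or> n mod 3 = 2"
    by presburger+
  moreover have "\<omega> \<otimes> (\<omega> \<otimes> \<omega>) = \<one>" using \<omega>_cube by (simp add: m_assoc)
  ultimately show ?thesis
    unfolding W_def mn by (elim disjE) (simp_all add: m_assoc)
qed

text \<open>
  Multiplication by \<open>x\<close> permutes the summands, so \<open>x t = t\<close> for the sum \<open>t\<close>.
\<close>

lemma sum_powers_cube_root:
  assumes x: "x \<in> carrier K" "x \<otimes> x \<otimes> x = \<one>" "x \<noteq> \<one>"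
  shows "\<one> \<oplus> x \<oplus> x \<otimes> x = \<zero>"
proof (rule ccontr)
  let ?t = "\<one> \<oplus> x \<oplus> x \<otimes> x"
  assume t: "?t \<noteq> \<zero>"
  have "x \<otimes> ?t = x \<oplus> x \<otimes> x \<oplus> x \<otimes> x \<otimes> x" using x(1) by (simp add: r_distr m_assoc)
  also have "\<dots> = \<one> \<otimes> ?t" using x by (simp add: a_ac)
  finally show False using t x m_rcancel[of ?t x \<one>] by simp
qed

definition three :: 'k where "three = \<one> \<oplus> \<one> \<oplus> \<one>"

lemma three_closed [simp]: "three \<in> carrier K"
  by (simp add: three_def)

text \<open>
  In characteristic 3 the polynomial \<open>1 + t + t\<^sup>2\<close> is \<open>(t - 1)\<^sup>2\<close>, whose only root is 1.
\<close>

lemma three_neq_zero: "three \<noteq> \<zero>"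
proof
  assume "three = \<zero>"
  moreover have "(\<omega> \<ominus> \<one>) \<otimes> (\<omega> \<ominus> \<one>) = (\<one> \<oplus> \<omega> \<oplus> \<omega> \<otimes> \<omega>) \<ominus> (\<one> \<oplus> \<one> \<oplus> \<one>) \<otimes> \<omega>"
    using \<omega>_closed by algebra
  ultimately have "(\<omega> \<ominus> \<one>) \<otimes> (\<omega> \<ominus> \<one>) = \<zero>"
    using sum_powers_cube_root[OF \<omega>_closed \<omega>_cube \<omega>_neq_one] by (simp add: three_def minus_eq)
  then have "\<omega> \<ominus> \<one> = \<zero>" using integral[of "\<omega> \<ominus> \<one>" "\<omega> \<ominus> \<one>"] by simp
  then show False using \<omega>_neq_one by simp
qed

lemma inv_three [simp]: "inv three \<in> carrier K" "inv three \<otimes> three = \<one>"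
  using three_neq_zero field_Units by auto

text \<open>
  Orthogonality of the characters of \<open>\<int>/3\<close>.
\<close>

lemma sum_W:
  "(\<Oplus>x\<in>UNIV. W (n * num x)) = (if n mod 3 = 0 then three else \<zero>)"
proof -
  have t: "\<one> \<oplus> (\<omega> \<oplus> \<omega> \<otimes> \<omega>) = \<zero>" "\<one> \<oplus> (\<omega> \<otimes> \<omega> \<oplus> \<omega>) = \<zero>"
    using sum_powers_cube_root[OF \<omega>_closed \<omega>_cube \<omega>_neq_one] by (simp_all add: a_ac)
  have n2: "(n * 2) mod 3 = (n mod 3 * 2) mod 3" by (simp add: mod_mult_left_eq)
  have "n mod 3 = 0 \<or> n mod 3 = 1 \<or> n mod 3 = 2" by presburger
  then show ?thesis
    using t by (elim disjE) (simp_all add: sum_gen3 W_def n2 three_def a_assoc)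
qed

lemma cube_root_cases:
  assumes x: "x \<in> carrier K" "x \<otimes> x \<otimes> x = \<one>" shows "\<exists>n. x = W n"
proof (cases "x = \<one>")
  case True
  then show ?thesis by (intro exI[of _ 0]) simp
next
  case False
  have "(x \<ominus> \<omega>) \<otimes> (x \<ominus> \<omega> \<otimes> \<omega>) = (\<one> \<oplus> x \<oplus> x \<otimes> x) \<ominus> (\<one> \<oplus> \<omega> \<oplus> \<omega> \<otimes> \<omega>) \<otimes> x \<oplus> (\<omega> \<otimes> \<omega> \<otimes> \<omega> \<ominus> \<one>)"
    using x(1) \<omega>_closed by algebra
  also have "\<dots> = \<zero>"
    using x(1) sum_powers_cube_root[OF x False] sum_powers_cube_root[OF \<omega>_closed \<omega>_cube \<omega>_neq_one]
    by (simp add: \<omega>_cube minus_eq r_neg)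
  finally have "x \<ominus> \<omega> = \<zero> \<or> x \<ominus> \<omega> \<otimes> \<omega> = \<zero>"
    using x(1) integral[of "x \<ominus> \<omega>" "x \<ominus> \<omega> \<otimes> \<omega>"] by simp
  then have "x = \<omega> \<or> x = \<omega> \<otimes> \<omega>" using x(1) by simp
  then have "x = W 1 \<or> x = W 2" by (simp add: W_def)
  then show ?thesis by blast
qed

text \<open>
  With \<open>e\<close> and \<open>g\<close> modulo 3, these are all nine functions from \<open>\<int>/3\<close> to the cube roots of unity that
  take the value 1 at 0.
\<close>

definition gauss :: "int \<Rightarrow> int \<Rightarrow> int \<Rightarrow> 'k" where
  "gauss g e d = W (2 * e * d + 2 * g * d * d)"

lemma periodic_gauss: "periodic (gauss g e)"
  unfolding periodic_def gauss_def
proof (intro allI impI W_eqI)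
  fix m n :: int assume "m mod 3 = n mod 3"
  then have "3 dvd m - n" by (simp add: mod_eq_dvd_iff)
  then obtain k where m: "m = n + 3 * k" unfolding dvd_def by (metis diff_add_cancel add.commute)
  show "3 dvd 2 * e * m + 2 * g * m * m - (2 * e * n + 2 * g * n * n)"
    by (rule dvdI[of _ _ "2 * e * k + 4 * g * n * k + 6 * g * k * k"]) (simp add: m algebra_simps)
qed

text \<open>
  The character table of \<open>\<int>/3\<close> with its columns rescaled, so that the inverse comes from the
  orthogonality of characters.
\<close>

definition fourier :: "int \<Rightarrow> int \<Rightarrow> gen3 \<Rightarrow> gen3 \<Rightarrow> 'k" where
  "fourier g i x y = W (num x * num y + g * num y * num y)"

definition fourier_inv :: "int \<Rightarrow> int \<Rightarrow> gen3 \<Rightarrow> gen3 \<Rightarrow> 'k" where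
  "fourier_inv g i y x = inv three \<otimes> W (- num x * num y - g * num y * num y)"

lemma num_diff_mod: "(num x - num y) mod 3 = 0 \<longleftrightarrow> x = y"
  by (cases x; cases y) simp_all

lemma gen3_substitution_fourier: "gen3_substitution K (fourier g) (fourier_inv g)"
proof (intro gen3_substitution.intro invertible_substitution.intro invertible_substitution_axioms.intro
    field_axioms)
  fix i x z
  have "(\<Oplus>y\<in>UNIV. fourier g i x y \<otimes> fourier_inv g i y z)
      = (\<Oplus>y\<in>UNIV. inv three \<otimes> W ((num x - num z) * num y))"
    by (simp add: fourier_def fourier_inv_def m_lcomm W_mult algebra_simps)
  also have "\<dots> = inv three \<otimes> (\<Oplus>y\<in>UNIV. W ((num x - num z) * num y))"
    by (simp add: finsum_rdistr)
  finally show "(\<Oplus>y\<in>UNIV. fourier g i x y \<otimes> fourier_inv g i y z) = (if x = z then \<one> else \<zero>)"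
    by (simp add: sum_W num_diff_mod)
  have "(\<Oplus>y\<in>UNIV. fourier_inv g i x y \<otimes> fourier g i y z)
      = (\<Oplus>y\<in>UNIV. inv three \<otimes> W (g * num z * num z - g * num x * num x) \<otimes> W ((num z - num x) * num y))"
    by (simp add: fourier_def fourier_inv_def m_assoc W_mult algebra_simps)
  also have "\<dots> = inv three \<otimes> W (g * num z * num z - g * num x * num x) \<otimes> (\<Oplus>y\<in>UNIV. W ((num z - num x) * num y))"
    by (simp add: finsum_rdistr)
  finally show "(\<Oplus>y\<in>UNIV. fourier_inv g i x y \<otimes> fourier g i y z) = (if x = z then \<one> else \<zero>)"
    by (auto simp: sum_W num_diff_mod)
qed (simp_all add: fourier_def fourier_inv_def)

lemma num_gen_div: "num (gen n) = n - 3 * (n div 3)"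
  by (simp add: minus_mult_div_eq_mod)

text \<open>
  The relation \<open>x\<^sub>j\<^sub>+\<^sub>e x\<^sub>j\<^sub>+\<^sub>2\<^sub>e\<close> is sent to the sum over all \<open>v, w\<close> of \<open>x\<^sub>v x\<^sub>w\<close> times \<open>\<omega>\<close> to the
  exponent \<open>(j + e)v + gv\<^sup>2 + (j + 2e)w + gw\<^sup>2\<close>. In terms of \<open>l = -v - w\<close> and \<open>d = w - v\<close>, and modulo 3, this
  is \<open>2jl + 2gl\<^sup>2 + 2ed + 2gd\<^sup>2\<close>: a coefficient that depends on the index \<open>l\<close> of the relation, plus
  the exponent of \<open>gauss g e d\<close>.
\<close>

lemma fourier_relation:
  "substitute K (fourier g) i (relation K (delta K e) j) \<in> relation_ideal K (gauss g e)"
proof -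
  interpret gen3_substitution K "fourier g" "fourier_inv g" by (rule gen3_substitution_fourier)
  show ?thesis
  proof (rule sub_relation_mem[where c = "\<lambda>l. W (2 * num j * num l + 2 * g * num l * num l)"])
    fix v w
    let ?x = "\<lambda>d. gen (num j + num d)" and ?y = "\<lambda>d. gen (num j + 2 * num d)"
    have "(\<Oplus>d\<in>UNIV. fourier g i (?x d) v \<otimes> fourier g (i + 1) (?y d) w \<otimes> delta K e (num d))
        = fourier g i (?x (gen e)) v \<otimes> fourier g (i + 1) (?y (gen e)) w \<otimes> delta K e (num (gen e))"
    proof (rule sum_single)
      fix d assume "d \<noteq> gen e"
      then have "(num d - e) mod 3 \<noteq> 0" using gen_eq_iff[of e d] by metis
      then show "fourier g i (?x d) v \<otimes> fourier g (i + 1) (?y d) w \<otimes> delta K e (num d) = \<zero>"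
        by (simp add: delta_def fourier_def)
    qed (simp add: delta_def fourier_def)
    also have "\<dots> = W ((num (gen (num j + e)) * num v + g * num v * num v)
        + (num (gen (num j + 2 * e)) * num w + g * num w * num w))"
    proof -
      have "(num j + e mod 3) mod 3 = (num j + e) mod 3"
        "(num j + 2 * (e mod 3)) mod 3 = (num j + 2 * e) mod 3" by presburger+
      then show ?thesis by (simp add: fourier_def delta_def W_mult mod_diff_left_eq)
    qed
    also have "\<dots> = W ((2 * num j * num (gen (- num v - num w))
          + 2 * g * num (gen (- num v - num w)) * num (gen (- num v - num w)))
        + (2 * e * (num w - num v) + 2 * g * (num w - num v) * (num w - num v)))"
    proof (rule W_eqI)
      \<comment> \<open>The witness is a third of the difference, once each index is written as \<open>n - 3 (n div 3)\<close>.\<close>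
      let ?X = "(num j + e) div 3" and ?Y = "(num j + 2 * e) div 3" and ?L = "(- num v - num w) div 3"
      show "3 dvd (num (gen (num j + e)) * num v + g * num v * num v)
        + (num (gen (num j + 2 * e)) * num w + g * num w * num w)
        - ((2 * num j * num (gen (- num v - num w))
          + 2 * g * num (gen (- num v - num w)) * num (gen (- num v - num w)))
        + (2 * e * (num w - num v) + 2 * g * (num w - num v) * (num w - num v)))"
        unfolding num_gen_div
        by (rule dvdI[of _ _ "num j * num v + num j * num w + e * num v - ?X * num v - ?Y * num w
          + 2 * num j * ?L - 4 * g * (num v + num w) * ?L - 6 * g * ?L * ?L
          - g * num v * num v - g * num w * num w"]) (simp add: algebra_simps)
    qed
    finally show "(\<Oplus>d\<in>UNIV. fourier g i (?x d) v \<otimes> fourier g (i + 1) (?y d) w \<otimes> delta K e (num d))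
        = W (2 * num j * num (gen (- num v - num w))
          + 2 * g * num (gen (- num v - num w)) * num (gen (- num v - num w))) \<otimes> gauss g e (num w - num v)"
      by (simp only: gauss_def W_mult)
  qed (simp_all add: delta_def periodic_delta gauss_def)
qed

text \<open>
  The coefficient of \<open>x\<^sub>v x\<^sub>w\<close> in the image of \<open>f\<^sub>j\<close> is a sum over \<open>d\<close> in which the quadratic terms in \<open>d\<close>
  cancel modulo 3. What remains is a character of \<open>d\<close>, whose sum vanishes unless \<open>w - v = e\<close>.
\<close>

lemma fourier_inv_relation:
  "substitute K (fourier_inv g) i (relation K (gauss g e) j) \<in> relation_ideal K (delta K e)"
proof -
  interpret gen3_substitution K "fourier g" "fourier_inv g" by (rule gen3_substitution_fourier)
  interpret rev: gen3_substitution K "fourier_inv g" "fourier g"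
    by (intro gen3_substitution.intro reverse)
  show ?thesis
  proof (rule rev.sub_relation_mem[where c = "\<lambda>l. inv three \<otimes> W (num j * num l - 2 * g * num j * num j)"])
    fix v w
    let ?x = "\<lambda>d. gen (num j + num d)" and ?y = "\<lambda>d. gen (num j + 2 * num d)"
    let ?s = "num j * num (gen (- num v - num w)) - 2 * g * num j * num j"
    have "fourier_inv g i (?x d) v \<otimes> fourier_inv g (i + 1) (?y d) w \<otimes> gauss g e (num d)
        = inv three \<otimes> inv three \<otimes> W ?s \<otimes> W ((2 * e - num v - 2 * num w) * num d)" for d
    proof -
      have "fourier_inv g i (?x d) v \<otimes> fourier_inv g (i + 1) (?y d) w \<otimes> gauss g e (num d)
          = inv three \<otimes> inv three \<otimes> W ((- num v * num (?x d) - g * num (?x d) * num (?x d))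
            + (- num w * num (?y d) - g * num (?y d) * num (?y d)) + (2 * e * num d + 2 * g * num d * num d))"
        by (simp add: fourier_inv_def gauss_def W_mult[symmetric] m_ac)
      also have "W ((- num v * num (?x d) - g * num (?x d) * num (?x d))
            + (- num w * num (?y d) - g * num (?y d) * num (?y d)) + (2 * e * num d + 2 * g * num d * num d))
          = W (?s + (2 * e - num v - 2 * num w) * num d)"
      proof (rule W_eqI)
        \<comment> \<open>As for the Fourier substitution, the witness is a third of the difference.\<close>
        let ?X = "(num j + num d) div 3" and ?Y = "(num j + 2 * num d) div 3" and ?L = "(- num v - num w) div 3"
        show "3 dvd (- num v * num (?x d) - g * num (?x d) * num (?x d))
            + (- num w * num (?y d) - g * num (?y d) * num (?y d)) + (2 * e * num d + 2 * g * num d * num d)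
            - (?s + (2 * e - num v - 2 * num w) * num d)"
          unfolding num_gen_div
          by (rule dvdI[of _ _ "num v * ?X + 2 * g * ?X * (num j + num d) - 3 * g * ?X * ?X
            + num w * ?Y + 2 * g * ?Y * (num j + 2 * num d) - 3 * g * ?Y * ?Y
            + num j * ?L - 2 * g * num j * num d - g * num d * num d"]) (simp add: algebra_simps)
      qed
      finally show ?thesis by (simp add: W_mult[symmetric] m_assoc)
    qed
    then have "(\<Oplus>d\<in>UNIV. fourier_inv g i (?x d) v \<otimes> fourier_inv g (i + 1) (?y d) w \<otimes> gauss g e (num d))
        = inv three \<otimes> inv three \<otimes> W ?s \<otimes> (\<Oplus>d\<in>UNIV. W ((2 * e - num v - 2 * num w) * num d))"
      by (simp add: finsum_rdistr)
    also have "\<dots> = inv three \<otimes> W ?s \<otimes> delta K e (num w - num v)"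
    proof -
      have "(2 * e - num v - 2 * num w) mod 3 = 0 \<longleftrightarrow> (num w - num v - e) mod 3 = 0" by presburger
      moreover have "inv three \<otimes> inv three \<otimes> W ?s \<otimes> three = inv three \<otimes> three \<otimes> (inv three \<otimes> W ?s)"
        using inv_three(1) three_closed W_closed by (simp only: m_ac m_closed)
      ultimately show ?thesis by (simp add: sum_W delta_def)
    qed
    finally show "(\<Oplus>d\<in>UNIV. fourier_inv g i (?x d) v \<otimes> fourier_inv g (i + 1) (?y d) w \<otimes> gauss g e (num d))
        = inv three \<otimes> W ?s \<otimes> delta K e (num w - num v)" .
  qed (simp_all add: delta_def periodic_gauss gauss_def)
qed

lemma twisting_system_fourier:
  "twisting_system K (quot_alg free (relation_ideal K (delta K e)))
    (quot_alg free (relation_ideal K (gauss g e))) (\<lambda>i X. substitute K (fourier g) i ` X)"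
proof -
  interpret gen3_substitution K "fourier g" "fourier_inv g" by (rule gen3_substitution_fourier)
  show ?thesis
    using fourier_relation fourier_inv_relation
    by (intro twisting_system_relation_ideals) (simp_all add: delta_def gauss_def)
qed

lemma substitute_fourier_const: "substitute K (fourier g) i p w = substitute K (fourier g) j p w"
proof (induction w arbitrary: i j p)
  case (Cons y w)
  have "fourier g i = fourier g j" by (simp add: fun_eq_iff fourier_def)
  then show ?case by (simp only: substitute.simps Cons.IH[of "i + 1" _ "j + 1"])
qed simp

end

section \<open>Degenerate points\<close>

context field
begin

lemma relation_ideal_scale:
  assumes s: "s \<in> carrier R" "s \<noteq> \<zero>" and \<kappa>: "\<And>d. \<kappa> d \<in> carrier R"
  shows "relation_ideal R (\<lambda>d. s \<otimes> \<kappa> d) = relation_ideal R \<kappa>"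
proof -
  have sub: "relation_ideal R (\<lambda>d. t \<otimes> \<mu> d) \<subseteq> relation_ideal R \<mu>"
    if t: "t \<in> carrier R" and \<mu>: "\<And>d. \<mu> d \<in> carrier R" for t \<mu>
  proof -
    interpret F: graded_algebra R "free :: ('a, gen3 list \<Rightarrow> 'a) graded_alg" by (rule free_graded_algebra)
    have S: "range (relation R \<mu>) \<subseteq> carrier free"
      using relation_homog[OF \<mu>] by (auto simp: free_simps(7))
    interpret I: ideal "relation_ideal R \<mu>" free
      unfolding relation_ideal_def by (rule F.B.genideal_ideal[OF S])
    have "relation R (\<lambda>d. t \<otimes> \<mu> d) l \<in> relation_ideal R \<mu>" for l
    proof -
      have "relation R \<mu> l \<in> relation_ideal R \<mu>"
        unfolding relation_ideal_def using F.B.genideal_self[OF S] by blast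
      then have "t \<odot>\<^bsub>free\<^esub> relation R \<mu> l \<in> relation_ideal R \<mu>"
        by (rule F.ideal_smult[OF I.ideal_axioms t])
      moreover have "t \<odot>\<^bsub>free\<^esub> relation R \<mu> l = relation R (\<lambda>d. t \<otimes> \<mu> d) l"
        using t by (simp add: free_simps relation_def fun_eq_iff)
      ultimately show ?thesis by simp
    qed
    then show ?thesis
      unfolding relation_ideal_def[of _ "\<lambda>d. t \<otimes> \<mu> d"]
      by (intro F.B.genideal_minimal I.ideal_axioms) blast
  qed
  have inv: "inv s \<in> carrier R" "inv s \<otimes> s = \<one>" using s field_Units by auto
  have "(\<lambda>d. inv s \<otimes> (s \<otimes> \<kappa> d)) = \<kappa>"
    using s \<kappa> inv by (simp add: fun_eq_iff m_assoc[symmetric])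
  then show ?thesis
    using sub[OF s(1), of \<kappa>] sub[OF inv(1), of "\<lambda>d. s \<otimes> \<kappa> d"] s \<kappa> by simp
qed

end

context cube_root_of_unity
begin

text \<open>
  If \<open>a = c \<omega>\<^sup>m\<close> and \<open>b = c \<omega>\<^sup>n\<close>, then \<open>g\<close> and \<open>e\<close> must solve \<open>2e + 2g = m\<close> and \<open>4e + 8g = n\<close> modulo 3, which
  gives \<open>g = m + n\<close> and \<open>e = m - n\<close>.
\<close>

lemma coeff_gauss:
  assumes abc: "a \<in> carrier K" "b \<in> carrier K" "c \<in> carrier K" "(a, b, c) \<noteq> (\<zero>, \<zero>, \<zero>)"
    and ab: "a \<otimes> a \<otimes> a = b \<otimes> b \<otimes> b" and bc: "b \<otimes> b \<otimes> b = c \<otimes> c \<otimes> c"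
  shows "c \<noteq> \<zero> \<and> (\<exists>g e. coeff (a, b, c) = (\<lambda>d. c \<otimes> gauss g e d))"
proof -
  have c: "c \<noteq> \<zero>"
  proof
    assume "c = \<zero>"
    then have "a \<otimes> a \<otimes> a = \<zero>" "b \<otimes> b \<otimes> b = \<zero>" using ab bc by simp_all
    then have "a = \<zero>" "b = \<zero>" using abc integral_iff by simp_all
    then show False using \<open>c = \<zero>\<close> abc(4) by simp
  qed
  then have inv: "inv c \<in> carrier K" "c \<otimes> inv c = \<one>" using abc(3) field_Units by auto
  have log: "\<exists>n. x = c \<otimes> W n" if x: "x \<in> carrier K" "x \<otimes> x \<otimes> x = c \<otimes> c \<otimes> c" for x
  proof -
    have "(x \<otimes> inv c) \<otimes> (x \<otimes> inv c) \<otimes> (x \<otimes> inv c) = (x \<otimes> x \<otimes> x) \<otimes> (inv c \<otimes> inv c \<otimes> inv c)"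
      using x(1) inv(1) by (simp add: m_ac)
    also have "\<dots> = (c \<otimes> inv c) \<otimes> (c \<otimes> inv c) \<otimes> (c \<otimes> inv c)"
      unfolding x(2) using abc(3) inv(1) by (simp add: m_ac)
    finally obtain n where "x \<otimes> inv c = W n"
      using cube_root_cases[of "x \<otimes> inv c"] x(1) inv by auto
    moreover have "c \<otimes> (x \<otimes> inv c) = x" using x(1) abc(3) inv m_lcomm[of c x "inv c"] by simp
    ultimately show ?thesis by metis
  qed
  obtain m n where m: "a = c \<otimes> W m" and n: "b = c \<otimes> W n"
    using log[of a] log[of b] abc ab bc by auto
  let ?g = "m + n" and ?e = "m - n"
  have "W m = gauss ?g ?e 1" "W n = gauss ?g ?e 2" "\<one> = gauss ?g ?e 0"
    unfolding gauss_def
    by (auto intro!: W_eqI)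
  moreover have "coeff (a, b, c) d = coeff (a, b, c) (d mod 3)" "gauss ?g ?e d = gauss ?g ?e (d mod 3)" for d
    using periodicD[OF periodic_gauss, of d "d mod 3"] by (simp_all add: coeff_def)
  moreover have "d mod 3 = 0 \<or> d mod 3 = 1 \<or> d mod 3 = 2" for d :: int by presburger
  ultimately have "coeff (a, b, c) d = c \<otimes> gauss ?g ?e d" for d
    using m n abc(3) by (smt (verit) coeff_def case_prod_conv mod_mod_trivial r_one)
  then show ?thesis using c by blast
qed

text \<open>
  Equal points have proportional coordinates. A nonzero triple whose entries have equal cubes has
  no zero entry, and the quotients of its entries are cube roots of unity.
\<close>

lemma degenerate_cases:
  assumes "proj_point K (a, b, c) \<in> degenerate_points K"
  obtains s e where "s \<in> carrier K" "s \<noteq> \<zero>" "coeff (a, b, c) = (\<lambda>d. s \<otimes> delta K e d)"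
  | s g e where "s \<in> carrier K" "s \<noteq> \<zero>" "coeff (a, b, c) = (\<lambda>d. s \<otimes> gauss g e d)"
proof -
  have scaled: "\<exists>s \<in> carrier K - {\<zero>}. a \<in> carrier K \<and> b \<in> carrier K \<and> c \<in> carrier K
      \<and> a' = s \<otimes> a \<and> b' = s \<otimes> b \<and> c' = s \<otimes> c"
    if eq: "proj_point K (a, b, c) = proj_point K (a', b', c')" and t': "(a', b', c') \<in> homog_coords K" for a' b' c'
  proof -
    have "(a', b', c') \<in> proj_point K (a', b', c')"
      using t' by (auto simp: proj_point_def proj_rel_def homog_coords_def intro!: bexI[of _ \<one>])
    then have "(a', b', c') \<in> proj_point K (a, b, c)" using eq by simp
    then show ?thesis by (auto simp: proj_point_def proj_rel_def homog_coords_def)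
  qed
  have null: "x = \<zero>" if "s \<in> carrier K - {\<zero>}" "x \<in> carrier K" "\<zero> = s \<otimes> x" for s x
    using that integral_iff[of s x] by auto
  have nonnull: "x \<noteq> \<zero>" if "s \<in> carrier K - {\<zero>}" "\<one> = s \<otimes> x" for s x
    using that by auto
  from assms consider
      "proj_point K (a, b, c) = proj_point K (\<one>, \<zero>, \<zero>)"
    | "proj_point K (a, b, c) = proj_point K (\<zero>, \<one>, \<zero>)"
    | "proj_point K (a, b, c) = proj_point K (\<zero>, \<zero>, \<one>)"
    | a' b' c' where "proj_point K (a, b, c) = proj_point K (a', b', c')" "(a', b', c') \<in> homog_coords K"
      "a' [^] (3::nat) = b' [^] (3::nat)" "b' [^] (3::nat) = c' [^] (3::nat)"
    unfolding degenerate_points_def by auto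
  then show thesis
  proof cases
    case 1
    have h: "(\<one>, \<zero>, \<zero>) \<in> homog_coords K" by (simp add: homog_coords_def)
    obtain s where s: "s \<in> carrier K - {\<zero>}" "a \<in> carrier K \<and> b \<in> carrier K \<and> c \<in> carrier K
        \<and> \<one> = s \<otimes> a \<and> \<zero> = s \<otimes> b \<and> \<zero> = s \<otimes> c"
      using scaled[OF 1 h] by blast
    then have z: "b = \<zero>" "c = \<zero>" "a \<noteq> \<zero>" using null[OF s(1)] nonnull[OF s(1)] by metis+
    have cl: "a \<in> carrier K" "b \<in> carrier K" "c \<in> carrier K" using s(2) by simp_all
    have "coeff (a, b, c) = (\<lambda>d. a \<otimes> delta K 1 d)"
    proof
      fix d :: int
      have "(d - 1) mod 3 = 0 \<longleftrightarrow> d mod 3 = 1" by presburger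
      then show "coeff (a, b, c) d = a \<otimes> delta K 1 d" using z(1,2) cl by (simp add: coeff_def delta_def)
    qed
    then show thesis using that(1) cl z by blast
  next
    case 2
    have h: "(\<zero>, \<one>, \<zero>) \<in> homog_coords K" by (simp add: homog_coords_def)
    obtain s where s: "s \<in> carrier K - {\<zero>}" "a \<in> carrier K \<and> b \<in> carrier K \<and> c \<in> carrier K
        \<and> \<zero> = s \<otimes> a \<and> \<one> = s \<otimes> b \<and> \<zero> = s \<otimes> c"
      using scaled[OF 2 h] by blast
    then have z: "a = \<zero>" "c = \<zero>" "b \<noteq> \<zero>" using null[OF s(1)] nonnull[OF s(1)] by metis+
    have cl: "a \<in> carrier K" "b \<in> carrier K" "c \<in> carrier K" using s(2) by simp_all
    have "coeff (a, b, c) = (\<lambda>d. b \<otimes> delta K 2 d)"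
    proof
      fix d :: int
      have "(d - 2) mod 3 = 0 \<longleftrightarrow> d mod 3 \<noteq> 0 \<and> d mod 3 \<noteq> 1" by presburger
      then show "coeff (a, b, c) d = b \<otimes> delta K 2 d" using z(1,2) cl by (simp add: coeff_def delta_def)
    qed
    then show thesis using that(1) cl z by blast
  next
    case 3
    have h: "(\<zero>, \<zero>, \<one>) \<in> homog_coords K" by (simp add: homog_coords_def)
    obtain s where s: "s \<in> carrier K - {\<zero>}" "a \<in> carrier K \<and> b \<in> carrier K \<and> c \<in> carrier K
        \<and> \<zero> = s \<otimes> a \<and> \<zero> = s \<otimes> b \<and> \<one> = s \<otimes> c"
      using scaled[OF 3 h] by blast
    then have z: "a = \<zero>" "b = \<zero>" "c \<noteq> \<zero>" using null[OF s(1)] nonnull[OF s(1)] by metis+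
    have cl: "a \<in> carrier K" "b \<in> carrier K" "c \<in> carrier K" using s(2) by simp_all
    have "coeff (a, b, c) = (\<lambda>d. c \<otimes> delta K 0 d)"
      using z(1,2) cl by (simp add: fun_eq_iff coeff_def delta_def)
    then show thesis using that(1) cl z by blast
  next
    case (4 a' b' c')
    from scaled[OF 4(1,2)] obtain s where s: "s \<in> carrier K" "s \<noteq> \<zero>" and
      abc: "a \<in> carrier K" "b \<in> carrier K" "c \<in> carrier K" and
      t': "a' = s \<otimes> a" "b' = s \<otimes> b" "c' = s \<otimes> c"
      by auto
    have cube: "x \<otimes> x \<otimes> x = y \<otimes> y \<otimes> y"
      if "x \<in> carrier K" "y \<in> carrier K" "(s \<otimes> x) [^] (3::nat) = (s \<otimes> y) [^] (3::nat)" for x y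
    proof -
      have "(s \<otimes> s \<otimes> s) \<otimes> (x \<otimes> x \<otimes> x) = (s \<otimes> s \<otimes> s) \<otimes> (y \<otimes> y \<otimes> y)"
        using that s by (simp add: numeral_3_eq_3 m_ac)
      moreover have "s \<otimes> s \<otimes> s \<noteq> \<zero>" using s integral_iff by simp
      ultimately show ?thesis using that s m_lcancel by simp
    qed
    have "(a, b, c) \<noteq> (\<zero>, \<zero>, \<zero>)" using 4(2) t' s by (auto simp: homog_coords_def)
    then show thesis
      using coeff_gauss[OF abc] cube[of a b] cube[of b c] 4(3,4) abc t' that(2) by blast
  qed
qed

end

section \<open>Twists between degenerate Sklyanin algebras\<close>

text \<open>
  The composite system from \<open>A\<close> to \<open>B\<close> has the steps \<open>\<beta> \<circ> \<sigma> \<circ> \<beta>\<^sup>-\<^sup>1\<close>.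
\<close>

lemma twist_through_isomorphisms:
  assumes \<rho>: "twisting_system K C D \<rho>"
    and \<rho>_step: "\<And>i x. x \<in> carrier C \<Longrightarrow> \<rho> (i + 1) x = \<sigma> (\<rho> i x)"
    and \<alpha>: "twisting_system K C A \<alpha>" and \<alpha>_const: "\<And>i x. x \<in> carrier C \<Longrightarrow> \<alpha> i x = \<alpha> 0 x"
    and \<beta>: "twisting_system K D B \<beta>" and \<beta>_const: "\<And>i x. x \<in> carrier D \<Longrightarrow> \<beta> i x = \<beta> 0 x"
  obtains \<phi> \<tau> where "twisting_system K A B \<phi>"
    and "\<And>i x. x \<in> carrier A \<Longrightarrow> \<phi> (i + 1) x = \<tau> (\<phi> i x)"
proof -
  interpret \<rho>: twisting_system K C D \<rho> by fact
  interpret \<alpha>: twisting_system K C A \<alpha> by fact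
  interpret \<beta>: twisting_system K D B \<beta> by fact
  interpret \<alpha>': twisting_system K A C \<alpha>.inverse by (rule \<alpha>.twisting_system_inverse)
  have \<alpha>'_const: "\<alpha>.inverse i x = \<alpha>.inverse 0 x" if "x \<in> carrier A" for i x
    using that \<alpha>_const[OF \<alpha>.inverse_closed[OF that, of 0], of i]
    by (intro \<alpha>.inverse_eqI) (simp_all add: \<alpha>.inverse_closed \<alpha>.map_inverse)
  let ?\<phi> = "\<lambda>i. \<beta> i \<circ> (\<rho> i \<circ> \<alpha>.inverse i)"
  let ?\<tau> = "\<lambda>y. \<beta> 0 (\<sigma> (\<beta>.inverse 0 y))"
  have "twisting_system K A B ?\<phi>"
    using twisting_system.twisting_system_compose[OF
        twisting_system.twisting_system_compose[OF \<alpha>'.twisting_system_axioms \<rho>] \<beta>] .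
  moreover have "?\<phi> (i + 1) x = ?\<tau> (?\<phi> i x)" if x: "x \<in> carrier A" for i x
  proof -
    define y where "y = \<alpha>.inverse 0 x"
    have y: "y \<in> carrier C" "\<alpha>.inverse j x = y" for j
      unfolding y_def using x \<alpha>.inverse_closed \<alpha>'_const by blast+
    have r: "\<rho> j y \<in> carrier D" for j using \<rho>.map_closed[OF y(1)] .
    have "?\<phi> (i + 1) x = \<beta> 0 (\<sigma> (\<rho> i y))"
      using \<beta>_const[OF r, of "i + 1" "i + 1"] \<rho>_step[OF y(1), of i] by (simp add: y(2))
    also have "\<rho> i y = \<beta>.inverse 0 (\<beta> i (\<rho> i y))"
      by (subst \<beta>_const[OF r]) (simp add: \<beta>.inverse_map[OF r])
    finally show ?thesis by (simp add: y(2))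
  qed
  ultimately show thesis by (rule that)
qed

context cube_root_of_unity
begin

text \<open>
  The twisting system does not depend on its index, so it is an isomorphism of graded algebras.
\<close>

lemma isomorphic_monomial_algebra:
  assumes "proj_point K (a, b, c) \<in> degenerate_points K"
  obtains e \<alpha> where
    "twisting_system K (quot_alg free (relation_ideal K (delta K e))) (sklyanin K (a, b, c)) \<alpha>"
    and "\<And>i j x. \<alpha> i x = \<alpha> j x"
proof -
  have abc: "a \<in> carrier K" "b \<in> carrier K" "c \<in> carrier K"
  proof -
    have "coeff (a, b, c) d \<in> carrier K" for d
      using assms by (rule degenerate_cases) (simp_all add: delta_def gauss_def)
    from this[of 1] this[of 2] this[of 0] show "a \<in> carrier K" "b \<in> carrier K" "c \<in> carrier K"
      by (simp_all add: coeff_def)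
  qed
  from assms show thesis
  proof (rule degenerate_cases)
    fix s e assume s: "s \<in> carrier K" "s \<noteq> \<zero>" "coeff (a, b, c) = (\<lambda>d. s \<otimes> delta K e d)"
    have "sklyanin K (a, b, c) = quot_alg free (relation_ideal K (delta K (e + 0)))"
      using sklyanin_eq[OF abc] relation_ideal_scale[OF s(1,2), of "delta K e"] s(3)
      by (simp add: delta_def)
    then have "twisting_system K (quot_alg free (relation_ideal K (delta K e))) (sklyanin K (a, b, c))
        (\<lambda>i X. substitute K (rotation K 0) i ` X)"
      using twisting_system_rotation[of e 0] by simp
    moreover have "substitute K (rotation K 0) i = substitute K (rotation K 0) j" for i j
    proof (intro ext)
      show "substitute K (rotation K 0) i p w = substitute K (rotation K 0) j p w" for p w
      proof (induction w arbitrary: i j p)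
        case (Cons y w)
        have "rotation K 0 i = rotation K 0 j" by (simp add: fun_eq_iff rotation_def)
        then show ?case by (simp only: substitute.simps Cons.IH[of "i + 1" _ "j + 1"])
      qed simp
    qed
    ultimately show thesis by (metis (no_types, lifting) that)
  next
    fix s g e assume s: "s \<in> carrier K" "s \<noteq> \<zero>" "coeff (a, b, c) = (\<lambda>d. s \<otimes> gauss g e d)"
    have "sklyanin K (a, b, c) = quot_alg free (relation_ideal K (gauss g e))"
      using sklyanin_eq[OF abc] relation_ideal_scale[OF s(1,2), of "gauss g e"] s(3)
      by (simp add: gauss_def)
    then have "twisting_system K (quot_alg free (relation_ideal K (delta K e))) (sklyanin K (a, b, c))
        (\<lambda>i X. substitute K (fourier g) i ` X)"
      using twisting_system_fourier[of e g] by simp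
    moreover have "substitute K (fourier g) i = substitute K (fourier g) j" for i j
      by (intro ext substitute_fourier_const)
    ultimately show thesis by (metis (no_types, lifting) that)
  qed
qed

lemma rotation_step:
  assumes "X \<in> carrier (quot_alg free (relation_ideal K (delta K e)))"
  shows "substitute K (rotation K m) (i + 1) ` X
    = (\<lambda>q w. q (map (\<lambda>y. gen (num y - m)) w)) ` (substitute K (rotation K m) i ` X)"
proof -
  interpret F: graded_algebra K "free :: ('k, gen3 list \<Rightarrow> 'k) graded_alg" by (rule free_graded_algebra)
  have S: "s \<in> range (relation K (delta K e)) \<Longrightarrow> \<exists>n. s \<in> homog free n" for s
  proof -
    have "delta K e d \<in> carrier K" for d by (simp add: delta_def)
    then show "s \<in> range (relation K (delta K e)) \<Longrightarrow> \<exists>n. s \<in> homog free n"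
      using relation_homog[of "delta K e"] by blast
  qed
  interpret I: graded_ideal K free "relation_ideal K (delta K e)"
    unfolding relation_ideal_def by (rule F.graded_ideal_genideal[OF S])
  obtain x where "x \<in> carrier free" "X = I.proj x" using assms by (auto simp: I.quot_carrier)
  then have "X \<subseteq> carrier free" using F.M.a_r_coset_subset_G[OF I.I.a_subset] by blast
  then have "coeffs p" if "p \<in> X" for p using that by (auto simp: free_simps)
  then have "substitute K (rotation K m) (i + 1) p
      = (\<lambda>w. substitute K (rotation K m) i p (map (\<lambda>y. gen (num y - m)) w))" if "p \<in> X" for p
    using that by (intro ext substitute_rotation_Suc)
  then show ?thesis by (simp add: image_image)
qed

lemma twisting_system_sklyanin:
  assumes "proj_point K (a, b, c) \<in> degenerate_points K"
    and "proj_point K (a', b', c') \<in> degenerate_points K"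
  obtains \<phi> \<tau> where "twisting_system K (sklyanin K (a, b, c)) (sklyanin K (a', b', c')) \<phi>"
    and "\<And>i x. x \<in> carrier (sklyanin K (a, b, c)) \<Longrightarrow> \<phi> (i + 1) x = \<tau> (\<phi> i x)"
proof -
  obtain e \<alpha> where \<alpha>: "twisting_system K (quot_alg free (relation_ideal K (delta K e))) (sklyanin K (a, b, c)) \<alpha>"
    "\<And>i j x. \<alpha> i x = \<alpha> j x"
    by (rule isomorphic_monomial_algebra[OF assms(1)]) (rule that)
  obtain e' \<beta> where \<beta>: "twisting_system K (quot_alg free (relation_ideal K (delta K e'))) (sklyanin K (a', b', c')) \<beta>"
    "\<And>i j x. \<beta> i x = \<beta> j x"
    by (rule isomorphic_monomial_algebra[OF assms(2)]) (rule that)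
  have "twisting_system K (quot_alg free (relation_ideal K (delta K e)))
      (quot_alg free (relation_ideal K (delta K e'))) (\<lambda>i X. substitute K (rotation K (e' - e)) i ` X)"
    using twisting_system_rotation[of e "e' - e"] by simp
  then show thesis
  proof (rule twist_through_isomorphisms[where
        \<sigma> = "(`) (\<lambda>q w. q (map (\<lambda>y. gen (num y - (e' - e))) w))", OF _ _ \<alpha> \<beta>])
    show "substitute K (rotation K (e' - e)) (i + 1) ` X
        = (\<lambda>q w. q (map (\<lambda>y. gen (num y - (e' - e))) w)) ` (substitute K (rotation K (e' - e)) i ` X)"
      if "X \<in> carrier (quot_alg free (relation_ideal K (delta K e)))" for i X
      using that by (rule rotation_step)
  qed (rule that)
qed

end

theorem corollary1p2:
  fixes K :: "('k, 'r) ring_scheme" and \<omega> a b c a' b' c' :: 'k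
  assumes "field K"
    and "\<omega> \<in> carrier (mult_of K)" and "group.ord (mult_of K) \<omega> = 3"
    and "proj_point K (a, b, c) \<in> degenerate_points K"
    and "proj_point K (a', b', c') \<in> degenerate_points K"
  shows "is_zhang_twist_of K (sklyanin K (a, b, c)) (sklyanin K (a', b', c')) \<and>
    is_zhang_twist_of K (sklyanin K (a', b', c')) (sklyanin K (a, b, c)) \<and>
    equivalent_categories
      (Gr (sklyanin K (a, b, c))
        :: (((gen3 list \<Rightarrow> 'k) set, 'm) graded_mod, 'm \<Rightarrow> 'm) cat)
      (Gr (sklyanin K (a', b', c'))
        :: (((gen3 list \<Rightarrow> 'k) set, 'm) graded_mod, 'm \<Rightarrow> 'm) cat)"
proof -
  interpret K: field K by fact
  interpret U: group "mult_of K" by (rule K.field_mult_group)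
  have \<omega>: "\<omega> \<in> carrier K" using assms(2) by simp
  have "\<omega> [^]\<^bsub>mult_of K\<^esub> (3::nat) = \<one>\<^bsub>mult_of K\<^esub>"
    using U.pow_ord_eq_1[OF assms(2)] assms(3) by simp
  then have cube: "\<omega> \<otimes>\<^bsub>K\<^esub> \<omega> \<otimes>\<^bsub>K\<^esub> \<omega> = \<one>\<^bsub>K\<^esub>"
    using \<omega> by (simp add: numeral_3_eq_3)
  have "\<omega> \<noteq> \<one>\<^bsub>K\<^esub>" using assms(3) U.ord_eq_1[OF assms(2)] by auto
  then interpret cube_root_of_unity K \<omega>
    using \<omega> cube by (intro cube_root_of_unity.intro cube_root_of_unity_axioms.intro assms(1))
  obtain \<phi> \<tau> where \<phi>: "twisting_system K (sklyanin K (a, b, c)) (sklyanin K (a', b', c')) \<phi>"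
    "\<And>i x. x \<in> carrier (sklyanin K (a, b, c)) \<Longrightarrow> \<phi> (i + 1) x = \<tau> (\<phi> i x)"
    using twisting_system_sklyanin[OF assms(4,5)] by blast
  obtain \<psi> \<upsilon> where \<psi>: "twisting_system K (sklyanin K (a', b', c')) (sklyanin K (a, b, c)) \<psi>"
    "\<And>i x. x \<in> carrier (sklyanin K (a', b', c')) \<Longrightarrow> \<psi> (i + 1) x = \<upsilon> (\<psi> i x)"
    using twisting_system_sklyanin[OF assms(5,4)] by blast
  show ?thesis
    using twisting_system.is_zhang_twist[OF \<phi>] twisting_system.is_zhang_twist[OF \<psi>]
      twisting_system.equivalent_module_categories[OF \<phi>(1)] by blast
qed

end
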